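(* Let $k$ be a field with $\operatorname{char}(k)\neq 2$. Let $C_1$ be an octonion division algebra over $k$ and let $C_2$ be a separable quadratic field extension of $k$, a quaternion division algebra over $k$ or an octonion division algebra over $k$, such that $C_1$ and $C_2$ have linkage number $1$. Let $\mathcal S, q_A, f_A, \mathbf i_1,\mathbf i_2,a, V$ be as in the context, let $u\in V\setminus\{0\}$ be arbitrary, and let $e_0,e_1,Q,F,J,r$ be as in the context. Put $X:=C_1\otimes_k C_2$, with $$\bullet:\mathcal S\times X\to X:\ s\bullet x:=s(rx),\qquad \beta:X\times X\to\mathcal S:\ \beta(x,y):=x\overline y-y\overline x .$$ Then: (1) $X$ is a special $J$-module (under $\bullet$, with $J=\mathcal S$ as vector space), and $\beta$ satisfies, for all $j\in J$, $x,y\in X$, the (equivalent) identities $U_j\beta(x,y)=\beta(j\bullet x,j\bullet y)$ and $j.\beta(x,y)=\tfrac12\bigl(\beta(j\bullet x,y)+\beta(x,j\bullet y)\bigr)$, where $.$ and $U$ denote the product and the $U$-operator of $J$. (2) With $X_0:=\{x\in X\mid e_0\bullet x=x\}$, the following two conditions hold: $$\beta(v\bullet x,x)\bullet x=v\bullet\bigl(u\bullet(\beta(u\bullet x,x)\bullet x)\bigr)\quad\text{for all }x\in X_0,\ v\in V,$$ $$\beta(u\bullet x,x)\neq 0\quad\text{for all }x\in X_0\setminus\{0\}.$$ (3) With $$\cdot: X_0\times V\to X_0:\ x\cdot v:=v\bullet(u\bullet x),\qquad h:X_0\times X_0\to V:\ h(x,y):=\beta(u\bullet x,y),$$ the tuple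 $(k,V,Q,u,X_0,\cdot,h)$ is a quadrangular algebra, of type $E_6$, $E_7$ or $E_8$ according as $\dim_k C_2=2,4$ or $8$.
   Context: **Composition algebras.** A composition algebra over $k$ is a unital (not necessarily commutative or associative) $k$-algebra $C$ with a multiplicative norm form $q$ (a nondegenerate quadratic form); with $f$ its associated bilinear form, $\overline x:=f(x,1)1-x$ is its standard involution. Its dimension is $1,2,4$ (quaternion algebra) or $8$ (octonion algebra). Norm forms are Pfister forms, where $\langle\!\langle a_1,\dots,a_n\rangle\!\rangle:=\bigotimes_{i=1}^n\langle 1,a_i\rangle$. Two Pfister forms $q_1,q_2$ (not necessarily of the same fold) are $r$-linked if there is an $r$-fold Pfister form $p$ with $q_1\simeq p\otimes q_3$, $q_2\simeq p\otimes q_4$ for Pfister forms $q_3,q_4$ (possibly $\langle1\rangle$); the linkage number of $q_1,q_2$ is the $r$ such that they are $r$-linked but not $(r+1)$-linked. The linkage number of composition algebras $C_1,C_2$ is that of their norm forms $q_1,q_2$. **Setup.** $C_1\otimes_kC_2$ carries the involution $x\mapsto\overline x$ which is the tensor product of the standard involutions. Let $S_i=\{x\in C_i\mid\overline x=-x\}$ and $\mathcal S=\{x\in C_1\otimes_k C_2\mid \overline x=-x\}=(S_1\otimes1)\oplus(1\otimes S_2)$. The Albert form is $q_A:\mathcal S\to k$, $q_A(s_1\otimes1+1\otimes s_2)=q_1(s_1)-q_2(s_2)$, with associated bilinear form $f_A(s,t)=q_A(s+t)-q_A(s)-q_A(t)$. Put $(s_1\otimes 1+1\otimes s_2)^\natural:=s_1\otimes1-1\otimes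 s_2$, and for $q_A(s)\ne0$, $s^{-1}:=-\frac1{q_A(s)}s^\natural$. Because the linkage number is $1$, one can choose $\mathbf i_1\in S_1$, $\mathbf i_2\in S_2$ with $\mathbf i_1^2=\mathbf i_2^2=:a\in k$ ($a$ is then a nonsquare in $k$); fix such a choice. Let $V:=\langle\mathbf i_1\otimes1,1\otimes\mathbf i_2\rangle^\perp\subset\mathcal S$ (orthogonal with respect to $f_A$). For the chosen $u\in V\setminus\{0\}$ (one has $q_A(u)\neq0$) put $$e_0=\mathbf i_1\otimes1+1\otimes\mathbf i_2,\quad e_1=\tfrac{q_A(u)}{4a}(\mathbf i_1\otimes1-1\otimes\mathbf i_2),\quad Q:=\tfrac1{q_A(u)}q_A|_V,$$ let $F$ be the bilinear form of $Q$, and $r:=(e_0+e_1)^{-1}\in\mathcal S$ in the sense above. The Jordan algebra $J$ is the vector space $\mathcal S=ke_0\oplus V\oplus ke_1$ with commutative product $(t_1e_i).(t_2e_j)=\delta_{ij}t_1t_2e_i$, $(te_i).v=\tfrac12tv$, $v.w=\tfrac12F(v,w)(e_0+e_1)$ ($i,j\in\{0,1\}$, $t,t_1,t_2\in k$, $v,w\in V$); it is the reduced spin factor of $(k,V,Q)$. **Jordan algebras and modules.** A Jordan $k$-algebra is a unital commutative $k$-algebra with $(x^2y)x=x^2(yx)$; $U_xy:=2x(xy)-x^2y$. A special $J$-module is a $k$-vector space $X$ with a $k$-bilinear action $\bullet:J\times X\to X$ such that $1\bullet x=x$ and $(U_jj')\bullet x=j\bullet(j'\bullet(j\bullet x))$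 for all $j,j'\in J$, $x\in X$. **Quadrangular algebras.** For $\operatorname{char}(k)\ne2$, a quadrangular algebra is a 7-tuple $(k,L,q,1,X,\cdot,h)$ with $L$ a $k$-vector space, $q:L\to k$ an anisotropic quadratic form, $1\in L$ with $q(1)=1$ (base point), $X$ a nontrivial $k$-vector space, and maps $X\times L\to X:(x,v)\mapsto x\cdot v$ (also written $xv$), $h:X\times X\to L$ such that, with $f(v,w)=q(v+w)-q(v)-q(w)$, $v^\sigma=f(1,v)1-v$, $v^{-1}=v^\sigma/q(v)$: (A1) $\cdot$ is $k$-bilinear; (A2) $x\cdot1=x$; (A3) $(xv)v^{-1}=x$ for $v\ne0$; (B1) $h$ is $k$-bilinear; (B2) $h(x,yv)=h(y,xv)+f(h(x,y),1)v$; (B3) $f(h(xv,y),1)=f(h(x,y),v)$; (C) $\theta(x,v):=\tfrac12h(x,xv)$; (D1) with $\pi(x)=\theta(x,1)$, $x\theta(x,v)=(x\pi(x))v$; (D2) $\pi(x)\neq0$ for $x\ne0$ (for all $x,y\in X$, $v\in L$). It is of type $E_6$, $E_7$ or $E_8$ if $(k,L,q)$ is a quadratic space of that type and $\dim_kX=8$, $16$ or $32$ respectively. A quadratic space $(k,L,q)$ with base point is of type $E_6,E_7,E_8$ if it is anisotropic and there is a separable quadratic field extension $E/k$ with norm $N$ such that, respectively: $q\cong N\otimes\langle1,s_2,s_3\rangle$ with $s_i\in k^*$; $q\cong N\otimes\langle1,s_2,s_3,s_4\rangle$ with $s_i\in k^*$ and $s_2s_3s_4\notin N(E)$; $q\cong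 N\otimes\langle1,s_2,\dots,s_6\rangle$ with $s_i\in k^*$ and $-s_2s_3s_4s_5s_6\in N(E)$. *)

theory Defs
  imports
    "HOL-Computational_Algebra.Polynomial"
    "HOL-Library.Product_Plus"
begin

section \<open>Linear maps, bilinear maps and quadratic forms on subspaces\<close>

definition linear_on ::
  "('k \<Rightarrow> 'a \<Rightarrow> 'a) \<Rightarrow> ('k \<Rightarrow> 'b \<Rightarrow> 'b) \<Rightarrow> 'a set \<Rightarrow> 'b set \<Rightarrow>
   ('a::ab_group_add \<Rightarrow> 'b::ab_group_add) \<Rightarrow> bool" where
  "linear_on sA sB A B f \<longleftrightarrow>
     (\<forall>x\<in>A. f x \<in> B) \<and>
     (\<forall>x\<in>A. \<forall>y\<in>A. f (x + y) = f x + f y) \<and>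
     (\<forall>c. \<forall>x\<in>A. f (sA c x) = sB c (f x))"

definition bilinear_on ::
  "('k \<Rightarrow> 'a \<Rightarrow> 'a) \<Rightarrow> ('k \<Rightarrow> 'b \<Rightarrow> 'b) \<Rightarrow> ('k \<Rightarrow> 'c \<Rightarrow> 'c) \<Rightarrow> 'a set \<Rightarrow> 'b set \<Rightarrow> 'c set \<Rightarrow>
   ('a::ab_group_add \<Rightarrow> 'b::ab_group_add \<Rightarrow> 'c::ab_group_add) \<Rightarrow> bool" where
  "bilinear_on sA sB sC A B C f \<longleftrightarrow>
     (\<forall>x\<in>A. linear_on sB sC B C (f x)) \<and>
     (\<forall>y\<in>B. linear_on sA sC A C (\<lambda>x. f x y))"

definition polar :: "('a::ab_group_add \<Rightarrow> 'k::ab_group_add) \<Rightarrow> 'a \<Rightarrow> 'a \<Rightarrow> 'k" where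
  "polar q x y = q (x + y) - q x - q y"

definition quadratic_form_on ::
  "('k::field \<Rightarrow> 'a::ab_group_add \<Rightarrow> 'a) \<Rightarrow> 'a set \<Rightarrow> ('a \<Rightarrow> 'k) \<Rightarrow> bool" where
  "quadratic_form_on s L q \<longleftrightarrow>
     (\<forall>c. \<forall>x\<in>L. q (s c x) = c\<^sup>2 * q x) \<and>
     bilinear_on s s (*) L L UNIV (polar q)"

definition nondegenerate_on :: "'a::ab_group_add set \<Rightarrow> ('a \<Rightarrow> 'k::field) \<Rightarrow> bool" where
  "nondegenerate_on L q \<longleftrightarrow> (\<forall>x\<in>L. (\<forall>y\<in>L. polar q x y = 0) \<longrightarrow> x = 0)"

definition anisotropic_on :: "'a::ab_group_add set \<Rightarrow> ('a \<Rightarrow> 'k::field) \<Rightarrow> bool" where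
  "anisotropic_on L q \<longleftrightarrow> (\<forall>x\<in>L. q x = 0 \<longrightarrow> x = 0)"

(* q on L is isometric to N \<otimes> \<langle>d_1,...,d_n\<rangle>, i.e. to the form sum_i d_i N(y_i) on E^n, where N is
   a quadratic form on E.  The maps \<phi> i are the n components of the isometry L \<rightarrow> E^n. *)
definition isometric_to_multiple ::
  "('k::field \<Rightarrow> 'a::ab_group_add \<Rightarrow> 'a) \<Rightarrow> 'a set \<Rightarrow> ('a \<Rightarrow> 'k) \<Rightarrow>
   ('k \<Rightarrow> 'e::ab_group_add \<Rightarrow> 'e) \<Rightarrow> ('e \<Rightarrow> 'k) \<Rightarrow> 'k list \<Rightarrow> bool" where
  "isometric_to_multiple s L q sE N ds \<longleftrightarrow>
     (\<exists>\<phi> :: nat \<Rightarrow> 'a \<Rightarrow> 'e.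
        (\<forall>i<length ds. linear_on s sE L UNIV (\<phi> i)) \<and>
        (\<forall>y :: nat \<Rightarrow> 'e. \<exists>!x. x \<in> L \<and> (\<forall>i<length ds. \<phi> i x = y i)) \<and>
        (\<forall>x\<in>L. q x = (\<Sum>i<length ds. ds ! i * N (\<phi> i x))))"

definition isometric_to_diagonal ::
  "('k::field \<Rightarrow> 'a::ab_group_add \<Rightarrow> 'a) \<Rightarrow> 'a set \<Rightarrow> ('a \<Rightarrow> 'k) \<Rightarrow> 'k list \<Rightarrow> bool" where
  "isometric_to_diagonal s L q ds \<longleftrightarrow> isometric_to_multiple s L q (*) (\<lambda>t. t\<^sup>2) ds"

section \<open>Nonassociative algebras and composition algebras\<close>

record ('k, 'a) nonassoc_algebra =
  scal :: "'k \<Rightarrow> 'a \<Rightarrow> 'a"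
  mul :: "'a \<Rightarrow> 'a \<Rightarrow> 'a"
  unt :: 'a

record ('k, 'a) normed_algebra = "('k, 'a) nonassoc_algebra" +
  nrm :: "'a \<Rightarrow> 'k"

abbreviation algebra_dim :: "('k::field, 'a::ab_group_add, 'z) nonassoc_algebra_scheme \<Rightarrow> nat" where
  "algebra_dim C \<equiv> vector_space.dim (scal C) UNIV"

definition unital_algebra :: "('k::field, 'a::ab_group_add, 'z) nonassoc_algebra_scheme \<Rightarrow> bool" where
  "unital_algebra C \<longleftrightarrow>
     vector_space (scal C) \<and>
     bilinear_on (scal C) (scal C) (scal C) UNIV UNIV UNIV (mul C) \<and>
     (\<forall>x. mul C (unt C) x = x \<and> mul C x (unt C) = x)"

definition division_algebra :: "('k::field, 'a::ab_group_add, 'z) nonassoc_algebra_scheme \<Rightarrow> bool" where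
  "division_algebra C \<longleftrightarrow>
     unital_algebra C \<and> unt C \<noteq> 0 \<and>
     (\<forall>x. x \<noteq> 0 \<longrightarrow> bij (\<lambda>y. mul C x y) \<and> bij (\<lambda>y. mul C y x))"

definition composition_algebra :: "('k::field, 'a::ab_group_add) normed_algebra \<Rightarrow> bool" where
  "composition_algebra C \<longleftrightarrow>
     unital_algebra C \<and>
     quadratic_form_on (scal C) UNIV (nrm C) \<and>
     nondegenerate_on UNIV (nrm C) \<and>
     (\<forall>x y. nrm C (mul C x y) = nrm C x * nrm C y)"

definition quaternion_algebra :: "('k::field, 'a::ab_group_add) normed_algebra \<Rightarrow> bool" where
  "quaternion_algebra C \<longleftrightarrow> composition_algebra C \<and> algebra_dim C = 4"

definition octonion_algebra :: "('k::field, 'a::ab_group_add) normed_algebra \<Rightarrow> bool" where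
  "octonion_algebra C \<longleftrightarrow> composition_algebra C \<and> algebra_dim C = 8"

definition conj_of :: "('k::field, 'a::ab_group_add) normed_algebra \<Rightarrow> 'a \<Rightarrow> 'a" where
  "conj_of C x = scal C (polar (nrm C) x (unt C)) (unt C) - x"

definition skew_of :: "('k::field, 'a::ab_group_add) normed_algebra \<Rightarrow> 'a set" where
  "skew_of C = {x. conj_of C x = - x}"

section \<open>Separable quadratic field extensions\<close>

definition poly_at :: "('k::field, 'a::ab_group_add, 'z) nonassoc_algebra_scheme \<Rightarrow> 'k poly \<Rightarrow> 'a \<Rightarrow> 'a" where
  "poly_at E p x = fold_coeffs (\<lambda>c y. scal E c (unt E) + mul E x y) p 0"

definition field_extension :: "('k::field, 'a::ab_group_add, 'z) nonassoc_algebra_scheme \<Rightarrow> bool" where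
  "field_extension E \<longleftrightarrow>
     unital_algebra E \<and> unt E \<noteq> 0 \<and>
     (\<forall>x y z. mul E (mul E x y) z = mul E x (mul E y z)) \<and>
     (\<forall>x y. mul E x y = mul E y x) \<and>
     (\<forall>x. x \<noteq> 0 \<longrightarrow> (\<exists>y. mul E x y = unt E))"

definition separable_quadratic_extension ::
  "('k::field, 'a::ab_group_add, 'z) nonassoc_algebra_scheme \<Rightarrow> bool" where
  "separable_quadratic_extension E \<longleftrightarrow>
     field_extension E \<and> algebra_dim E = 2 \<and>
     (\<forall>x. \<exists>p. coprime p (pderiv p) \<and> poly_at E p x = 0)"

(* N(x) = x x^\<sigma>, with \<sigma> the nontrivial element of Gal(E/k). *)
definition quadratic_extension_norm ::
  "('k::field, 'a::ab_group_add, 'z) nonassoc_algebra_scheme \<Rightarrow> ('a \<Rightarrow> 'k) \<Rightarrow> bool" where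
  "quadratic_extension_norm E N \<longleftrightarrow>
     (\<exists>\<sigma>. bij \<sigma> \<and> linear_on (scal E) (scal E) UNIV UNIV \<sigma> \<and>
          (\<forall>x y. \<sigma> (mul E x y) = mul E (\<sigma> x) (\<sigma> y)) \<and> \<sigma> \<noteq> id \<and>
          (\<forall>x. scal E (N x) (unt E) = mul E x (\<sigma> x)))"

section \<open>Pfister forms and linkage\<close>

definition tensor_diag :: "'k::field list \<Rightarrow> 'k list \<Rightarrow> 'k list" where
  "tensor_diag ds es = concat (map (\<lambda>d. map (\<lambda>e. d * e) es) ds)"

primrec pfister :: "'k::field list \<Rightarrow> 'k list" where
  "pfister [] = [1]"
| "pfister (a # as) = tensor_diag [1, a] (pfister as)"

definition r_linked ::
  "nat \<Rightarrow> ('k::field, 'a::ab_group_add) normed_algebra \<Rightarrow> ('k, 'b::ab_group_add) normed_algebra \<Rightarrow> bool" where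
  "r_linked r C1 C2 \<longleftrightarrow>
     (\<exists>ps as bs. length ps = r \<and> 0 \<notin> set ps \<union> set as \<union> set bs \<and>
        isometric_to_diagonal (scal C1) UNIV (nrm C1) (tensor_diag (pfister ps) (pfister as)) \<and>
        isometric_to_diagonal (scal C2) UNIV (nrm C2) (tensor_diag (pfister ps) (pfister bs)))"

definition has_linkage_number ::
  "('k::field, 'a::ab_group_add) normed_algebra \<Rightarrow> ('k, 'b::ab_group_add) normed_algebra \<Rightarrow> nat \<Rightarrow> bool" where
  "has_linkage_number C1 C2 r \<longleftrightarrow> r_linked r C1 C2 \<and> \<not> r_linked (Suc r) C1 C2"

section \<open>Tensor products\<close>

(* The universal property is required only for bilinear maps into k, because a definition cannot
   quantify over target types.  Over a field this is enough: see tensor_product_universal below. *)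
definition is_tensor_product ::
  "('k::field \<Rightarrow> 'a::ab_group_add \<Rightarrow> 'a) \<Rightarrow> ('k \<Rightarrow> 'b::ab_group_add \<Rightarrow> 'b) \<Rightarrow>
   ('k \<Rightarrow> 't::ab_group_add \<Rightarrow> 't) \<Rightarrow> ('a \<Rightarrow> 'b \<Rightarrow> 't) \<Rightarrow> bool" where
  "is_tensor_product s1 s2 sT t \<longleftrightarrow>
     vector_space s1 \<and> vector_space s2 \<and> vector_space sT \<and>
     bilinear_on s1 s2 sT UNIV UNIV UNIV t \<and>
     (\<forall>\<phi>. bilinear_on s1 s2 (*) UNIV UNIV UNIV \<phi> \<longrightarrow>
        (\<exists>!\<Phi>. linear_on sT (*) UNIV UNIV \<Phi> \<and> (\<forall>x y. \<Phi> (t x y) = \<phi> x y)))"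

record ('k, 'a, 'b, 't) tensor_algebra = "('k, 't) nonassoc_algebra" +
  tens :: "'a \<Rightarrow> 'b \<Rightarrow> 't"

definition is_tensor_algebra ::
  "('k::field, 'a::ab_group_add) normed_algebra \<Rightarrow> ('k, 'b::ab_group_add) normed_algebra \<Rightarrow>
   ('k, 'a, 'b, 't::ab_group_add) tensor_algebra \<Rightarrow> bool" where
  "is_tensor_algebra C1 C2 T \<longleftrightarrow>
     is_tensor_product (scal C1) (scal C2) (scal T) (tens T) \<and>
     bilinear_on (scal T) (scal T) (scal T) UNIV UNIV UNIV (mul T) \<and>
     (\<forall>x y x' y'. mul T (tens T x y) (tens T x' y') = tens T (mul C1 x x') (mul C2 y y')) \<and>
     unt T = tens T (unt C1) (unt C2)"

definition tensor_conj ::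
  "('k::field, 'a::ab_group_add) normed_algebra \<Rightarrow> ('k, 'b::ab_group_add) normed_algebra \<Rightarrow>
   ('k, 'a, 'b, 't::ab_group_add) tensor_algebra \<Rightarrow> 't \<Rightarrow> 't" where
  "tensor_conj C1 C2 T =
     (THE \<sigma>. linear_on (scal T) (scal T) UNIV UNIV \<sigma> \<and>
             (\<forall>x y. \<sigma> (tens T x y) = tens T (conj_of C1 x) (conj_of C2 y)))"

lemma linear_on_UNIV_iff:
  assumes "vector_space sA" "vector_space sB"
  shows "linear_on sA sB UNIV UNIV f \<longleftrightarrow> Vector_Spaces.linear sA sB f"
proof -
  have "Vector_Spaces.linear sA sB f \<longleftrightarrow> module_hom_axioms sA sB f"
    using assms by (auto simp: Vector_Spaces.linear_def module_hom_def vector_space_def module_def)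
  then show ?thesis by (auto simp: linear_on_def module_hom_axioms_def)
qed

lemma vector_space_times: "vector_space ((*) :: 'k::field \<Rightarrow> 'k \<Rightarrow> 'k)"
  by unfold_locales (auto simp: algebra_simps)

lemma bilinear_on_mult:
  fixes f :: "'a::ab_group_add \<Rightarrow> 'k::field" and g :: "'b::ab_group_add \<Rightarrow> 'k"
  assumes "linear_on s1 (*) UNIV UNIV f" "linear_on s2 (*) UNIV UNIV g"
  shows "bilinear_on s1 s2 (*) UNIV UNIV UNIV (\<lambda>x y. f x * g y)"
  using assms by (simp add: bilinear_on_def linear_on_def distrib_left distrib_right mult_ac)

lemma tensor_span:
  assumes T: "is_tensor_product s1 s2 sT t"
  shows "module.span sT (range (\<lambda>(x, y). t x y)) = UNIV"
proof (rule ccontr)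
  have vT: "vector_space sT" and ex1: "\<And>\<phi>. bilinear_on s1 s2 (*) UNIV UNIV UNIV \<phi> \<Longrightarrow>
        (\<exists>!\<Phi>. linear_on sT (*) UNIV UNIV \<Phi> \<and> (\<forall>x y. \<Phi> (t x y) = \<phi> x y))"
    using T by (auto simp: is_tensor_product_def)
  interpret T: vector_space sT by (rule vT)
  interpret K: vector_space "(*) :: 'a \<Rightarrow> 'a \<Rightarrow> 'a" by (rule vector_space_times)
  interpret TK: vector_space_pair sT "(*) :: 'a \<Rightarrow> 'a \<Rightarrow> 'a" ..
  let ?R = "range (\<lambda>(x, y). t x y)"
  assume ne: "T.span ?R \<noteq> UNIV"
  obtain B where B: "B \<subseteq> ?R" "T.independent B" "?R \<subseteq> T.span B"
    using T.maximal_independent_subset by blast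
  have sp: "T.span B = T.span ?R"
    by (rule T.span_eq[THEN iffD2]) (use B T.span_superset in blast)
  then obtain w where w: "w \<notin> T.span B" using ne by blast
  have ind: "T.independent (insert w B)"
    using B(2) w by (simp add: T.independent_insert)
  obtain g where g: "Vector_Spaces.linear sT (*) g" "\<forall>x\<in>insert w B. g x = (if x = w then 1 else 0)"
    using TK.linear_independent_extend[OF ind, of "\<lambda>x. if x = w then 1 else 0"] by blast
  have wB: "w \<notin> B" using w T.span_base by blast
  have g0: "g x = 0" if "x \<in> T.span ?R" for x
    by (rule TK.linear_eq_0_on_span[OF g(1), of B]) (use g(2) wB that sp in auto)
  have b0: "bilinear_on s1 s2 (*) UNIV UNIV UNIV (\<lambda>_ _. 0 :: 'a)"
    by (auto simp: bilinear_on_def linear_on_def)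
  have "linear_on sT (*) UNIV UNIV g \<and> (\<forall>x y. g (t x y) = 0)"
    using g(1) g0 T.span_base[of _ ?R] by (auto simp: linear_on_UNIV_iff[OF vT vector_space_times])
  moreover have "linear_on sT (*) UNIV UNIV (\<lambda>_. 0 :: 'a) \<and> (\<forall>x y. (\<lambda>_. 0 :: 'a) (t x y) = 0)"
    by (auto simp: linear_on_def)
  ultimately have "g = (\<lambda>_. 0)" using ex1[OF b0] by blast
  moreover have "g w = 1" using g(2) by simp
  ultimately show False by simp
qed

theorem tensor_product_universal:
  fixes s1 :: "'k::field \<Rightarrow> 'a::ab_group_add \<Rightarrow> 'a" and s2 :: "'k \<Rightarrow> 'b::ab_group_add \<Rightarrow> 'b"
    and sT :: "'k \<Rightarrow> 't::ab_group_add \<Rightarrow> 't" and sW :: "'k \<Rightarrow> 'w::ab_group_add \<Rightarrow> 'w"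
  assumes T: "is_tensor_product s1 s2 sT t"
    and W: "vector_space sW"
    and \<phi>: "bilinear_on s1 s2 sW UNIV UNIV UNIV \<phi>"
  shows "\<exists>!\<Phi>. linear_on sT sW UNIV UNIV \<Phi> \<and> (\<forall>x y. \<Phi> (t x y) = \<phi> x y)"
proof -
  have v1: "vector_space s1" and v2: "vector_space s2" and vT: "vector_space sT"
    and t: "bilinear_on s1 s2 sT UNIV UNIV UNIV t"
    and ex1: "\<And>\<phi>. bilinear_on s1 s2 (*) UNIV UNIV UNIV \<phi> \<Longrightarrow>
        (\<exists>!\<Phi>. linear_on sT (*) UNIV UNIV \<Phi> \<and> (\<forall>x y. \<Phi> (t x y) = \<phi> x y))"
    using T by (auto simp: is_tensor_product_def)
  note vK = vector_space_times[where 'k = 'k]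
  interpret A: vector_space s1 by (rule v1)
  interpret B: vector_space s2 by (rule v2)
  interpret T: vector_space sT by (rule vT)
  interpret W: vector_space sW by (rule W)
  interpret K: vector_space "(*) :: 'k \<Rightarrow> 'k \<Rightarrow> 'k" by (rule vK)
  interpret TK: vector_space_pair sT "(*) :: 'k \<Rightarrow> 'k \<Rightarrow> 'k" ..
  interpret AK: vector_space_pair s1 "(*) :: 'k \<Rightarrow> 'k \<Rightarrow> 'k" ..
  interpret BK: vector_space_pair s2 "(*) :: 'k \<Rightarrow> 'k \<Rightarrow> 'k" ..
  interpret TW: vector_space_pair sT sW ..
  interpret AW: vector_space_pair s1 sW ..
  interpret BW: vector_space_pair s2 sW ..
  obtain M1 where M1: "A.independent M1" "UNIV \<subseteq> A.span M1"
    using A.maximal_independent_subset[of UNIV] by blast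
  obtain M2 where M2: "B.independent M2" "UNIV \<subseteq> B.span M2"
    using B.maximal_independent_subset[of UNIV] by blast
  have dual: "\<exists>\<Psi>. Vector_Spaces.linear sT (*) \<Psi> \<and> (\<forall>b'\<in>M1. \<forall>c'\<in>M2. \<Psi> (t b' c') = (if b' = b \<and> c' = c then 1 else 0))"
    for b c
  proof -
    obtain f where f: "Vector_Spaces.linear s1 (*) f" "\<forall>x\<in>M1. f x = (if x = b then 1 else 0)"
      using AK.linear_independent_extend[OF M1(1), of "\<lambda>x. if x = b then 1 else 0"] by blast
    obtain g where g: "Vector_Spaces.linear s2 (*) g" "\<forall>x\<in>M2. g x = (if x = c then 1 else 0)"
      using BK.linear_independent_extend[OF M2(1), of "\<lambda>x. if x = c then 1 else 0"] by blast
    have f': "f (x + y) = f x + f y" "f (s1 d x) = d * f x" for x y d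
      using f(1) by (simp_all add: AK.linear_add AK.linear_scale)
    have g': "g (x + y) = g x + g y" "g (s2 d x) = d * g x" for x y d
      using g(1) by (simp_all add: BK.linear_add BK.linear_scale)
    have "bilinear_on s1 s2 (*) UNIV UNIV UNIV (\<lambda>x y. f x * g y)"
      by (rule bilinear_on_mult) (simp_all add: f' g' linear_on_def)
    from ex1[OF this] obtain \<Psi> where
      "linear_on sT (*) UNIV UNIV \<Psi>" "\<forall>x y. \<Psi> (t x y) = f x * g y" by blast
    then show ?thesis
      using f(2) g(2) by (intro exI[of _ \<Psi>]) (auto simp: linear_on_UNIV_iff[OF vT vK])
  qed
  let ?p = "\<lambda>(b, c). t b c"
  have inj: "inj_on ?p (M1 \<times> M2)"
  proof (rule inj_onI, clarify)
    fix b c b' c' assume m: "b \<in> M1" "c \<in> M2" "b' \<in> M1" "c' \<in> M2" and eq: "t b c = t b' c'"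
    obtain \<Psi> where "\<forall>d\<in>M1. \<forall>e\<in>M2. \<Psi> (t d e) = (if d = b \<and> e = c then 1 else (0::'k))"
      using dual by blast
    with m eq show "b = b' \<and> c = c'" by (metis zero_neq_one)
  qed
  have ind: "T.independent (?p ` (M1 \<times> M2))"
    unfolding T.dependent_def
  proof clarify
    fix b c assume m: "b \<in> M1" "c \<in> M2" and s: "t b c \<in> T.span (?p ` (M1 \<times> M2) - {t b c})"
    obtain \<Psi> where \<Psi>: "Vector_Spaces.linear sT (*) \<Psi>"
      "\<forall>d\<in>M1. \<forall>e\<in>M2. \<Psi> (t d e) = (if d = b \<and> e = c then 1 else 0)"
      using dual by blast
    have "\<Psi> (t b c) = 0"
      by (rule TK.linear_eq_0_on_span[OF \<Psi>(1) _ s]) (use \<Psi>(2) in auto)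
    with \<Psi>(2) m show False by simp
  qed
  obtain \<Phi> where \<Phi>: "Vector_Spaces.linear sT sW \<Phi>"
    "\<forall>x\<in>?p ` (M1 \<times> M2). \<Phi> x = (\<lambda>(b, c). \<phi> b c) (inv_into (M1 \<times> M2) ?p x)"
    using TW.linear_independent_extend[OF ind,
        of "\<lambda>x. (\<lambda>(b, c). \<phi> b c) (inv_into (M1 \<times> M2) ?p x)"] by blast
  have \<Phi>b: "\<Phi> (t b c) = \<phi> b c" if "b \<in> M1" "c \<in> M2" for b c
    using \<Phi>(2) that inv_into_f_f[OF inj, of "(b, c)"] by auto
  have l1: "Vector_Spaces.linear s1 sW (\<lambda>x. \<phi> x y)" and l2: "Vector_Spaces.linear s2 sW (\<lambda>y. \<phi> x y)" for x y
    using \<phi> by (auto simp: bilinear_on_def linear_on_UNIV_iff[OF v1 W] linear_on_UNIV_iff[OF v2 W])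
  have tl: "t (x + x') y = t x y + t x' y" "t (s1 d x) y = sT d (t x y)"
    "t x (z + z') = t x z + t x z'" "t x (s2 d z) = sT d (t x z)" for x x' y z z' d
    using t by (auto simp: bilinear_on_def linear_on_def)
  have m1: "Vector_Spaces.linear s1 sW (\<lambda>x. \<Phi> (t x y))" for y
    by (subst linear_on_UNIV_iff[OF v1 W, symmetric])
      (auto simp: linear_on_def tl TW.linear_add[OF \<Phi>(1)] TW.linear_scale[OF \<Phi>(1)])
  have m2: "Vector_Spaces.linear s2 sW (\<lambda>y. \<Phi> (t x y))" for x
    by (subst linear_on_UNIV_iff[OF v2 W, symmetric])
      (auto simp: linear_on_def tl TW.linear_add[OF \<Phi>(1)] TW.linear_scale[OF \<Phi>(1)])
  have \<Phi>1: "\<Phi> (t b y) = \<phi> b y" if "b \<in> M1" for b y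
    by (rule BW.linear_eq_on_span[OF m2 l2, of M2]) (use \<Phi>b that M2(2) in auto)
  have \<Phi>t: "\<Phi> (t x y) = \<phi> x y" for x y
    by (rule AW.linear_eq_on_span[OF m1 l1, of M1]) (use \<Phi>1 M1(2) in auto)
  show ?thesis
  proof (rule ex1I)
    show "linear_on sT sW UNIV UNIV \<Phi> \<and> (\<forall>x y. \<Phi> (t x y) = \<phi> x y)"
      using \<Phi>(1) \<Phi>t by (simp add: linear_on_UNIV_iff[OF vT W])
  next
    fix \<Psi> assume P: "linear_on sT sW UNIV UNIV \<Psi> \<and> (\<forall>x y. \<Psi> (t x y) = \<phi> x y)"
    then have l: "Vector_Spaces.linear sT sW \<Psi>" by (simp add: linear_on_UNIV_iff[OF vT W])
    show "\<Psi> = \<Phi>"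
    proof
      fix z
      have eq: "\<Psi> p = \<Phi> p" if "p \<in> range ?p" for p using that P \<Phi>t by auto
      have "z \<in> T.span (range ?p)" using tensor_span[OF T] by simp
      with eq show "\<Psi> z = \<Phi> z" by (rule TW.linear_eq_on_span[OF l \<Phi>(1)])
    qed
  qed
qed

lemma conj_of_linear:
  assumes "composition_algebra C"
  shows "linear_on (scal C) (scal C) UNIV UNIV (conj_of C)"
proof -
  interpret vector_space "scal C"
    using assms by (simp add: composition_algebra_def unital_algebra_def)
  have "bilinear_on (scal C) (scal C) (*) UNIV UNIV UNIV (polar (nrm C))"
    using assms by (simp add: composition_algebra_def quadratic_form_on_def)
  then show ?thesis
    by (auto simp: bilinear_on_def linear_on_def conj_of_def scale_left_distrib scale_right_diff_distrib)
qed

lemma tensor_conj_props: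
  assumes C1: "composition_algebra C1" and C2: "composition_algebra C2"
    and T: "is_tensor_algebra C1 C2 T"
  shows "linear_on (scal T) (scal T) UNIV UNIV (tensor_conj C1 C2 T)"
    and "tensor_conj C1 C2 T (tens T x y) = tens T (conj_of C1 x) (conj_of C2 y)"
proof -
  have P: "is_tensor_product (scal C1) (scal C2) (scal T) (tens T)"
    using T by (simp add: is_tensor_algebra_def)
  then have vT: "vector_space (scal T)"
    and t: "bilinear_on (scal C1) (scal C2) (scal T) UNIV UNIV UNIV (tens T)"
    by (auto simp: is_tensor_product_def)
  have "bilinear_on (scal C1) (scal C2) (scal T) UNIV UNIV UNIV
      (\<lambda>x y. tens T (conj_of C1 x) (conj_of C2 y))"
    using t conj_of_linear[OF C1] conj_of_linear[OF C2]
    by (simp add: bilinear_on_def linear_on_def)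
  from theI'[OF tensor_product_universal[OF P vT this]]
  show "linear_on (scal T) (scal T) UNIV UNIV (tensor_conj C1 C2 T)"
    and "tensor_conj C1 C2 T (tens T x y) = tens T (conj_of C1 x) (conj_of C2 y)"
    by (auto simp: tensor_conj_def)
qed

section \<open>The Albert form\<close>

definition tensor_skew ::
  "('k::field, 'a::ab_group_add) normed_algebra \<Rightarrow> ('k, 'b::ab_group_add) normed_algebra \<Rightarrow>
   ('k, 'a, 'b, 't::ab_group_add) tensor_algebra \<Rightarrow> 't set" where
  "tensor_skew C1 C2 T = {x. tensor_conj C1 C2 T x = - x}"

(* The components of an element of S = (S_1 \<otimes> 1) \<oplus> (1 \<otimes> S_2). *)
definition skew_parts ::
  "('k::field, 'a::ab_group_add) normed_algebra \<Rightarrow> ('k, 'b::ab_group_add) normed_algebra \<Rightarrow>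
   ('k, 'a, 'b, 't::ab_group_add) tensor_algebra \<Rightarrow> 't \<Rightarrow> 'a \<times> 'b" where
  "skew_parts C1 C2 T s =
     (THE (s1, s2). s1 \<in> skew_of C1 \<and> s2 \<in> skew_of C2 \<and>
        s = tens T s1 (unt C2) + tens T (unt C1) s2)"

definition albert_form ::
  "('k::field, 'a::ab_group_add) normed_algebra \<Rightarrow> ('k, 'b::ab_group_add) normed_algebra \<Rightarrow>
   ('k, 'a, 'b, 't::ab_group_add) tensor_algebra \<Rightarrow> 't \<Rightarrow> 'k" where
  "albert_form C1 C2 T s =
     (case skew_parts C1 C2 T s of (s1, s2) \<Rightarrow> nrm C1 s1 - nrm C2 s2)"

definition skew_natural ::
  "('k::field, 'a::ab_group_add) normed_algebra \<Rightarrow> ('k, 'b::ab_group_add) normed_algebra \<Rightarrow>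
   ('k, 'a, 'b, 't::ab_group_add) tensor_algebra \<Rightarrow> 't \<Rightarrow> 't" where
  "skew_natural C1 C2 T s =
     (case skew_parts C1 C2 T s of (s1, s2) \<Rightarrow> tens T s1 (unt C2) - tens T (unt C1) s2)"

definition skew_inverse ::
  "('k::field, 'a::ab_group_add) normed_algebra \<Rightarrow> ('k, 'b::ab_group_add) normed_algebra \<Rightarrow>
   ('k, 'a, 'b, 't::ab_group_add) tensor_algebra \<Rightarrow> 't \<Rightarrow> 't" where
  "skew_inverse C1 C2 T s =
     - scal T (1 / albert_form C1 C2 T s) (skew_natural C1 C2 T s)"

section \<open>Jordan algebras and special modules\<close>

definition U_op ::
  "('k::field \<Rightarrow> 'a::ab_group_add \<Rightarrow> 'a) \<Rightarrow> ('a \<Rightarrow> 'a \<Rightarrow> 'a) \<Rightarrow> 'a \<Rightarrow> 'a \<Rightarrow> 'a" where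
  "U_op s jm x y = s 2 (jm x (jm x y)) - jm (jm x x) y"

locale jordan_algebra = vector_space s
  for s :: "'k::field \<Rightarrow> 'a::ab_group_add \<Rightarrow> 'a" +
  fixes J :: "'a set" and jm :: "'a \<Rightarrow> 'a \<Rightarrow> 'a" and e :: 'a
  assumes subspace: "subspace J"
    and bilinear: "bilinear_on s s s J J J jm"
    and unit_mem: "e \<in> J"
    and unit: "x \<in> J \<Longrightarrow> jm e x = x"
    and commute: "x \<in> J \<Longrightarrow> y \<in> J \<Longrightarrow> jm x y = jm y x"
    and jordan: "x \<in> J \<Longrightarrow> y \<in> J \<Longrightarrow> jm (jm (jm x x) y) x = jm (jm x x) (jm y x)"

locale special_jordan_module = jordan_algebra s J jm e + X: vector_space sX
  for s :: "'k::field \<Rightarrow> 'a::ab_group_add \<Rightarrow> 'a"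
    and J jm e
    and sX :: "'k \<Rightarrow> 'x::ab_group_add \<Rightarrow> 'x" +
  fixes X :: "'x set" and act :: "'a \<Rightarrow> 'x \<Rightarrow> 'x"
  assumes subspace_X: "X.subspace X"
    and bilinear_act: "bilinear_on s sX sX J X X act"
    and unit_act: "x \<in> X \<Longrightarrow> act e x = x"
    and U_act: "j \<in> J \<Longrightarrow> j' \<in> J \<Longrightarrow> x \<in> X \<Longrightarrow> act (U_op s jm j j') x = act j (act j' (act j x))"

(* The reduced spin factor of (k,V,Q), realised on an internal direct sum k e0 \<oplus> V \<oplus> k e1. *)
definition spin_parts ::
  "('k::field \<Rightarrow> 'a::ab_group_add \<Rightarrow> 'a) \<Rightarrow> 'a set \<Rightarrow> 'a \<Rightarrow> 'a \<Rightarrow> 'a \<Rightarrow> 'k \<times> 'a \<times> 'k" where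
  "spin_parts s V e0 e1 x = (THE (t0, v, t1). v \<in> V \<and> x = s t0 e0 + v + s t1 e1)"

definition spin_mult ::
  "('k::field \<Rightarrow> 'a::ab_group_add \<Rightarrow> 'a) \<Rightarrow> 'a set \<Rightarrow> ('a \<Rightarrow> 'k) \<Rightarrow> 'a \<Rightarrow> 'a \<Rightarrow> 'a \<Rightarrow> 'a \<Rightarrow> 'a" where
  "spin_mult s V Q e0 e1 x y =
     (case spin_parts s V e0 e1 x of (t0, v, t1) \<Rightarrow>
      case spin_parts s V e0 e1 y of (t0', w, t1') \<Rightarrow>
        s (t0 * t0') e0 + s (t1 * t1') e1
        + s (1/2 * t0) w + s (1/2 * t1) w + s (1/2 * t0') v + s (1/2 * t1') v
        + s (1/2 * polar Q v w) (e0 + e1))"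

section \<open>Quadrangular algebras\<close>

definition base_sigma ::
  "('k::field \<Rightarrow> 'l::ab_group_add \<Rightarrow> 'l) \<Rightarrow> ('l \<Rightarrow> 'k) \<Rightarrow> 'l \<Rightarrow> 'l \<Rightarrow> 'l" where
  "base_sigma s q b v = s (polar q b v) b - v"

definition base_inverse ::
  "('k::field \<Rightarrow> 'l::ab_group_add \<Rightarrow> 'l) \<Rightarrow> ('l \<Rightarrow> 'k) \<Rightarrow> 'l \<Rightarrow> 'l \<Rightarrow> 'l" where
  "base_inverse s q b v = s (1 / q v) (base_sigma s q b v)"

definition theta_map ::
  "('k::field \<Rightarrow> 'l::ab_group_add \<Rightarrow> 'l) \<Rightarrow> ('x \<Rightarrow> 'l \<Rightarrow> 'x) \<Rightarrow> ('x \<Rightarrow> 'x \<Rightarrow> 'l) \<Rightarrow> 'x \<Rightarrow> 'l \<Rightarrow> 'l" where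
  "theta_map s act h x v = s (1/2) (h x (act x v))"

locale quadrangular_algebra = L: vector_space sL + X: vector_space sX
  for sL :: "'k::field \<Rightarrow> 'l::ab_group_add \<Rightarrow> 'l"
    and sX :: "'k \<Rightarrow> 'x::ab_group_add \<Rightarrow> 'x" +
  fixes L :: "'l set" and q :: "'l \<Rightarrow> 'k" and b :: 'l
    and X :: "'x set" and act :: "'x \<Rightarrow> 'l \<Rightarrow> 'x" and h :: "'x \<Rightarrow> 'x \<Rightarrow> 'l"
  assumes char_not_2: "CHAR('k) \<noteq> 2"
    and subspace_L: "L.subspace L"
    and quadratic: "quadratic_form_on sL L q"
    and anisotropic: "anisotropic_on L q"
    and base_mem: "b \<in> L"
    and base: "q b = 1"
    and subspace_X: "X.subspace X"
    and nontrivial: "X \<noteq> {0}"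
    and A1: "bilinear_on sX sL sX X L X act"
    and A2: "x \<in> X \<Longrightarrow> act x b = x"
    and A3: "x \<in> X \<Longrightarrow> v \<in> L \<Longrightarrow> v \<noteq> 0 \<Longrightarrow> act (act x v) (base_inverse sL q b v) = x"
    and B1: "bilinear_on sX sX sL X X L h"
    and B2: "x \<in> X \<Longrightarrow> y \<in> X \<Longrightarrow> v \<in> L \<Longrightarrow>
               h x (act y v) = h y (act x v) + sL (polar q (h x y) b) v"
    and B3: "x \<in> X \<Longrightarrow> y \<in> X \<Longrightarrow> v \<in> L \<Longrightarrow>
               polar q (h (act x v) y) b = polar q (h x y) v"
    and D1: "x \<in> X \<Longrightarrow> v \<in> L \<Longrightarrow>
               act x (theta_map sL act h x v) = act (act x (theta_map sL act h x b)) v"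
    and D2: "x \<in> X \<Longrightarrow> x \<noteq> 0 \<Longrightarrow> theta_map sL act h x b \<noteq> 0"

(* Every quadratic extension of k is isomorphic to one whose underlying additive group is k \<times> k,
   so it suffices to let E range over the algebra structures on that type. *)
definition norm_multiple ::
  "('k::field \<Rightarrow> 'l::ab_group_add \<Rightarrow> 'l) \<Rightarrow> 'l set \<Rightarrow> ('l \<Rightarrow> 'k) \<Rightarrow>
   ('k, 'k \<times> 'k) nonassoc_algebra \<Rightarrow> ('k \<times> 'k \<Rightarrow> 'k) \<Rightarrow> 'k list \<Rightarrow> bool" where
  "norm_multiple s L q E N ds \<longleftrightarrow>
     separable_quadratic_extension E \<and> quadratic_extension_norm E N \<and>
     0 \<notin> set ds \<and> isometric_to_multiple s L q (scal E) N ds"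

definition quadratic_space_E6 ::
  "('k::field \<Rightarrow> 'l::ab_group_add \<Rightarrow> 'l) \<Rightarrow> 'l set \<Rightarrow> ('l \<Rightarrow> 'k) \<Rightarrow> bool" where
  "quadratic_space_E6 s L q \<longleftrightarrow> anisotropic_on L q \<and>
     (\<exists>E N s2 s3. norm_multiple s L q E N [1, s2, s3])"

definition quadratic_space_E7 ::
  "('k::field \<Rightarrow> 'l::ab_group_add \<Rightarrow> 'l) \<Rightarrow> 'l set \<Rightarrow> ('l \<Rightarrow> 'k) \<Rightarrow> bool" where
  "quadratic_space_E7 s L q \<longleftrightarrow> anisotropic_on L q \<and>
     (\<exists>E N s2 s3 s4. norm_multiple s L q E N [1, s2, s3, s4] \<and> s2 * s3 * s4 \<notin> range N)"

definition quadratic_space_E8 ::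
  "('k::field \<Rightarrow> 'l::ab_group_add \<Rightarrow> 'l) \<Rightarrow> 'l set \<Rightarrow> ('l \<Rightarrow> 'k) \<Rightarrow> bool" where
  "quadratic_space_E8 s L q \<longleftrightarrow> anisotropic_on L q \<and>
     (\<exists>E N s2 s3 s4 s5 s6. norm_multiple s L q E N [1, s2, s3, s4, s5, s6] \<and>
        - (s2 * s3 * s4 * s5 * s6) \<in> range N)"

definition quadrangular_algebra_E6 where
  "quadrangular_algebra_E6 sL sX L q b X act h \<longleftrightarrow>
     quadrangular_algebra sL sX L q b X act h \<and> quadratic_space_E6 sL L q \<and> vector_space.dim sX X = 8"

definition quadrangular_algebra_E7 where
  "quadrangular_algebra_E7 sL sX L q b X act h \<longleftrightarrow>
     quadrangular_algebra sL sX L q b X act h \<and> quadratic_space_E7 sL L q \<and> vector_space.dim sX X = 16"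

definition quadrangular_algebra_E8 where
  "quadrangular_algebra_E8 sL sX L q b X act h \<longleftrightarrow>
     quadrangular_algebra sL sX L q b X act h \<and> quadratic_space_E8 sL L q \<and> vector_space.dim sX X = 32"

end

theory Submission
  imports Defs
begin

text \<open>Left multiplications by skew elements satisfy the Clifford relation of the Albert form,
  twisted by the natural map.  Passing to the isotope with unit \<open>e = e\<^sub>0 + e\<^sub>1\<close> turns it into
  \<open>s \<bullet> (s \<bullet> x) = tr(s) (s \<bullet> x) - N(s) x\<close> with \<open>N = q\<^sub>A / q\<^sub>A(e)\<close>, so \<open>X\<close> is a special module.  The map
  \<open>\<beta>\<close> is the adjoint of left multiplication: \<open>f\<^sub>A(\<beta>(x, y), s)\<close> is the value at \<open>x\<close> and \<open>s\<^sup>\<natural> y\<close> of the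
  tensor product of the two norm forms.  Hence \<open>\<beta>\<close> is compatible with the action, which is (1).  Given
  (1) and (2), the axioms of a quadrangular algebra follow by Peirce calculus.

  The cubic identity in (2) says that \<open>v\<^sup>-\<^sup>1 \<bullet> (\<beta>(v \<bullet> x, x) \<bullet> x)\<close> does not depend on \<open>v \<in> V\<close>.  For \<open>v\<close> in one
  of the two summands of \<open>V\<close> this is comparatively easy; the mixed case comes down to an identity
  between left multiplications, obtained by expressing triple products in a composition algebra
  through the quaternion algebra generated by two anticommuting left multiplications.  If
  \<open>\<beta>(u \<bullet> x, x)\<close> vanishes, then so does every \<open>\<beta>(v \<bullet> x, x)\<close>, and the contractions of \<open>x\<close> with the elements of
  \<open>C\<^sub>1\<close> then yield an isotropic vector of \<open>V\<close>.  But \<open>V\<close> is anisotropic, since elements \<open>s\<close>, \<open>t\<close> of equal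
  norm orthogonal to \<open>i\<^sub>1\<close> and \<open>i\<^sub>2\<close> would give the two norms a common 2-fold Pfister factor.\<close>

section \<open>Orthogonal families\<close>

text \<open>The obstacle in the mixed case is nonassociativity: a component of
  \<open>\<beta>\<close> is itself a product and then multiplies x from the left. Once it is
  expanded through i and s, only words in fixed left multiplications and the trilinear map
  \<open>t3\<close>, which behaves like a product of matrices, remain. On \<open>X0\<close> the left
  multiplications by i1 and i2 agree, and this relation collapses the words until the sum vanishes.
  If both summands of V are nonzero, the mixed case settles the pure one as well, because the two
  actions anticommute. Only for \<open>dim C2 = 2\<close>, where the second summand is 0, is a pure
  vector computed directly. For regularity the key operator is the product of the left
  multiplications by i, s and is: it is a scalar on each of the two quaternionic halves of the
  octonions, with opposite signs. Vanishing of \<open>\<beta>\<close> therefore balances the norms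
  of the contractions over the two halves. The type of Q comes from the action of i1 and i2 on the
  two components of V. It makes V a space over k(sqrt a), and an orthogonal basis over this field
  that begins with u has 1 as its first coefficient.\<close>

locale bilinear_form_on = vector_space scale
  for scale :: "'k::field \<Rightarrow> 'v::ab_group_add \<Rightarrow> 'v" (infixr "*s" 75) +
  fixes L :: "'v set" and B :: "'v \<Rightarrow> 'v \<Rightarrow> 'k"
  assumes sub: "subspace L"
    and B_add: "x \<in> L \<Longrightarrow> y \<in> L \<Longrightarrow> z \<in> L \<Longrightarrow> B (x + y) z = B x z + B y z"
    and B_scale: "x \<in> L \<Longrightarrow> z \<in> L \<Longrightarrow> B (c *s x) z = c * B x z"
    and B_sym: "x \<in> L \<Longrightarrow> y \<in> L \<Longrightarrow> B x y = B y x"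
begin

lemma B_zero: "z \<in> L \<Longrightarrow> B 0 z = 0"
  using B_scale[of 0 z 0] subspace_0[OF sub] by simp

lemma B_sum:
  assumes "finite I" "\<And>i. i \<in> I \<Longrightarrow> F i \<in> L" "z \<in> L"
  shows "B (\<Sum>i\<in>I. c i *s F i) z = (\<Sum>i\<in>I. c i * B (F i) z)"
  using assms(1,2)
proof (induction I)
  case empty
  then show ?case by (simp add: B_zero assms)
next
  case (insert j I)
  have "(\<Sum>i\<in>I. c i *s F i) \<in> L" using insert by (auto intro!: subspace_sum[OF sub] subspace_scale[OF sub])
  then show ?case using insert by (simp add: B_add B_scale assms subspace_scale[OF sub])
qed

definition orthogonal :: "'v list \<Rightarrow> bool" where
  "orthogonal bs \<longleftrightarrow> set bs \<subseteq> L \<and> sorted_wrt (\<lambda>x y. B x y = 0) bs \<and> (\<forall>b\<in>set bs. B b b \<noteq> 0)"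

lemma orthogonal_nth:
  assumes "orthogonal bs" "i < length bs" "j < length bs" "i \<noteq> j"
  shows "B (bs ! i) (bs ! j) = 0"
proof -
  have L: "bs ! i \<in> L" "bs ! j \<in> L" using assms by (auto simp: orthogonal_def)
  have *: "B (bs ! i) (bs ! j) = 0" if "i < j" "j < length bs" for i j
    using assms(1) that by (simp add: orthogonal_def sorted_wrt_iff_nth_less)
  show ?thesis using assms(2-4) *[of i j] *[of j i] B_sym[OF L]
    by (cases i j rule: linorder_cases) simp_all
qed

lemma orthogonal_distinct:
  assumes "orthogonal bs" shows "distinct bs"
  unfolding distinct_conv_nth
proof (intro allI impI)
  fix i j assume ij: "i < length bs" "j < length bs" "i \<noteq> j"
  have "B (bs ! j) (bs ! j) \<noteq> 0" using assms ij by (simp add: orthogonal_def)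
  then show "bs ! i \<noteq> bs ! j" using orthogonal_nth[OF assms ij] by metis
qed

lemma orthogonal_sum:
  assumes "orthogonal bs" "j < length bs"
  shows "B (\<Sum>i<length bs. c i *s bs ! i) (bs ! j) = c j * B (bs ! j) (bs ! j)"
proof -
  have "bs ! i \<in> L" if "i < length bs" for i using assms that by (auto simp: orthogonal_def)
  then have "B (\<Sum>i<length bs. c i *s bs ! i) (bs ! j) = (\<Sum>i<length bs. c i * B (bs ! i) (bs ! j))"
    using assms by (intro B_sum) auto
  also have "\<dots> = (\<Sum>i<length bs. if i = j then c j * B (bs ! j) (bs ! j) else 0)"
    by (intro sum.cong refl) (simp add: orthogonal_nth[OF assms(1) _ assms(2)])
  finally show ?thesis using assms(2) by simp
qed

lemma span_list: "span (set bs) = range (\<lambda>c. \<Sum>i<length bs. c i *s bs ! i)"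
proof (rule span_unique)
  show "set bs \<subseteq> range (\<lambda>c. \<Sum>i<length bs. c i *s bs ! i)"
  proof
    fix b assume "b \<in> set bs"
    then obtain j where j: "j < length bs" "b = bs ! j" by (auto simp: in_set_conv_nth)
    have "(\<Sum>i<length bs. (if i = j then 1 else 0) *s bs ! i) = (\<Sum>i<length bs. if i = j then bs ! i else 0)"
      by (intro sum.cong) auto
    then have "b = (\<Sum>i<length bs. (if i = j then 1 else 0) *s bs ! i)" using j by simp
    then show "b \<in> range (\<lambda>c. \<Sum>i<length bs. c i *s bs ! i)"
      by (rule range_eqI[where f = "\<lambda>c. \<Sum>i<length bs. c i *s bs ! i" and x = "\<lambda>i. if i = j then 1 else 0"])
  qed
  show "range (\<lambda>c. \<Sum>i<length bs. c i *s bs ! i) \<subseteq> T" if "set bs \<subseteq> T" "subspace T" for T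
    using that by (auto intro!: subspace_sum subspace_scale)
  show "subspace (range (\<lambda>c. \<Sum>i<length bs. c i *s bs ! i))"
    unfolding subspace_def
  proof (intro conjI ballI allI)
    show "0 \<in> range (\<lambda>c. \<Sum>i<length bs. c i *s bs ! i)"
      by (rule range_eqI[of _ _ "\<lambda>_. 0"]) simp
    fix x y c assume "x \<in> range (\<lambda>c. \<Sum>i<length bs. c i *s bs ! i)"
    then obtain d where d: "x = (\<Sum>i<length bs. d i *s bs ! i)" by blast
    show "c *s x \<in> range (\<lambda>c. \<Sum>i<length bs. c i *s bs ! i)"
      by (rule range_eqI[of _ _ "\<lambda>i. c * d i"]) (simp add: d scale_sum_right)
    assume "y \<in> range (\<lambda>c. \<Sum>i<length bs. c i *s bs ! i)"
    then obtain d' where d': "y = (\<Sum>i<length bs. d' i *s bs ! i)" by blast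
    show "x + y \<in> range (\<lambda>c. \<Sum>i<length bs. c i *s bs ! i)"
      by (rule range_eqI[of _ _ "\<lambda>i. d i + d' i"]) (simp add: d d' scale_left_distrib sum.distrib)
  qed
qed

lemma orthogonal_expand:
  assumes "orthogonal bs" "x \<in> span (set bs)"
  shows "x = (\<Sum>i<length bs. (B x (bs ! i) / B (bs ! i) (bs ! i)) *s bs ! i)"
proof -
  obtain c where c: "x = (\<Sum>i<length bs. c i *s bs ! i)" using assms span_list by auto
  have "B x (bs ! i) / B (bs ! i) (bs ! i) = c i" if "i < length bs" for i
  proof -
    have "B (bs ! i) (bs ! i) \<noteq> 0" using assms(1) that by (simp add: orthogonal_def)
    then show ?thesis using orthogonal_sum[OF assms(1) that, of c] by (simp add: c)
  qed
  then have "(\<Sum>i<length bs. (B x (bs ! i) / B (bs ! i) (bs ! i)) *s bs ! i) = (\<Sum>i<length bs. c i *s bs ! i)"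
    by (intro sum.cong refl) simp
  with c show ?thesis by simp
qed

lemma orthogonal_independent:
  assumes "orthogonal bs" shows "independent (set bs)"
proof (rule independent_if_scalars_zero)
  fix f x assume s: "(\<Sum>x\<in>set bs. f x *s x) = 0" and "x \<in> set bs"
  then obtain j where j: "j < length bs" "x = bs ! j" by (auto simp: in_set_conv_nth)
  have "(\<Sum>x\<in>set bs. f x *s x) = (\<Sum>i<length bs. f (bs ! i) *s bs ! i)"
    by (rule sum.reindex_bij_betw[OF bij_betw_nth[OF orthogonal_distinct[OF assms]], symmetric]) auto
  with s have "f (bs ! j) * B (bs ! j) (bs ! j) = B 0 (bs ! j)"
    using orthogonal_sum[OF assms j(1), of "\<lambda>i. f (bs ! i)"] by simp
  moreover have "bs ! j \<in> L" "B (bs ! j) (bs ! j) \<noteq> 0" using assms j by (auto simp: orthogonal_def)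
  ultimately show "f x = 0" by (simp add: B_zero j)
qed simp

lemma orthogonal_dim:
  assumes "orthogonal bs" shows "dim (span (set bs)) = length bs"
proof -
  have "dim (span (set bs)) = card (set bs)"
    unfolding dim_span by (rule dim_eq_card_independent[OF orthogonal_independent[OF assms]])
  also have "\<dots> = length bs" by (rule distinct_card[OF orthogonal_distinct[OF assms]])
  finally show ?thesis .
qed

lemma orthogonal_span_UNIV:
  assumes "orthogonal bs" "length bs = dim UNIV" "bs \<noteq> []"
  shows "span (set bs) = UNIV"
proof (rule ccontr)
  assume "span (set bs) \<noteq> UNIV"
  then obtain x where x: "x \<notin> span (set bs)" by blast
  obtain D where D: "independent D" "UNIV \<subseteq> span D" "card D = dim UNIV"
    using basis_exists[of UNIV] by blast
  \<comment> \<open>An infinite basis would have cardinality 0, so a positive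
    \<open>dim UNIV\<close> is what makes D finite.\<close>
  have "card D > 0" using assms(3) unfolding D(3) assms(2)[symmetric] by simp
  then have "finite D" by (rule card_ge_0_finite)
  have "independent (insert x (set bs))" using x orthogonal_independent[OF assms(1)]
    by (simp add: independent_insert)
  then have "card (insert x (set bs)) \<le> card D"
    using independent_span_bound[OF \<open>finite D\<close>, of "insert x (set bs)"] D(2) by blast
  moreover have "x \<notin> set bs" using x span_base by blast
  then have "card (insert x (set bs)) = Suc (length bs)"
    using distinct_card[OF orthogonal_distinct[OF assms(1)]] by simp
  ultimately show False using assms(2) D(3) by simp
qed

text \<open>Gram-Schmidt: a vector outside the span minus its orthogonal projection. The orthogonal
  bases of the algebras are built up in this way.\<close>

lemma orthogonal_extend:
  assumes "orthogonal bs" "length bs < dim UNIV" "L = UNIV"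
  shows "\<exists>x. x \<noteq> 0 \<and> (\<forall>b\<in>set bs. B x b = 0)"
proof -
  have "dim (span (set bs)) \<noteq> dim UNIV" using orthogonal_dim[OF assms(1)] assms(2) by linarith
  then have "span (set bs) \<noteq> UNIV" by metis
  then obtain x where x: "x \<notin> span (set bs)" by blast
  define p where "p = (\<Sum>i<length bs. (B x (bs ! i) / B (bs ! i) (bs ! i)) *s bs ! i)"
  have "p \<in> span (set bs)" unfolding p_def by (intro span_sum span_scale span_base) simp
  then have "x + (-1) *s p \<noteq> 0" using x by (metis scale_minus_left scale_one eq_neg_iff_add_eq_0 minus_minus)
  moreover have "B (x + (-1) *s p) b = 0" if b: "b \<in> set bs" for b
  proof -
    obtain j where j: "j < length bs" "b = bs ! j" using b by (auto simp: in_set_conv_nth)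
    have "B (x + (-1) *s p) b = B x b + (-1) * B p b" by (simp only: B_add B_scale UNIV_I assms(3))
    moreover have "B b b \<noteq> 0" using assms(1) b by (simp add: orthogonal_def)
    moreover have "B p b = B x b / B b b * B b b"
      unfolding p_def j(2) by (rule orthogonal_sum[OF assms(1) j(1)])
    ultimately show ?thesis by simp
  qed
  ultimately show ?thesis by blast
qed

end

section \<open>Composition algebras with anisotropic norm\<close>

text \<open>Division algebras and quadratic field extensions both satisfy these axioms, so all kinds
  of second factor are treated alike. Vectors are determined by the polar form
  (\<open>f_eqI\<close>), because f(x, x) = 2 N(x).\<close>

locale anisotropic_composition = vector_space sc
  for sc :: "'k::field \<Rightarrow> 'a::ab_group_add \<Rightarrow> 'a" (infixr "*s" 75) +
  fixes mu :: "'a \<Rightarrow> 'a \<Rightarrow> 'a" (infixl "\<cdot>" 70) and one :: 'a and N :: "'a \<Rightarrow> 'k"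
  assumes mult_add_left: "(x + y) \<cdot> z = x \<cdot> z + y \<cdot> z"
    and mult_add_right: "z \<cdot> (x + y) = z \<cdot> x + z \<cdot> y"
    and mult_scale_left [simp]: "(c *s x) \<cdot> y = c *s (x \<cdot> y)"
    and mult_scale_right [simp]: "x \<cdot> (c *s y) = c *s (x \<cdot> y)"
    and one_left [simp]: "one \<cdot> x = x" and one_right [simp]: "x \<cdot> one = x"
    and N_scale [simp]: "N (c *s x) = c\<^sup>2 * N x"
    and f_add_left: "polar N (x + y) z = polar N x z + polar N y z"
    and f_scale_left [simp]: "polar N (c *s x) z = c * polar N x z"
    and N_mult [simp]: "N (x \<cdot> y) = N x * N y"
    and anisotropic: "N x = 0 \<Longrightarrow> x = 0"
    and one_neq_zero [simp]: "one \<noteq> 0"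
    and two: "(2::'k) \<noteq> 0"
begin

abbreviation f :: "'a \<Rightarrow> 'a \<Rightarrow> 'k" where "f \<equiv> polar N"

definition cj :: "'a \<Rightarrow> 'a" where "cj x = f x one *s one - x"

lemma N_zero [simp]: "N 0 = 0" using N_scale[of 0 0] by simp

lemma N_eq_0_iff [simp]: "N x = 0 \<longleftrightarrow> x = 0" using anisotropic by auto

lemma f_sym: "f x y = f y x" by (simp add: polar_def add.commute)

lemma f_add_right: "f z (x + y) = f z x + f z y" by (simp add: f_sym[of z] f_add_left)

lemma f_scale_right [simp]: "f z (c *s x) = c * f z x" by (simp add: f_sym[of z])

lemma f_zero_left [simp]: "f 0 x = 0" using f_scale_left[of 0 0 x] by simp
lemma f_zero_right [simp]: "f x 0 = 0" by (simp add: f_sym[of x])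

lemma f_minus_left [simp]: "f (- x) y = - f x y" using f_scale_left[of "-1" x y] by simp
lemma f_minus_right [simp]: "f x (- y) = - f x y" by (simp add: f_sym[of x])

lemma f_diff_left: "f (x - y) z = f x z - f y z" using f_add_left[of x "- y" z] by simp
lemma f_diff_right: "f z (x - y) = f z x - f z y" by (simp add: f_sym[of z] f_diff_left)

lemma mult_zero_right [simp]: "x \<cdot> 0 = 0" using mult_scale_right[of x 0 0] by simp
lemma mult_minus_left [simp]: "(- x) \<cdot> y = - (x \<cdot> y)" using mult_scale_left[of "-1" x y] by simp
lemma mult_minus_right [simp]: "x \<cdot> (- y) = - (x \<cdot> y)" using mult_scale_right[of x "-1" y] by simp
lemma mult_diff_left: "(x - y) \<cdot> z = x \<cdot> z - y \<cdot> z" using mult_add_left[of x "- y" z] by simp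
lemma mult_diff_right: "z \<cdot> (x - y) = z \<cdot> x - z \<cdot> y" using mult_add_right[of z x "- y"] by simp

lemmas bilin = mult_add_left mult_add_right mult_diff_left mult_diff_right
  f_add_left f_add_right f_diff_left f_diff_right scale_left_distrib scale_right_distrib
  scale_left_diff_distrib scale_right_diff_distrib

lemma N_minus [simp]: "N (- x) = N x" using N_scale[of "-1" x] by simp

lemma N_add: "N (x + y) = N x + N y + f x y" by (simp add: polar_def)

lemma f_self: "f x x = 2 * N x"
proof -
  have "N (2 *s x) = 4 * N x" by (simp add: power2_eq_square)
  moreover have "2 *s x = x + x" using scale_left_distrib[of 1 1 x] by simp
  ultimately show ?thesis by (simp add: polar_def)
qed

lemma N_one [simp]: "N one = 1"
proof -
  have "N one * N one = N one" by (metis N_mult one_left)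
  then show ?thesis using N_eq_0_iff[of one] one_neq_zero by (metis mult_cancel_right1)
qed

lemma f_one_one [simp]: "f one one = 2" by (simp add: f_self)

lemma f_eqI: assumes "\<And>z. f x z = f y z" shows "x = y"
proof -
  have "f (x - y) (x - y) = 0" using assms by (simp add: bilin)
  then show ?thesis using two by (simp add: f_self)
qed

lemma f_mult_left: "f (x \<cdot> y) (x \<cdot> z) = N x * f y z"
  using N_mult[of x "y + z"] by (simp add: mult_add_right N_add algebra_simps)

lemma f_mult_right: "f (y \<cdot> x) (z \<cdot> x) = f y z * N x"
  using N_mult[of "y + z" x] by (simp add: mult_add_left N_add algebra_simps)

text \<open>Multiplicativity of the norm, polarized in both factors. With \<open>one\<close> in one
  place it gives the adjoint formulas, and nondegeneracy turns those into the cancellation laws and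
  the rule for conjugating a product.\<close>

lemma f_cross: "f (x \<cdot> y) (w \<cdot> z) + f (w \<cdot> y) (x \<cdot> z) = f x w * f y z"
  using f_mult_left[of "x + w" y z] by (simp add: bilin f_mult_left N_add f_sym[of w x] algebra_simps)

lemma f_adj_left: "f (x \<cdot> y) z = f y (cj x \<cdot> z)"
  using f_cross[of x y one z] by (simp add: cj_def bilin algebra_simps)

lemma f_adj_right: "f (x \<cdot> y) z = f x (z \<cdot> cj y)"
  using f_cross[of x y z one] by (simp add: cj_def bilin f_sym algebra_simps)

lemma cj_one [simp]: "cj one = one" using scale_left_distrib[of 1 1 one] by (simp add: cj_def)

lemma cj_cj [simp]: "cj (cj x) = x" by (simp add: cj_def bilin)

lemma cj_add: "cj (x + y) = cj x + cj y" by (simp add: cj_def bilin)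
lemma cj_scale [simp]: "cj (c *s x) = c *s cj x" by (simp add: cj_def bilin)
lemma cj_zero [simp]: "cj 0 = 0" by (simp add: cj_def)
lemma f_cj_cj [simp]: "f (cj x) (cj y) = f x y" by (simp add: cj_def bilin f_sym)
lemma N_cj [simp]: "N (cj x) = N x" using f_cj_cj[of x x] two by (simp add: f_self)

lemma cj_mult_cancel: "cj x \<cdot> (x \<cdot> y) = N x *s y"
  by (rule f_eqI) (simp add: f_adj_left[of "cj x"] f_mult_left)

lemma mult_cj_cancel: "x \<cdot> (cj x \<cdot> y) = N x *s y"
  using cj_mult_cancel[of "cj x" y] by simp

lemma mult_cj_cancel_right: "(y \<cdot> x) \<cdot> cj x = N x *s y"
  by (rule f_eqI) (simp add: f_adj_right[of _ "cj x"] f_mult_right)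

lemma cj_mult_cancel_right: "(y \<cdot> cj x) \<cdot> x = N x *s y"
  using mult_cj_cancel_right[of y "cj x"] by simp

lemma cj_mult: "cj (x \<cdot> y) = cj y \<cdot> cj x"
proof (rule f_eqI)
  fix z
  have "f (cj (x \<cdot> y)) z = f (x \<cdot> y) (cj z)" by (metis cj_cj f_cj_cj)
  also have "\<dots> = f y (cj x \<cdot> cj z)" by (rule f_adj_left)
  also have "\<dots> = f (cj y \<cdot> cj x) z"
    by (simp add: f_adj_left[of "cj y"] f_adj_right[of y] f_sym[of "cj x"])
  finally show "f (cj (x \<cdot> y)) z = f (cj y \<cdot> cj x) z" .
qed

lemma left_linearized: "x \<cdot> (cj y \<cdot> z) + y \<cdot> (cj x \<cdot> z) = f x y *s z"
  using mult_cj_cancel[of "x + y" z] by (simp add: bilin cj_add mult_cj_cancel N_add algebra_simps)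

lemma right_linearized: "(x \<cdot> cj y) \<cdot> z + (x \<cdot> cj z) \<cdot> y = f y z *s x"
  using cj_mult_cancel_right[of x "y + z"]
  by (simp add: bilin cj_add cj_mult_cancel_right N_add algebra_simps)

lemma mult_cj_self: "x \<cdot> cj x = N x *s one" using mult_cj_cancel[of x one] by simp

lemma mult_cj_add: "x \<cdot> cj y + y \<cdot> cj x = f x y *s one" using left_linearized[of x y one] by simp

subsection \<open>Clifford relations of the left multiplications\<close>

definition skw :: "'a set" where "skw = {s. f s one = 0}"

lemma cj_skw: "s \<in> skw \<Longrightarrow> cj s = - s" by (simp add: cj_def skw_def)

lemma skw_iff: "s \<in> skw \<longleftrightarrow> cj s = - s"
proof
  assume "cj s = - s"
  then have "f (f s one *s one) one = 0" by (simp add: cj_def)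
  then show "s \<in> skw" using two by (simp add: skw_def)
qed (rule cj_skw)

lemma subspace_skw: "subspace skw" by (auto simp: subspace_def skw_def bilin)

lemma skw_sq: "s \<in> skw \<Longrightarrow> s \<cdot> (s \<cdot> x) = - (N s *s x)"
  using mult_cj_cancel[of s x] by (simp add: cj_skw minus_equation_iff[of "s \<cdot> (s \<cdot> x)"])

lemma skw_anticomm: "s \<in> skw \<Longrightarrow> t \<in> skw \<Longrightarrow> s \<cdot> (t \<cdot> x) = - (f s t *s x) - t \<cdot> (s \<cdot> x)"
proof -
  assume "s \<in> skw" "t \<in> skw"
  then have "- (f s t *s x) = s \<cdot> (t \<cdot> x) + t \<cdot> (s \<cdot> x)"
    by (simp add: cj_skw left_linearized[of s t x, symmetric])
  then show ?thesis by simp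
qed

lemma skw_orth: "s \<in> skw \<Longrightarrow> t \<in> skw \<Longrightarrow> f s t = 0 \<Longrightarrow> s \<cdot> (t \<cdot> x) = - (t \<cdot> (s \<cdot> x))"
  using skw_anticomm[of s t x] by simp

lemma skw_adj: "s \<in> skw \<Longrightarrow> f (s \<cdot> x) y = - f x (s \<cdot> y)"
  by (simp add: f_adj_left cj_skw)

lemma f_skw_self: "s \<in> skw \<Longrightarrow> f (s \<cdot> x) x = 0"
  using skw_adj[of s x x] two by (simp add: f_sym[of x] eq_neg_iff_add_eq_0 flip: mult_2)

text \<open>The orthogonal projection onto \<open>skw\<close>.\<close>

definition im :: "'a \<Rightarrow> 'a" where "im z = z - (f z one / 2) *s one"

lemma im_skw: "im z \<in> skw" using two by (simp add: im_def skw_def bilin)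

lemma im_add: "im (x + y) = im x + im y" by (simp add: im_def bilin add_divide_distrib)
lemma im_scale [simp]: "im (c *s x) = c *s im x" by (simp add: im_def bilin)
lemma f_im: "t \<in> skw \<Longrightarrow> f (im z) t = f z t" by (simp add: im_def bilin skw_def f_sym[of one])
lemma im_decomp: "z = (f z one / 2) *s one + im z" by (simp add: im_def)
lemma im_of_skw: "s \<in> skw \<Longrightarrow> im s = s" by (simp add: im_def skw_def)

lemma cj_decomp: "cj z = (f z one / 2) *s one - im z"
proof -
  have "(f z one / 2) *s one + (f z one / 2) *s one = f z one *s one"
    using two by (simp flip: scale_left_distrib)
  then show ?thesis by (simp add: cj_def im_def algebra_simps)
qed

lemma skw_ext:
  assumes "x \<in> skw" "y \<in> skw" "\<And>t. t \<in> skw \<Longrightarrow> f x t = f y t" shows "x = y"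
proof (rule f_eqI)
  fix z
  have "f x z = f x (im z)" "f y z = f y (im z)"
    using assms(1,2) by (simp_all add: im_def bilin skw_def)
  then show "f x z = f y z" using assms(3)[OF im_skw] by simp
qed

lemma mult_eq_0_iff [simp]: "x \<cdot> y = 0 \<longleftrightarrow> x = 0 \<or> y = 0"
  by (metis N_eq_0_iff N_mult mult_eq_0_iff)

sublocale norm: bilinear_form_on sc UNIV f
  by unfold_locales (simp_all add: f_add_left, rule f_sym)

end

lemma (in anisotropic_composition) skw_perp_zero_if_dim_2:
  assumes "dim UNIV = 2" "i \<in> skw" "i \<noteq> 0" "t \<in> skw" "f t i = 0"
  shows "t = 0"
proof -
  have o: "norm.orthogonal [one, i]"
    using two assms by (simp add: norm.orthogonal_def f_self skw_def f_sym[of one i])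
  have "t \<in> span (set [one, i])" using norm.orthogonal_span_UNIV[OF o] assms(1) by simp
  from norm.orthogonal_expand[OF o this] show "t = 0"
    using assms by (simp add: skw_def lessThan_Suc)
qed

text \<open>The associative algebra generated by the left multiplications with orthogonal trace zero
  elements i and s is a quaternion algebra.\<close>

locale quaternion_pair = anisotropic_composition sc mu one N
  for sc :: "'k::field \<Rightarrow> 'a::ab_group_add \<Rightarrow> 'a" (infixr "*s" 75)
    and mu :: "'a \<Rightarrow> 'a \<Rightarrow> 'a" (infixl "\<cdot>" 70) and one :: 'a and N :: "'a \<Rightarrow> 'k" +
  fixes i s :: 'a
  assumes i_skw: "i \<in> skw" and s_skw: "s \<in> skw" and i_s: "f i s = 0"
    and i_nz: "i \<noteq> 0" and s_nz: "s \<noteq> 0"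
begin

lemma ii [simp]: "i \<cdot> (i \<cdot> x) = - (N i *s x)" by (rule skw_sq[OF i_skw])
lemma ss [simp]: "s \<cdot> (s \<cdot> x) = - (N s *s x)" by (rule skw_sq[OF s_skw])
lemma s_i: "s \<cdot> (i \<cdot> x) = - (i \<cdot> (s \<cdot> x))" by (rule skw_orth[OF s_skw i_skw]) (simp add: f_sym i_s)

lemma isi [simp]: "i \<cdot> (s \<cdot> (i \<cdot> x)) = N i *s (s \<cdot> x)" by (simp add: s_i)
lemma sis [simp]: "s \<cdot> (i \<cdot> (s \<cdot> x)) = N s *s (i \<cdot> x)" by (simp add: s_i)

lemma f_i: "f (i \<cdot> x) y = - f x (i \<cdot> y)" by (rule skw_adj[OF i_skw])
lemma f_s: "f (s \<cdot> x) y = - f x (s \<cdot> y)" by (rule skw_adj[OF s_skw])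

lemma f_i_self [simp]: "f (i \<cdot> x) x = 0" "f x (i \<cdot> x) = 0"
  using f_skw_self[OF i_skw, of x] by (simp_all add: f_sym)
lemma f_s_self [simp]: "f (s \<cdot> x) x = 0" "f x (s \<cdot> x) = 0"
  using f_skw_self[OF s_skw, of x] by (simp_all add: f_sym)
lemma f_is_self [simp]: "f (i \<cdot> (s \<cdot> x)) x = 0" "f x (i \<cdot> (s \<cdot> x)) = 0" "f (i \<cdot> x) (s \<cdot> x) = 0" "f (s \<cdot> x) (i \<cdot> x) = 0"
proof -
  have "f (i \<cdot> x) (s \<cdot> x) = 0" using f_mult_right[of i x s] by (simp add: i_s)
  then show "f (i \<cdot> (s \<cdot> x)) x = 0" "f x (i \<cdot> (s \<cdot> x)) = 0" "f (i \<cdot> x) (s \<cdot> x) = 0" "f (s \<cdot> x) (i \<cdot> x) = 0"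
    by (simp_all add: f_i f_sym)
qed

text \<open>The basis 1, s, i, is of the quaternion algebra of left multiplications, applied to
  p.\<close>

definition block :: "'a \<Rightarrow> 'a list" where "block p = [p, s \<cdot> p, i \<cdot> p, i \<cdot> (s \<cdot> p)]"

lemma block_orthogonal: "p \<noteq> 0 \<Longrightarrow> norm.orthogonal (block p)"
  using two i_nz s_nz by (simp add: norm.orthogonal_def block_def f_self f_mult_left)

text \<open>The left multiplications by i and s are skew and anticommute, so every value of f
  between the blocks reduces to one between r and an element of \<open>block p\<close>.\<close>

lemma two_blocks_orthogonal:
  assumes "p \<noteq> 0" "r \<noteq> 0" "f r p = 0" "f r (i \<cdot> p) = 0" "f r (s \<cdot> p) = 0" "f r (i \<cdot> (s \<cdot> p)) = 0"
  shows "norm.orthogonal (block p @ block r)"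
proof -
  have [simp]: "f p r = 0" "f p (i \<cdot> r) = 0" "f p (s \<cdot> r) = 0" "f p (i \<cdot> (s \<cdot> r)) = 0"
    using assms(3-) by (simp_all add: f_sym[of p] f_i f_s s_i)
  show ?thesis
    using two assms i_nz s_nz
    by (simp add: norm.orthogonal_def block_def f_self f_mult_left f_i f_s s_i)
qed

end

section \<open>Triple products expressed by the left multiplications with i and s\<close>

context quaternion_pair
begin

text \<open>For E skew with respect to f, this is the exterior product of the 2-form f(x, E y) with
  the vector-valued 1-form E.\<close>

definition cyc :: "('a \<Rightarrow> 'a) \<Rightarrow> 'a \<Rightarrow> 'a \<Rightarrow> 'a \<Rightarrow> 'a" where
  "cyc E x y z = f x (E y) *s E z + f y (E z) *s E x + f z (E x) *s E y"

text \<open>Twice the alternating part of the triple product, minus its expression by the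
  quaternion algebra generated by the left multiplications with i and s.  It is alternating, and it
  vanishes.\<close>

definition defect :: "'a \<Rightarrow> 'a \<Rightarrow> 'a \<Rightarrow> 'a" where
  "defect x y z = 2 *s ((x \<cdot> cj y) \<cdot> z) - (f x y *s z + f y z *s x - f x z *s y)
     - ((1 / N i) *s cyc (\<lambda>x. i \<cdot> x) x y z + (1 / N s) *s cyc (\<lambda>x. s \<cdot> x) x y z
        - (1 / (N i * N s)) *s cyc (\<lambda>x. i \<cdot> (s \<cdot> x)) x y z)"

lemma cyc_add:
  assumes "\<And>x y. E (x + y) = E x + E y"
  shows "cyc E (x + x') y z = cyc E x y z + cyc E x' y z"
    and "cyc E x (y + y') z = cyc E x y z + cyc E x y' z"
    and "cyc E x y (z + z') = cyc E x y z + cyc E x y z'"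
  by (simp_all add: cyc_def assms f_add_left f_add_right scale_left_distrib scale_right_distrib ac_simps)

lemma cyc_scale:
  assumes "\<And>c x. E (c *s x) = c *s E x"
  shows "cyc E (c *s x) y z = c *s cyc E x y z"
    and "cyc E x (c *s y) z = c *s cyc E x y z"
    and "cyc E x y (c *s z) = c *s cyc E x y z"
  by (simp_all add: cyc_def assms scale_right_distrib mult.commute)

lemma defect_add:
  "defect (x + x') y z = defect x y z + defect x' y z"
  "defect x (y + y') z = defect x y z + defect x y' z"
  "defect x y (z + z') = defect x y z + defect x y z'"
  by (simp_all add: defect_def cyc_add mult_add_left mult_add_right cj_add f_add_left f_add_right
      scale_left_distrib scale_right_distrib)

lemma defect_scale:
  "defect (c *s x) y z = c *s defect x y z"
  "defect x (c *s y) z = c *s defect x y z"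
  "defect x y (c *s z) = c *s defect x y z"
  by (simp_all add: defect_def cyc_scale scale_right_distrib scale_right_diff_distrib mult.commute)

lemma double: "2 *s x = x + x" "(2 * c) *s x = c *s x + c *s x" "(c * 2) *s x = c *s x + c *s x"
  by (metis one_add_one scale_left_distrib scale_one) (metis mult_2 mult_2_right scale_left_distrib)+

lemma f_flip:
  "f x (i \<cdot> y) = - f y (i \<cdot> x)" "f x (s \<cdot> y) = - f y (s \<cdot> x)" "f x (i \<cdot> (s \<cdot> y)) = - f y (i \<cdot> (s \<cdot> x))"
  by (simp_all add: f_sym[of x] f_i f_s s_i)

lemma cyc_alt:
  assumes E: "\<And>x y. f x (E y) = - f y (E x)"
  shows "cyc E x x z = 0" "cyc E x y y = 0"
proof -
  have 0: "f x (E x) = 0" for x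
    using E[of x x] two by (simp add: eq_neg_iff_add_eq_0 flip: mult_2)
  show "cyc E x x z = 0" using E[of z x] by (simp add: cyc_def 0)
  show "cyc E x y y = 0" using E[of y x] by (simp add: cyc_def 0)
qed

lemma defect_alt: "defect x x z = 0" "defect x y y = 0"
  by (simp_all add: defect_def cyc_alt[OF f_flip(1)] cyc_alt[OF f_flip(2)] cyc_alt[OF f_flip(3)] mult_cj_self cj_mult_cancel_right f_self double)

lemma defect_minus: "defect x (- y) z = - defect x y z"
  using defect_scale(2)[of x "-1" y z] by simp

lemma defect_swap: "defect x y z = - defect y x z" "defect x y z = - defect x z y"
proof -
  have "0 = defect (x + y) (x + y) z" by (simp only: defect_alt)
  also have "\<dots> = defect y x z + defect x y z" by (simp only: defect_add) (simp add: defect_alt)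
  finally have 1: "defect y x z + defect x y z = 0" by simp
  have "0 = defect x (y + z) (y + z)" by (simp only: defect_alt)
  also have "\<dots> = defect x z y + defect x y z" by (simp only: defect_add) (simp add: defect_alt)
  finally have 2: "defect x z y + defect x y z = 0" by simp
  from 1 2 show "defect x y z = - defect y x z" "defect x y z = - defect x z y"
    by (simp_all add: eq_neg_iff_add_eq_0 add.commute)
qed

text \<open>Two exchanges: x with \<open>t \<cdot> p\<close> by the polarized norm, then the
  conjugated x with the last p. After that p meets its own conjugate and cancels to N(p).\<close>

lemma triple_skw:
  assumes "t \<in> skw"
  shows "(x \<cdot> cj (t \<cdot> p)) \<cdot> p = f x (t \<cdot> p) *s p - f x p *s (t \<cdot> p) + N p *s (t \<cdot> x)"
proof -
  have "x \<cdot> cj (t \<cdot> p) = f x (t \<cdot> p) *s one - (t \<cdot> p) \<cdot> cj x"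
    using mult_cj_add[of x "t \<cdot> p"] by (simp add: algebra_simps)
  moreover have "((t \<cdot> p) \<cdot> cj x) \<cdot> p = f x p *s (t \<cdot> p) - N p *s (t \<cdot> x)"
    using right_linearized[of "t \<cdot> p" x p] by (simp add: mult_cj_cancel_right algebra_simps)
  ultimately have "(x \<cdot> cj (t \<cdot> p)) \<cdot> p = f x (t \<cdot> p) *s p - (f x p *s (t \<cdot> p) - N p *s (t \<cdot> x))"
    by (simp only: mult_diff_left mult_scale_left one_left)
  then show ?thesis by simp
qed

text \<open>Here i(sp) differs from (is)p in general, but it is orthogonal to p and so equals tp for
  a skew t that depends on p. This brings \<open>triple_skw\<close> into play; the term tx is found
  by moving the skew part of the right quotient of x by p past t, i and s.\<close>

lemma triple_is:
  "(x \<cdot> cj (i \<cdot> (s \<cdot> p))) \<cdot> p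
     = f x (i \<cdot> p) *s (s \<cdot> p) - f x (s \<cdot> p) *s (i \<cdot> p) - N p *s (i \<cdot> (s \<cdot> x))"
proof (cases "p = 0")
  case False
  \<comment> \<open>Right quotients by p, so that tp = i(sp) and zp = x.\<close>
  define t where "t = (1 / N p) *s ((i \<cdot> (s \<cdot> p)) \<cdot> cj p)"
  define z where "z = (1 / N p) *s (x \<cdot> cj p)"
  define c where "c = f z one / 2"
  have tp: "t \<cdot> p = i \<cdot> (s \<cdot> p)" and zp: "z \<cdot> p = x"
    using False by (simp_all add: t_def z_def cj_mult_cancel_right)
  have "N p * f t one = 0" using f_mult_right[of t p one] by (auto simp: tp)
  then have t: "t \<in> skw" using False by (auto simp: skw_def)
  have z: "z = c *s one + im z" unfolding c_def by (rule im_decomp)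
  let ?z = "im z"
  have zs: "?z \<in> skw" by (rule im_skw)
  have zt: "z \<cdot> w = c *s w + ?z \<cdot> w" for w by (subst z) (simp add: bilin)
  have e: "f ?z t = f z t" "f ?z i = f z i" "f ?z s = f z s"
    using t i_skw s_skw by (simp_all add: f_im)
  have "?z \<cdot> (s \<cdot> p) = - (f z s *s p) - s \<cdot> (?z \<cdot> p)"
    using skw_anticomm[OF zs s_skw, of p] by (simp add: e)
  then have "i \<cdot> (?z \<cdot> (s \<cdot> p)) = - (f z s *s (i \<cdot> p)) - i \<cdot> (s \<cdot> (?z \<cdot> p))" by (simp add: bilin)
  moreover have "?z \<cdot> (i \<cdot> (s \<cdot> p)) = - (f z i *s (s \<cdot> p)) - i \<cdot> (?z \<cdot> (s \<cdot> p))"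
    using skw_anticomm[OF zs i_skw, of "s \<cdot> p"] by (simp add: e)
  moreover have "t \<cdot> (?z \<cdot> p) = - (f z t *s p) - ?z \<cdot> (i \<cdot> (s \<cdot> p))"
    using skw_anticomm[OF t zs, of p] by (simp add: e tp f_sym[of t])
  ultimately have "t \<cdot> (?z \<cdot> p) = f z i *s (s \<cdot> p) - f z s *s (i \<cdot> p) - i \<cdot> (s \<cdot> (?z \<cdot> p)) - f z t *s p"
    by simp
  moreover have "?z \<cdot> p = x - c *s p" using zt[of p] by (simp add: zp)
  ultimately have tx: "t \<cdot> x = f z i *s (s \<cdot> p) - f z s *s (i \<cdot> p) - i \<cdot> (s \<cdot> x) - f z t *s p + (2 * c) *s (i \<cdot> (s \<cdot> p))"
    by (simp add: bilin tp algebra_simps double)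
  have fz: "f x p = N p * (2 * c)" "f x (i \<cdot> p) = N p * f z i" "f x (s \<cdot> p) = N p * f z s"
    "f x (i \<cdot> (s \<cdot> p)) = N p * f z t"
    using f_mult_right[of z p one] f_mult_right[of z p i] f_mult_right[of z p s] f_mult_right[of z p t] two
    by (simp_all add: zp tp c_def mult.commute)
  have "(x \<cdot> cj (t \<cdot> p)) \<cdot> p = f x (t \<cdot> p) *s p - f x p *s (t \<cdot> p) + N p *s (t \<cdot> x)"
    by (rule triple_skw[OF t])
  then show ?thesis by (simp add: tp fz tx bilin algebra_simps)
qed simp

lemma defect_i: "defect x (i \<cdot> p) p = 0"
  using i_nz s_nz
  by (simp add: defect_def cyc_def triple_skw[OF i_skw] f_self f_i f_s s_i f_mult_left bilin double
      algebra_simps f_sym[of x p] f_flip[of x p])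

lemma defect_s: "defect x (s \<cdot> p) p = 0"
  using i_nz s_nz
  by (simp add: defect_def cyc_def triple_skw[OF s_skw] f_self f_i f_s s_i f_mult_left bilin double
      algebra_simps f_sym[of x p] f_flip[of x p])

lemma defect_is: "defect x (i \<cdot> (s \<cdot> p)) p = 0"
  using i_nz s_nz
  by (simp add: defect_def cyc_def triple_is f_self f_i f_s s_i f_mult_left bilin double
      algebra_simps f_sym[of x p] f_flip[of x p])

lemma defect_block:
  assumes "y \<in> set (block p)" "z \<in> set (block p)"
  shows "defect x y z = 0"
proof -
  have n: "N i \<noteq> 0" using i_nz by simp
  \<comment> \<open>The remaining pairs of the block arise by putting sp or ip in place of p;
    alternation supplies the other orders.\<close>
  have 1: "defect x (i \<cdot> (s \<cdot> p)) (s \<cdot> p) = 0" by (rule defect_i)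
  have 2: "defect x (i \<cdot> (s \<cdot> p)) (i \<cdot> p) = 0" using defect_s[of x "i \<cdot> p"] by (simp add: s_i defect_minus)
  have "N i *s defect x (s \<cdot> p) (i \<cdot> p) = 0"
    using defect_is[of x "i \<cdot> p"] by (simp add: defect_scale)
  then have 3: "defect x (s \<cdot> p) (i \<cdot> p) = 0" using n by simp
  have 4: "defect x y z = 0 \<Longrightarrow> defect x z y = 0" for y z using defect_swap(2)[of x z y] by simp
  show ?thesis
    using assms 1 2 3 defect_i[of x p] defect_s[of x p] defect_is[of x p] 4[of "i \<cdot> (s \<cdot> p)" "s \<cdot> p"]
      4[of "i \<cdot> (s \<cdot> p)" "i \<cdot> p"] 4[of "s \<cdot> p" "i \<cdot> p"] 4[of "i \<cdot> p" p] 4[of "s \<cdot> p" p]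
      4[of "i \<cdot> (s \<cdot> p)" p]
    by (auto simp: block_def defect_alt)
qed

lemma defect_block_span:
  assumes "y \<in> span (set (block p))" "z \<in> span (set (block p))"
  shows "defect x y z = 0"
proof -
  have 0: "defect x 0 z = 0" "defect x y 0 = 0" for x y z
    using defect_scale(2)[of x 0 0] defect_scale(3)[of x y 0 0] by simp_all
  have 1: "defect x y z = 0" if "z \<in> set (block p)" for z
    using assms(1)
  proof (rule span_induct)
    show "subspace {y. defect x y z = 0}" by (auto simp: subspace_def defect_add defect_scale 0)
  qed (rule defect_block[OF _ that])
  show ?thesis
    using assms(2)
  proof (rule span_induct)
    show "subspace {z. defect x y z = 0}" by (auto simp: subspace_def defect_add defect_scale 0)
  qed (rule 1)
qed

lemma exists_block_complement:
  assumes "p \<noteq> 0" "y \<notin> span (set (block p))"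
  shows "\<exists>r. r \<noteq> 0 \<and> y - r \<in> span (set (block p)) \<and> norm.orthogonal (block p @ block r)"
proof -
  have o: "norm.orthogonal (block p)" by (rule block_orthogonal[OF assms(1)])
  define w where "w = (\<Sum>j<length (block p). (f y (block p ! j) / f (block p ! j) (block p ! j)) *s block p ! j)"
  have w: "w \<in> span (set (block p))" unfolding w_def by (intro span_sum span_scale span_base) simp
  have perp: "f (y - w) b = 0" if b: "b \<in> set (block p)" for b
  proof -
    obtain j where j: "j < length (block p)" "b = block p ! j" using b by (auto simp: in_set_conv_nth)
    have "f w b = f y b / f b b * f b b" unfolding w_def j(2) by (rule norm.orthogonal_sum[OF o j(1)])
    moreover have "f b b \<noteq> 0" using o b by (simp add: norm.orthogonal_def)
    ultimately show ?thesis by (simp add: bilin)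
  qed
  have "y - w \<noteq> 0" using w assms(2) by auto
  moreover have "norm.orthogonal (block p @ block (y - w))"
    using perp by (intro two_blocks_orthogonal assms calculation) (simp_all add: block_def)
  ultimately show ?thesis using w by (intro exI[of _ "y - w"]) simp
qed

text \<open>Pigeonhole: the block of a nonzero z is everything in dimension 4, and in dimension 8
  one further block completes it. After splitting x and y along the blocks, two of the three
  arguments always lie in the same block, where alternation and \<open>defect_block_span\<close>
  apply.\<close>

lemma defect_zero:
  assumes dim: "dim UNIV = 4 \<or> dim UNIV = 8"
  shows "defect x y z = 0"
proof -
  consider "z = 0" | "z \<noteq> 0" "y \<in> span (set (block z))" | "z \<noteq> 0" "y \<notin> span (set (block z))" by blast
  then show ?thesis
  proof cases
    case 1
    then show ?thesis using defect_scale(3)[of x y 0 0] by simp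
  next
    case 2
    then show ?thesis using defect_block_span[of y z z x] by (auto simp: block_def span_base)
  next
    case 3
    then obtain r where r: "r \<noteq> 0" "y - r \<in> span (set (block z))" "norm.orthogonal (block z @ block r)"
      using exists_block_complement by blast
    have oz: "norm.orthogonal (block z)" by (rule block_orthogonal[OF 3(1)])
    have "dim UNIV \<noteq> 4"
      using norm.orthogonal_span_UNIV[OF oz] 3 by (auto simp: block_def)
    then have "dim UNIV = 8" using dim by simp
    then have sp: "span (set (block z @ block r)) = UNIV"
      by (intro norm.orthogonal_span_UNIV r) (simp_all add: block_def)
    have "x \<in> span (set (block z) \<union> set (block r))" using sp by simp
    then obtain x1 x2 where x: "x = x1 + x2" "x1 \<in> span (set (block z))" "x2 \<in> span (set (block r))"
      by (auto simp: span_Un)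
    have zz: "z \<in> span (set (block z))" and rr: "r \<in> span (set (block r))"
      by (auto intro!: span_base simp: block_def)
    have "defect x y z = defect x (y - r) z + defect x r z" by (simp flip: defect_add(2))
    also have "defect x (y - r) z = 0" by (rule defect_block_span[OF r(2) zz])
    also have "defect x r z = defect x1 r z + defect x2 r z" unfolding x(1) by (rule defect_add)
    also have "defect x1 r z = - defect r x1 z" by (rule defect_swap)
    also have "defect x2 r z = - defect x2 z r" by (rule defect_swap)
    also have "defect x2 z r = - defect z x2 r" by (rule defect_swap)
    finally show ?thesis using defect_block_span[OF x(2) zz] defect_block_span[OF x(3) rr] by simp
  qed
qed

end

section \<open>Tensor products of composition algebras\<close>

locale tensor_pair =
  A: anisotropic_composition sc1 mu1 one1 N1 + B: anisotropic_composition sc2 mu2 one2 N2 + T: vector_space sT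
  for sc1 :: "'k::field \<Rightarrow> 'a::ab_group_add \<Rightarrow> 'a" (infixr "*\<^sub>1" 75)
    and mu1 :: "'a \<Rightarrow> 'a \<Rightarrow> 'a" (infixl "\<cdot>\<^sub>1" 70) and one1 :: 'a and N1 :: "'a \<Rightarrow> 'k"
    and sc2 :: "'k \<Rightarrow> 'b::ab_group_add \<Rightarrow> 'b" (infixr "*\<^sub>2" 75)
    and mu2 :: "'b \<Rightarrow> 'b \<Rightarrow> 'b" (infixl "\<cdot>\<^sub>2" 70) and one2 :: 'b and N2 :: "'b \<Rightarrow> 'k"
    and sT :: "'k \<Rightarrow> 't::ab_group_add \<Rightarrow> 't" (infixr "*\<^sub>T" 75) +
  fixes mT :: "'t \<Rightarrow> 't \<Rightarrow> 't" and tn :: "'a \<Rightarrow> 'b \<Rightarrow> 't" (infixl "\<otimes>" 76)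
  assumes tp: "is_tensor_product sc1 sc2 sT tn"
    and mT_add_left: "mT (x + y) z = mT x z + mT y z"
    and mT_add_right: "mT z (x + y) = mT z x + mT z y"
    and mT_scale_left: "mT (c *\<^sub>T x) y = c *\<^sub>T mT x y"
    and mT_scale_right: "mT x (c *\<^sub>T y) = c *\<^sub>T mT x y"
    and mT_tn: "mT (p \<otimes> q) (p' \<otimes> q') = (p \<cdot>\<^sub>1 p') \<otimes> (q \<cdot>\<^sub>2 q')"
begin

lemma tn_bilinear: "bilinear_on sc1 sc2 sT UNIV UNIV UNIV tn"
  using tp by (simp add: is_tensor_product_def)

lemma tn_add_left: "(x + y) \<otimes> z = x \<otimes> z + y \<otimes> z"
  and tn_add_right: "w \<otimes> (u + v) = w \<otimes> u + w \<otimes> v"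
  and tn_scale_left [simp]: "(c *\<^sub>1 x) \<otimes> z = c *\<^sub>T x \<otimes> z"
  and tn_scale_right [simp]: "w \<otimes> (c *\<^sub>2 u) = c *\<^sub>T w \<otimes> u"
  using tn_bilinear by (simp_all add: bilinear_on_def linear_on_def)

lemma tn_minus_left [simp]: "(- x) \<otimes> z = - (x \<otimes> z)" using tn_scale_left[of "-1" x z] by simp
lemma tn_minus_right [simp]: "x \<otimes> (- z) = - (x \<otimes> z)" using tn_scale_right[of x "-1" z] by simp
lemma tn_zero_left [simp]: "0 \<otimes> z = 0" using tn_scale_left[of 0 0 z] by simp
lemma tn_zero_right [simp]: "x \<otimes> 0 = 0" using tn_scale_right[of x 0 0] by simp
lemma tn_diff_left: "(x - y) \<otimes> z = x \<otimes> z - y \<otimes> z" using tn_add_left[of x "- y" z] by simp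
lemma tn_diff_right: "z \<otimes> (x - y) = z \<otimes> x - z \<otimes> y" using tn_add_right[of z x "- y"] by simp

text \<open>A scalar is absorbed by the left factor of a pure tensor, so sums are the only other
  case.\<close>

lemma tensor_induct [case_names pure add]:
  assumes "\<And>p q. P (p \<otimes> q)" "\<And>x y. P x \<Longrightarrow> P y \<Longrightarrow> P (x + y)"
  shows "P z"
proof -
  have "z \<in> T.span (range (\<lambda>(x, y). x \<otimes> y))" using tensor_span[OF tp] by simp
  then show ?thesis
  proof (induction rule: T.span_induct_alt)
    case base
    show ?case using assms(1)[of 0 0] by simp
  next
    case (step c x y)
    then show ?case using assms(2)[OF assms(1)] by (auto simp flip: tn_scale_left)
  qed
qed

section \<open>Contractions, the product form and the matrix calculus of tensors\<close>

definition lift :: "('k \<Rightarrow> 'w::ab_group_add \<Rightarrow> 'w) \<Rightarrow> ('a \<Rightarrow> 'b \<Rightarrow> 'w) \<Rightarrow> 't \<Rightarrow> 'w" where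
  "lift sW \<phi> = (THE \<Phi>. linear_on sT sW UNIV UNIV \<Phi> \<and> (\<forall>x y. \<Phi> (x \<otimes> y) = \<phi> x y))"

lemma lift:
  assumes "vector_space sW" "\<And>x x' y. \<phi> (x + x') y = \<phi> x y + \<phi> x' y" "\<And>x y y'. \<phi> x (y + y') = \<phi> x y + \<phi> x y'"
    "\<And>c x y. \<phi> (c *\<^sub>1 x) y = sW c (\<phi> x y)" "\<And>c x y. \<phi> x (c *\<^sub>2 y) = sW c (\<phi> x y)"
  shows "lift sW \<phi> (x \<otimes> y) = \<phi> x y" "lift sW \<phi> (z + z') = lift sW \<phi> z + lift sW \<phi> z'"
    "lift sW \<phi> (c *\<^sub>T z) = sW c (lift sW \<phi> z)"
proof -
  have "bilinear_on sc1 sc2 sW UNIV UNIV UNIV \<phi>" using assms(2-) by (simp add: bilinear_on_def linear_on_def)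
  from theI'[OF tensor_product_universal[OF tp assms(1) this], folded lift_def]
  show "lift sW \<phi> (x \<otimes> y) = \<phi> x y" "lift sW \<phi> (z + z') = lift sW \<phi> z + lift sW \<phi> z'"
    "lift sW \<phi> (c *\<^sub>T z) = sW c (lift sW \<phi> z)"
    by (auto simp: linear_on_def)
qed

text \<open>The norm forms let a tensor be read as a linear map from one factor to the other; these
  are the two readings.\<close>

definition ctr1 :: "'t \<Rightarrow> 'a \<Rightarrow> 'b" where "ctr1 z p = lift sc2 (\<lambda>p' q. A.f p' p *\<^sub>2 q) z"
definition ctr2 :: "'t \<Rightarrow> 'b \<Rightarrow> 'a" where "ctr2 z q = lift sc1 (\<lambda>p q'. B.f q' q *\<^sub>1 p) z"

lemma ctr1_pure [simp]: "ctr1 (p \<otimes> q) p' = A.f p p' *\<^sub>2 q"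
  and ctr1_add: "ctr1 (z + z') p' = ctr1 z p' + ctr1 z' p'"
  and ctr1_scale [simp]: "ctr1 (c *\<^sub>T z) p' = c *\<^sub>2 ctr1 z p'"
proof -
  note l = lift[where sW = sc2 and \<phi> = "\<lambda>p' q. A.f p' p *\<^sub>2 q" for p, folded ctr1_def]
  show "ctr1 (p \<otimes> q) p' = A.f p p' *\<^sub>2 q" "ctr1 (z + z') p' = ctr1 z p' + ctr1 z' p'"
    "ctr1 (c *\<^sub>T z) p' = c *\<^sub>2 ctr1 z p'"
    by (rule l; (simp add: A.bilin B.bilin mult.commute; fail)?; unfold_locales)+
qed

lemma ctr2_pure [simp]: "ctr2 (p \<otimes> q) q' = B.f q q' *\<^sub>1 p"
  and ctr2_add: "ctr2 (z + z') q' = ctr2 z q' + ctr2 z' q'"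
  and ctr2_scale [simp]: "ctr2 (c *\<^sub>T z) q' = c *\<^sub>1 ctr2 z q'"
proof -
  note l = lift[where sW = sc1 and \<phi> = "\<lambda>p q'. B.f q' q *\<^sub>1 p" for q, folded ctr2_def]
  show "ctr2 (p \<otimes> q) q' = B.f q q' *\<^sub>1 p" "ctr2 (z + z') q' = ctr2 z q' + ctr2 z' q'"
    "ctr2 (c *\<^sub>T z) q' = c *\<^sub>1 ctr2 z q'"
    by (rule l; (simp add: A.bilin B.bilin mult.commute; fail)?; unfold_locales)+
qed

lemma ctr1_add_right: "ctr1 z (p + p') = ctr1 z p + ctr1 z p'"
  by (induction z rule: tensor_induct) (simp_all add: ctr1_add A.bilin B.bilin)
lemma ctr1_scale_right [simp]: "ctr1 z (c *\<^sub>1 p) = c *\<^sub>2 ctr1 z p"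
  by (induction z rule: tensor_induct) (simp_all add: ctr1_add A.bilin B.bilin)
lemma ctr2_add_right: "ctr2 z (p + p') = ctr2 z p + ctr2 z p'"
  by (induction z rule: tensor_induct) (simp_all add: ctr2_add A.bilin B.bilin)
lemma ctr2_scale_right [simp]: "ctr2 z (c *\<^sub>2 p) = c *\<^sub>1 ctr2 z p"
  by (induction z rule: tensor_induct) (simp_all add: ctr2_add A.bilin B.bilin)

text \<open>The tensor product of the two polar forms. The universal property serves one variable at
  a time, so the other one enters through a contraction.\<close>

definition g :: "'t \<Rightarrow> 't \<Rightarrow> 'k" where "g y z = lift (*) (\<lambda>p q. A.f (ctr2 y q) p) z"

lemma g_pure_right: "g y (p \<otimes> q) = A.f (ctr2 y q) p"
  and g_add_right: "g y (z + z') = g y z + g y z'"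
  and g_scale_right [simp]: "g y (c *\<^sub>T z) = c * g y z"
proof -
  note l = lift[where sW = "(*)" and \<phi> = "\<lambda>p q. A.f (ctr2 y q) p" for y, folded g_def]
  show "g y (p \<otimes> q) = A.f (ctr2 y q) p" "g y (z + z') = g y z + g y z'" "g y (c *\<^sub>T z) = c * g y z"
    by (rule l; (simp add: A.bilin ctr2_add_right; fail)?; rule vector_space_times)+
qed

lemma g_add_left: "g (y + y') z = g y z + g y' z"
  by (induction z rule: tensor_induct) (simp_all add: g_pure_right g_add_right ctr2_add A.bilin)
lemma g_scale_left [simp]: "g (c *\<^sub>T y) z = c * g y z"
  by (induction z rule: tensor_induct) (simp_all add: g_pure_right g_add_right algebra_simps)

lemma g_pure [simp]: "g (p \<otimes> q) (p' \<otimes> q') = A.f p p' * B.f q q'" by (simp add: g_pure_right)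

lemma g_sym: "g y z = g z y"
proof (induction z rule: tensor_induct)
  case (pure p q)
  show ?case
    by (induction y rule: tensor_induct) (simp_all add: g_add_left g_add_right A.f_sym[of p] B.f_sym[of q])
qed (simp add: g_add_left g_add_right)

text \<open>If tensors are read as matrices, \<open>t3 y z x\<close> is the product of \<open>y\<close>, the transpose of \<open>z\<close>, and \<open>x\<close>.
  The components \<open>c1\<close> and \<open>c2\<close> are those of \<open>\<beta>(y, z)\<close> in the two skew spaces.\<close>

definition c1 :: "'t \<Rightarrow> 't \<Rightarrow> 'a" where "c1 y z = lift sc1 (\<lambda>p q. A.im (ctr2 y q \<cdot>\<^sub>1 A.cj p)) z"
definition c2 :: "'t \<Rightarrow> 't \<Rightarrow> 'b" where "c2 y z = lift sc2 (\<lambda>p q. B.im (ctr1 y p \<cdot>\<^sub>2 B.cj q)) z"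
definition t3 :: "'t \<Rightarrow> 't \<Rightarrow> 't \<Rightarrow> 't" where "t3 y z x = lift sT (\<lambda>p q. ctr2 y (ctr1 z p) \<otimes> q) x"

lemma c1_pure_right: "c1 y (p \<otimes> q) = A.im (ctr2 y q \<cdot>\<^sub>1 A.cj p)"
  and c1_add_right: "c1 y (z + z') = c1 y z + c1 y z'"
  and c1_scale_right [simp]: "c1 y (c *\<^sub>T z) = c *\<^sub>1 c1 y z"
proof -
  note l = lift[where sW = sc1 and \<phi> = "\<lambda>p q. A.im (ctr2 y q \<cdot>\<^sub>1 A.cj p)" for y, folded c1_def]
  show "c1 y (p \<otimes> q) = A.im (ctr2 y q \<cdot>\<^sub>1 A.cj p)" "c1 y (z + z') = c1 y z + c1 y z'"
    "c1 y (c *\<^sub>T z) = c *\<^sub>1 c1 y z"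
    by (rule l; (simp add: A.bilin A.im_add A.cj_add ctr2_add_right; fail)?; unfold_locales)+
qed

lemma c2_pure_right: "c2 y (p \<otimes> q) = B.im (ctr1 y p \<cdot>\<^sub>2 B.cj q)"
  and c2_add_right: "c2 y (z + z') = c2 y z + c2 y z'"
  and c2_scale_right [simp]: "c2 y (c *\<^sub>T z) = c *\<^sub>2 c2 y z"
proof -
  note l = lift[where sW = sc2 and \<phi> = "\<lambda>p q. B.im (ctr1 y p \<cdot>\<^sub>2 B.cj q)" for y, folded c2_def]
  show "c2 y (p \<otimes> q) = B.im (ctr1 y p \<cdot>\<^sub>2 B.cj q)" "c2 y (z + z') = c2 y z + c2 y z'"
    "c2 y (c *\<^sub>T z) = c *\<^sub>2 c2 y z"
    by (rule l; (simp add: B.bilin B.im_add B.cj_add ctr1_add_right; fail)?; unfold_locales)+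
qed

lemma t3_pure_right: "t3 y z (p \<otimes> q) = ctr2 y (ctr1 z p) \<otimes> q"
  and t3_add_right: "t3 y z (x + x') = t3 y z x + t3 y z x'"
  and t3_scale_right [simp]: "t3 y z (c *\<^sub>T x) = c *\<^sub>T t3 y z x"
proof -
  note l = lift[where sW = sT and \<phi> = "\<lambda>p q. ctr2 y (ctr1 z p) \<otimes> q" for y z, folded t3_def]
  show "t3 y z (p \<otimes> q) = ctr2 y (ctr1 z p) \<otimes> q" "t3 y z (x + x') = t3 y z x + t3 y z x'"
    "t3 y z (c *\<^sub>T x) = c *\<^sub>T t3 y z x"
    by (rule l; (simp add: tn_add_left tn_add_right ctr1_add_right ctr2_add_right; fail)?; unfold_locales)+
qed

lemma c1_add_left: "c1 (y + y') z = c1 y z + c1 y' z"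
  by (induction z rule: tensor_induct) (simp_all add: c1_pure_right c1_add_right ctr2_add A.mult_add_left A.im_add)
lemma c1_scale_left [simp]: "c1 (c *\<^sub>T y) z = c *\<^sub>1 c1 y z"
  by (induction z rule: tensor_induct) (simp_all add: c1_pure_right c1_add_right A.bilin)
lemma c2_add_left: "c2 (y + y') z = c2 y z + c2 y' z"
  by (induction z rule: tensor_induct) (simp_all add: c2_pure_right c2_add_right ctr1_add B.mult_add_left B.im_add)
lemma c2_scale_left [simp]: "c2 (c *\<^sub>T y) z = c *\<^sub>2 c2 y z"
  by (induction z rule: tensor_induct) (simp_all add: c2_pure_right c2_add_right B.bilin)

lemma t3_add_left: "t3 (y + y') z x = t3 y z x + t3 y' z x"
  by (induction x rule: tensor_induct) (simp_all add: t3_pure_right t3_add_right ctr2_add tn_add_left)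
lemma t3_scale_left [simp]: "t3 (c *\<^sub>T y) z x = c *\<^sub>T t3 y z x"
  by (induction x rule: tensor_induct) (simp_all add: t3_pure_right t3_add_right T.scale_right_distrib)
lemma t3_add_mid: "t3 y (z + z') x = t3 y z x + t3 y z' x"
  by (induction x rule: tensor_induct) (simp_all add: t3_pure_right t3_add_right ctr1_add ctr2_add_right tn_add_left)
lemma t3_scale_mid [simp]: "t3 y (c *\<^sub>T z) x = c *\<^sub>T t3 y z x"
  by (induction x rule: tensor_induct) (simp_all add: t3_pure_right t3_add_right T.scale_right_distrib)

lemma c1_pure [simp]: "c1 (p \<otimes> q) (p' \<otimes> q') = B.f q q' *\<^sub>1 A.im (p \<cdot>\<^sub>1 A.cj p')"
  by (simp add: c1_pure_right)
lemma c2_pure [simp]: "c2 (p \<otimes> q) (p' \<otimes> q') = A.f p p' *\<^sub>2 B.im (q \<cdot>\<^sub>2 B.cj q')"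
  by (simp add: c2_pure_right)
lemma t3_pure [simp]: "t3 (p \<otimes> q) (p' \<otimes> q') (p'' \<otimes> q'') = (A.f p' p'' * B.f q q') *\<^sub>T p \<otimes> q''"
  by (simp add: t3_pure_right mult.commute)

lemma c1_skw: "c1 y z \<in> A.skw"
proof (induction z rule: tensor_induct)
  case (add z z')
  then show ?case by (simp add: c1_add_right A.subspace_add[OF A.subspace_skw])
qed (simp add: c1_pure_right A.im_skw)

lemma c2_skw: "c2 y z \<in> B.skw"
proof (induction z rule: tensor_induct)
  case (add z z')
  then show ?case by (simp add: c2_add_right B.subspace_add[OF B.subspace_skw])
qed (simp add: c2_pure_right B.im_skw)

subsection \<open>The two families of left multiplications\<close>

abbreviation L1 :: "'a \<Rightarrow> 't \<Rightarrow> 't" where "L1 c x \<equiv> mT (c \<otimes> one2) x"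
abbreviation L2 :: "'b \<Rightarrow> 't \<Rightarrow> 't" where "L2 d x \<equiv> mT (one1 \<otimes> d) x"

lemma mT_zero_left [simp]: "mT 0 x = 0" using mT_scale_left[of 0 0 x] by simp
lemma mT_zero_right [simp]: "mT x 0 = 0" using mT_scale_right[of x 0 0] by simp
lemma mT_minus_left [simp]: "mT (- x) y = - mT x y" using mT_scale_left[of "-1" x y] by simp
lemma mT_minus_right [simp]: "mT x (- y) = - mT x y" using mT_scale_right[of x "-1" y] by simp
lemma mT_diff_left: "mT (x - y) z = mT x z - mT y z" using mT_add_left[of x "- y" z] by simp
lemma mT_diff_right: "mT z (x - y) = mT z x - mT z y" using mT_add_right[of z x "- y"] by simp

lemma L_commute: "L2 d (L1 c x) = L1 c (L2 d x)"
  by (induction x rule: tensor_induct) (simp_all add: mT_tn mT_add_right)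

lemma L1_sq: "c \<in> A.skw \<Longrightarrow> L1 c (L1 c x) = - (N1 c *\<^sub>T x)"
  by (induction x rule: tensor_induct) (simp_all add: mT_tn mT_add_right A.skw_sq T.scale_right_distrib)
lemma L2_sq: "d \<in> B.skw \<Longrightarrow> L2 d (L2 d x) = - (N2 d *\<^sub>T x)"
  by (induction x rule: tensor_induct) (simp_all add: mT_tn mT_add_right B.skw_sq T.scale_right_distrib)

lemma L1_orth: "c \<in> A.skw \<Longrightarrow> c' \<in> A.skw \<Longrightarrow> A.f c c' = 0 \<Longrightarrow> L1 c (L1 c' x) = - L1 c' (L1 c x)"
  by (induction x rule: tensor_induct) (simp_all add: mT_tn mT_add_right A.skw_orth[of c c'])
lemma L2_orth: "c \<in> B.skw \<Longrightarrow> c' \<in> B.skw \<Longrightarrow> B.f c c' = 0 \<Longrightarrow> L2 c (L2 c' x) = - L2 c' (L2 c x)"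
  by (induction x rule: tensor_induct) (simp_all add: mT_tn mT_add_right B.skw_orth[of c c'])

lemma g_L1: "c \<in> A.skw \<Longrightarrow> g (L1 c x) y = - g x (L1 c y)"
proof (induction y rule: tensor_induct)
  case (pure p q)
  then show ?case
    by (induction x rule: tensor_induct) (simp_all add: mT_tn mT_add_right g_add_left A.skw_adj)
qed (simp add: g_add_left g_add_right mT_add_right)

lemma g_L2: "c \<in> B.skw \<Longrightarrow> g (L2 c x) y = - g x (L2 c y)"
proof (induction y rule: tensor_induct)
  case (pure p q)
  then show ?case
    by (induction x rule: tensor_induct) (simp_all add: mT_tn mT_add_right g_add_left B.skw_adj)
qed (simp add: g_add_left g_add_right mT_add_right)

lemma f_c1: "t \<in> A.skw \<Longrightarrow> A.f (c1 y z) t = g y (L1 t z)"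
proof (induction z rule: tensor_induct)
  case (pure p q)
  have "A.f (p' \<cdot>\<^sub>1 A.cj p) t = A.f p' (t \<cdot>\<^sub>1 p)" for p' by (simp add: A.f_adj_right[of p' "A.cj p"])
  with pure show ?case
    by (induction y rule: tensor_induct) (simp_all add: c1_add_left A.bilin A.f_im mT_tn g_add_left)
qed (simp add: c1_add_right g_add_right mT_add_right A.bilin)

lemma f_c2: "t \<in> B.skw \<Longrightarrow> B.f (c2 y z) t = g y (L2 t z)"
proof (induction z rule: tensor_induct)
  case (pure p q)
  have "B.f (p' \<cdot>\<^sub>2 B.cj q) t = B.f p' (t \<cdot>\<^sub>2 q)" for p' by (simp add: B.f_adj_right[of p' "B.cj q"])
  with pure show ?case
    by (induction y rule: tensor_induct) (simp_all add: c2_add_left B.bilin B.f_im mT_tn g_add_left)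
qed (simp add: c2_add_right g_add_right mT_add_right B.bilin)

text \<open>In the matrix reading \<open>L1\<close> acts on the left and \<open>L2\<close> on the
  right. Operators therefore leave \<open>t3\<close> at its two ends, and in the transposed middle
  argument they pass to a neighbour with the sign of a skew map.\<close>

lemma t3_L1_left: "t3 (L1 c y) z x = L1 c (t3 y z x)"
proof (induction x rule: tensor_induct)
  case (pure p q)
  show ?case
  proof (induction z rule: tensor_induct)
    case (pure p' q')
    show ?case
      by (induction y rule: tensor_induct) (simp_all add: mT_tn mT_add_right t3_add_left mT_scale_right)
  qed (simp add: t3_add_mid mT_add_right)
qed (simp add: t3_add_right mT_add_right)

lemma t3_L2_right: "t3 y z (L2 d x) = L2 d (t3 y z x)"
proof (induction x rule: tensor_induct)
  case (pure p q)
  show ?case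
  proof (induction z rule: tensor_induct)
    case (pure p' q')
    show ?case
      by (induction y rule: tensor_induct) (simp_all add: mT_tn mT_add_right t3_add_left mT_scale_right)
  qed (simp add: t3_add_mid mT_add_right)
qed (simp add: t3_add_right mT_add_right)

lemma t3_L1_mid: "c \<in> A.skw \<Longrightarrow> t3 y (L1 c z) x = - t3 y z (L1 c x)"
proof (induction x rule: tensor_induct)
  case (pure p q)
  then show ?case
  proof (induction z rule: tensor_induct)
    case (pure p' q')
    then show ?case
      by (induction y rule: tensor_induct) (simp_all add: mT_tn mT_add_right t3_add_left mT_scale_right A.skw_adj)
  qed (simp add: t3_add_mid mT_add_right)
qed (simp add: t3_add_right mT_add_right)

lemma t3_L2_mid: "d \<in> B.skw \<Longrightarrow> t3 y (L2 d z) x = - t3 (L2 d y) z x"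
proof (induction x rule: tensor_induct)
  case (pure p q)
  then show ?case
  proof (induction z rule: tensor_induct)
    case (pure p' q')
    then show ?case
      by (induction y rule: tensor_induct) (simp_all add: mT_tn mT_add_right t3_add_left mT_scale_right B.skw_adj)
  qed (simp add: t3_add_mid mT_add_right)
qed (simp add: t3_add_right mT_add_right)

end

locale tensor_quaternion = tensor_pair sc1 mu1 one1 N1 sc2 mu2 one2 N2 sT mT tn +
    Q1: quaternion_pair sc1 mu1 one1 N1 i1 s1
  for sc1 :: "'k::field \<Rightarrow> 'a::ab_group_add \<Rightarrow> 'a" (infixr "*\<^sub>1" 75)
    and mu1 :: "'a \<Rightarrow> 'a \<Rightarrow> 'a" (infixl "\<cdot>\<^sub>1" 70) and one1 :: 'a and N1 :: "'a \<Rightarrow> 'k"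
    and sc2 :: "'k \<Rightarrow> 'b::ab_group_add \<Rightarrow> 'b" (infixr "*\<^sub>2" 75)
    and mu2 :: "'b \<Rightarrow> 'b \<Rightarrow> 'b" (infixl "\<cdot>\<^sub>2" 70) and one2 :: 'b and N2 :: "'b \<Rightarrow> 'k"
    and sT :: "'k \<Rightarrow> 't::ab_group_add \<Rightarrow> 't" (infixr "*\<^sub>T" 75)
    and mT :: "'t \<Rightarrow> 't \<Rightarrow> 't" and tn :: "'a \<Rightarrow> 'b \<Rightarrow> 't" (infixl "\<otimes>" 76)
    and i1 s1 :: 'a +
  assumes dim1: "A.dim UNIV = 4 \<or> A.dim UNIV = 8"
begin

text \<open>On pure tensors the three summands are those of \<open>cyc\<close>; \<open>t3\<close>
  carries out the pairing of the tensor factors.\<close>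

definition part :: "('t \<Rightarrow> 't) \<Rightarrow> 't \<Rightarrow> 't \<Rightarrow> 't \<Rightarrow> 't" where
  "part E y z x = E (t3 y z (E x)) - E (t3 z y (E x)) + g y (E z) *\<^sub>T E x"

text \<open>This is the vanishing of \<open>defect\<close> on pure tensors, extended by
  trilinearity. It frees the expression from multiplication by elements that depend on y and
  z.\<close>

lemma c1_as_t3:
  "2 *\<^sub>T L1 (c1 y z) x = t3 y z x - t3 z y x + (1 / N1 i1) *\<^sub>T part (L1 i1) y z x
     + (1 / N1 s1) *\<^sub>T part (L1 s1) y z x - (1 / (N1 i1 * N1 s1)) *\<^sub>T part (\<lambda>x. L1 i1 (L1 s1 x)) y z x"
    (is "?l y z x = ?r y z x")
proof -
  have pure: "?l (p1 \<otimes> q1) (p2 \<otimes> q2) (p \<otimes> q) = ?r (p1 \<otimes> q1) (p2 \<otimes> q2) (p \<otimes> q)" for p1 q1 p2 q2 p q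
  proof -
    have "2 *\<^sub>1 ((p1 \<cdot>\<^sub>1 A.cj p2) \<cdot>\<^sub>1 p) = A.f p1 p2 *\<^sub>1 p + A.f p2 p *\<^sub>1 p1 - A.f p1 p *\<^sub>1 p2
      + (1 / N1 i1) *\<^sub>1 Q1.cyc (\<lambda>x. i1 \<cdot>\<^sub>1 x) p1 p2 p + (1 / N1 s1) *\<^sub>1 Q1.cyc (\<lambda>x. s1 \<cdot>\<^sub>1 x) p1 p2 p
        - (1 / (N1 i1 * N1 s1)) *\<^sub>1 Q1.cyc (\<lambda>x. i1 \<cdot>\<^sub>1 (s1 \<cdot>\<^sub>1 x)) p1 p2 p"
      using Q1.defect_zero[OF dim1, of p1 p2 p] by (simp add: Q1.defect_def algebra_simps)
    \<comment> \<open>The trace of p1 times the conjugate of p2 is f(p1, p2), so passing to the skew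
      part removes the summand f(p1, p2) p.\<close>
    moreover have "A.f (p1 \<cdot>\<^sub>1 A.cj p2) one1 = A.f p1 p2" by (simp add: A.f_adj_right[of p1 "A.cj p2"])
    ultimately have im: "2 *\<^sub>1 (A.im (p1 \<cdot>\<^sub>1 A.cj p2) \<cdot>\<^sub>1 p) = A.f p2 p *\<^sub>1 p1 - A.f p1 p *\<^sub>1 p2
      + (1 / N1 i1) *\<^sub>1 Q1.cyc (\<lambda>x. i1 \<cdot>\<^sub>1 x) p1 p2 p + (1 / N1 s1) *\<^sub>1 Q1.cyc (\<lambda>x. s1 \<cdot>\<^sub>1 x) p1 p2 p
        - (1 / (N1 i1 * N1 s1)) *\<^sub>1 Q1.cyc (\<lambda>x. i1 \<cdot>\<^sub>1 (s1 \<cdot>\<^sub>1 x)) p1 p2 p"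
      using A.two by (simp add: A.im_def A.bilin algebra_simps)
    have "?l (p1 \<otimes> q1) (p2 \<otimes> q2) (p \<otimes> q) = B.f q1 q2 *\<^sub>T ((2 *\<^sub>1 (A.im (p1 \<cdot>\<^sub>1 A.cj p2) \<cdot>\<^sub>1 p)) \<otimes> q)"
      by (simp add: mT_tn mT_scale_left mult.commute)
    also have "\<dots> = ?r (p1 \<otimes> q1) (p2 \<otimes> q2) (p \<otimes> q)"
      unfolding im part_def Q1.cyc_def
      by (simp add: mT_tn mT_scale_right tn_add_left tn_diff_left T.scale_right_distrib T.scale_right_diff_distrib
         Q1.f_flip[of p p1] B.f_sym[of q2 q1] mult.commute mult.left_commute)
    finally show ?thesis .
  qed
  have l: "?l (y + y') z x = ?l y z x + ?l y' z x" "?l y (z + z') x = ?l y z x + ?l y z' x"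
    "?l y z (x + x') = ?l y z x + ?l y z x'" for y y' z z' x x'
    by (simp_all add: c1_add_left c1_add_right tn_add_left mT_add_left mT_add_right T.scale_right_distrib)
  have p: "part E (y + y') z x = part E y z x + part E y' z x" "part E y (z + z') x = part E y z x + part E y z' x"
    "part E y z (x + x') = part E y z x + part E y z x'" if E: "\<And>x y. E (x + y) = E x + E y" "\<And>x y. E (x - y) = E x - E y"
      for E y y' z z' x x'
    by (simp_all add: part_def E t3_add_left t3_add_mid t3_add_right g_add_left g_add_right
        T.scale_left_distrib T.scale_right_distrib)
  have r: "?r (y + y') z x = ?r y z x + ?r y' z x" "?r y (z + z') x = ?r y z x + ?r y z' x"
    "?r y z (x + x') = ?r y z x + ?r y z x'" for y y' z z' x x'
    by (simp_all add: p mT_add_right mT_diff_right t3_add_left t3_add_mid t3_add_right T.scale_right_distrib)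
  show ?thesis
  proof (induction x rule: tensor_induct)
    case (pure p q)
    show ?case
    proof (induction z rule: tensor_induct)
      case (pure p2 q2)
      show ?case
      proof (induction y rule: tensor_induct)
        case (pure p1 q1)
        show ?case by (rule \<open>\<And>q2 q1 q p2 p1 p. ?l (p1 \<otimes> q1) (p2 \<otimes> q2) (p \<otimes> q) = ?r (p1 \<otimes> q1) (p2 \<otimes> q2) (p \<otimes> q)\<close>)
      qed (simp only: l r)
    qed (simp only: l r)
  qed (simp only: l r)
qed

end

section \<open>Exchange of the two tensor factors, which transfers results to the second
  algebra\<close>

context tensor_pair
begin

lemma tensor_product_swap: "is_tensor_product sc2 sc1 sT (\<lambda>q p. p \<otimes> q)"
  unfolding is_tensor_product_def
proof (intro conjI allI impI)
  show "vector_space sc1" "vector_space sc2" "vector_space sT" by unfold_locales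
  show "bilinear_on sc2 sc1 sT UNIV UNIV UNIV (\<lambda>q p. p \<otimes> q)"
    using tn_bilinear by (simp add: bilinear_on_def)
  fix \<phi> :: "'b \<Rightarrow> 'a \<Rightarrow> 'k" assume "bilinear_on sc2 sc1 (*) UNIV UNIV UNIV \<phi>"
  then have "bilinear_on sc1 sc2 (*) UNIV UNIV UNIV (\<lambda>p q. \<phi> q p)" by (simp add: bilinear_on_def)
  then have "\<exists>!\<Phi>. linear_on sT (*) UNIV UNIV \<Phi> \<and> (\<forall>p q. \<Phi> (p \<otimes> q) = \<phi> q p)"
    using tp unfolding is_tensor_product_def by blast
  moreover have "(\<forall>q p. \<Phi> (p \<otimes> q) = \<phi> q p) \<longleftrightarrow> (\<forall>p q. \<Phi> (p \<otimes> q) = \<phi> q p)" for \<Phi> by blast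
  ultimately show "\<exists>!\<Phi>. linear_on sT (*) UNIV UNIV \<Phi> \<and> (\<forall>q p. \<Phi> (p \<otimes> q) = \<phi> q p)" by simp
qed

lemma tensor_pair_swap: "tensor_pair sc2 mu2 one2 N2 sc1 mu1 one1 N1 sT mT (\<lambda>q p. p \<otimes> q)"
  by unfold_locales (simp_all add: tensor_product_swap mT_add_left mT_add_right mT_scale_left mT_scale_right mT_tn)

lemma swap_lift: "tensor_pair.lift sT (\<lambda>q p. p \<otimes> q) sW \<phi> = lift sW (\<lambda>p q. \<phi> q p)"
proof -
  have "(\<forall>q p. \<Phi> (p \<otimes> q) = \<phi> q p) \<longleftrightarrow> (\<forall>p q. \<Phi> (p \<otimes> q) = \<phi> q p)" for \<Phi> by blast
  then show ?thesis
    unfolding lift_def tensor_pair.lift_def[OF tensor_pair_swap] by simp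
qed

lemma swap_ctr1: "tensor_pair.ctr1 N2 sc1 sT (\<lambda>q p. p \<otimes> q) = ctr2"
  by (rule ext)+ (simp add: ctr2_def tensor_pair.ctr1_def[OF tensor_pair_swap] swap_lift)

lemma swap_ctr2: "tensor_pair.ctr2 sc2 N1 sT (\<lambda>q p. p \<otimes> q) = ctr1"
  by (rule ext)+ (simp add: ctr1_def tensor_pair.ctr2_def[OF tensor_pair_swap] swap_lift)

lemma swap_c1: "tensor_pair.c1 sc2 mu2 one2 N2 N1 sT (\<lambda>q p. p \<otimes> q) = c2"
  by (rule ext)+ (simp add: c2_def tensor_pair.c1_def[OF tensor_pair_swap] swap_lift swap_ctr2)

lemma swap_g: "tensor_pair.g sc2 N2 N1 sT (\<lambda>q p. p \<otimes> q) y z = g y z"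
proof -
  interpret sw: tensor_pair sc2 mu2 one2 N2 sc1 mu1 one1 N1 sT mT "\<lambda>q p. p \<otimes> q" by (rule tensor_pair_swap)
  show ?thesis
  proof (induction z rule: tensor_induct)
    case (pure p q)
    show ?case by (induction y rule: tensor_induct) (simp_all add: g_add_left sw.g_add_left)
  qed (simp add: g_add_right sw.g_add_right)
qed

text \<open>Exchanging the factors transposes the matrices and so reverses their product.\<close>

lemma swap_t3: "tensor_pair.t3 sc2 N2 sc1 N1 sT (\<lambda>q p. p \<otimes> q) y z x = t3 x z y"
proof -
  interpret sw: tensor_pair sc2 mu2 one2 N2 sc1 mu1 one1 N1 sT mT "\<lambda>q p. p \<otimes> q" by (rule tensor_pair_swap)
  show ?thesis
  proof (induction x rule: tensor_induct)
    case (pure p q)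
    show ?case
    proof (induction z rule: tensor_induct)
      case (pure p' q')
      show ?case
        by (induction y rule: tensor_induct)
          (simp_all add: t3_add_right sw.t3_add_left mult.commute A.f_sym[of p'] B.f_sym[of q'])
    qed (simp add: t3_add_mid sw.t3_add_mid)
  qed (simp add: t3_add_left sw.t3_add_right)
qed

end

section \<open>The mixed identity\<close>

locale linked_tensor = tensor_quaternion sc1 mu1 one1 N1 sc2 mu2 one2 N2 sT mT tn i1 s1 +
    Q2: quaternion_pair sc2 mu2 one2 N2 i2 s2
  for sc1 :: "'k::field \<Rightarrow> 'a::ab_group_add \<Rightarrow> 'a" (infixr "*\<^sub>1" 75)
    and mu1 :: "'a \<Rightarrow> 'a \<Rightarrow> 'a" (infixl "\<cdot>\<^sub>1" 70) and one1 :: 'a and N1 :: "'a \<Rightarrow> 'k"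
    and sc2 :: "'k \<Rightarrow> 'b::ab_group_add \<Rightarrow> 'b" (infixr "*\<^sub>2" 75)
    and mu2 :: "'b \<Rightarrow> 'b \<Rightarrow> 'b" (infixl "\<cdot>\<^sub>2" 70) and one2 :: 'b and N2 :: "'b \<Rightarrow> 'k"
    and sT :: "'k \<Rightarrow> 't::ab_group_add \<Rightarrow> 't" (infixr "*\<^sub>T" 75)
    and mT :: "'t \<Rightarrow> 't \<Rightarrow> 't" and tn :: "'a \<Rightarrow> 'b \<Rightarrow> 't" (infixl "\<otimes>" 76)
    and i1 s1 :: 'a and i2 s2 :: 'b +
  assumes dim2: "B.dim UNIV = 4 \<or> B.dim UNIV = 8"
    and N_i: "N2 i2 = N1 i1"
begin

lemma c2_as_t3:
  "2 *\<^sub>T L2 (c2 y z) x = t3 x z y - t3 x y z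
     + (1 / N2 i2) *\<^sub>T (L2 i2 (t3 (L2 i2 x) z y) - L2 i2 (t3 (L2 i2 x) y z) + g y (L2 i2 z) *\<^sub>T L2 i2 x)
     + (1 / N2 s2) *\<^sub>T (L2 s2 (t3 (L2 s2 x) z y) - L2 s2 (t3 (L2 s2 x) y z) + g y (L2 s2 z) *\<^sub>T L2 s2 x)
     - (1 / (N2 i2 * N2 s2)) *\<^sub>T (L2 i2 (L2 s2 (t3 (L2 i2 (L2 s2 x)) z y))
         - L2 i2 (L2 s2 (t3 (L2 i2 (L2 s2 x)) y z)) + g y (L2 i2 (L2 s2 z)) *\<^sub>T L2 i2 (L2 s2 x))"
proof -
  interpret sw: tensor_quaternion sc2 mu2 one2 N2 sc1 mu1 one1 N1 sT mT "\<lambda>q p. p \<otimes> q" i2 s2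
    by (intro tensor_quaternion.intro tensor_pair_swap tensor_quaternion_axioms.intro dim2) unfold_locales
  show ?thesis
    using sw.c1_as_t3[of y z x] by (simp add: swap_c1 swap_t3 swap_g sw.part_def)
qed

text \<open>Both components of \<open>\<beta>\<close> are expanded by \<open>c1_as_t3\<close> and
  \<open>c2_as_t3\<close>. The hypothesis on x then brings every summand to a normal form: words in
  left multiplications applied to the four products \<open>t3 y x w\<close> with y either x or
  \<open>L2 s2 x\<close> and w either x or \<open>L1 s1 x\<close>.\<close>

lemma mixed_identity:
  assumes x: "L2 i2 x = L1 i1 x"
  shows "L1 s1 (L1 (c1 (L2 s2 (L1 i1 x)) x) x - L2 (c2 (L2 s2 (L1 i1 x)) x) x)
       + L2 s2 (L1 (c1 (L1 s1 (L1 i1 x)) x) x - L2 (c2 (L1 s1 (L1 i1 x)) x) x) = 0"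
proof -
  have n [simp]: "N1 i1 \<noteq> 0" "N1 s1 \<noteq> 0" "N2 s2 \<noteq> 0" using Q1.i_nz Q1.s_nz Q2.s_nz by simp_all
  note sk = Q1.i_skw Q1.s_skw Q2.i_skw Q2.s_skw
  have a [simp]: "L1 s1 (L1 i1 w) = - L1 i1 (L1 s1 w)" "L1 i1 (L1 i1 w) = - (N1 i1 *\<^sub>T w)"
    "L1 s1 (L1 s1 w) = - (N1 s1 *\<^sub>T w)" "L2 s2 (L2 s2 w) = - (N2 s2 *\<^sub>T w)"
    "L2 i2 (L2 s2 w) = - L2 s2 (L2 i2 w)" "L2 i2 (L2 i2 w) = - (N1 i1 *\<^sub>T w)" for w
    using L1_orth[of s1 i1 w] L1_sq[of i1 w] L1_sq[of s1 w] L2_sq[of s2 w] L2_orth[of i2 s2 w] L2_sq[of i2 w]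
    by (simp_all add: sk Q1.i_s Q2.i_s A.f_sym[of s1] N_i)
  note mv = t3_L1_left t3_L2_right t3_L1_mid[OF Q1.i_skw] t3_L1_mid[OF Q1.s_skw] t3_L2_mid[OF Q2.i_skw]
    t3_L2_mid[OF Q2.s_skw]
  have mn [simp]: "t3 (- y) z w = - t3 y z w" "t3 y (- z) w = - t3 y z w" "t3 y z (- w) = - t3 y z w"
     "g (- y) z = - g y z" "g y (- z) = - g y z" for y z w
    using t3_scale_left[of "-1"] t3_scale_mid[of _ "-1"] t3_scale_right[of _ _ "-1"] g_scale_left[of "-1"]
      g_scale_right[of _ "-1"] by simp_all
  \<comment> \<open>An operator leaves the third argument of \<open>t3\<close> only as an
    \<open>L2\<close>; the factor \<open>L1 i1\<close> is first turned into \<open>L2 i2\<close> on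
    x.\<close>
  have r [simp]: "t3 y z (L1 i1 x) = L2 i2 (t3 y z x)"
    "t3 y z (L1 i1 (L1 s1 x)) = - L2 i2 (t3 y z (L1 s1 x))"
    "t3 y z (L2 s2 x) = L2 s2 (t3 y z x)"
    "t3 y z (L1 s1 (L2 s2 x)) = L2 s2 (t3 y z (L1 s1 x))"
    "t3 y z (L1 i1 (L2 s2 x)) = L2 s2 (L2 i2 (t3 y z x))"
    "t3 y z (L1 i1 (L1 s1 (L2 s2 x))) = - L2 s2 (L2 i2 (t3 y z (L1 s1 x)))" for y z
  proof -
    have 1: "L1 i1 (L1 s1 x) = - L2 i2 (L1 s1 x)" unfolding L_commute x by simp
    have 2: "L1 i1 (L2 s2 x) = L2 s2 (L2 i2 x)" unfolding x L_commute by simp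
    have 3: "L1 s1 (L2 s2 x) = L2 s2 (L1 s1 x)" by (simp add: L_commute)
    have 4: "L1 i1 (L1 s1 (L2 s2 x)) = - L2 s2 (L2 i2 (L1 s1 x))" unfolding L_commute x by (simp add: L_commute)
    show "t3 y z (L1 i1 x) = L2 i2 (t3 y z x)" by (simp only: x[symmetric] t3_L2_right)
    show "t3 y z (L1 i1 (L1 s1 x)) = - L2 i2 (t3 y z (L1 s1 x))" unfolding 1 by (simp add: t3_L2_right)
    show "t3 y z (L2 s2 x) = L2 s2 (t3 y z x)" by (rule t3_L2_right)
    show "t3 y z (L1 s1 (L2 s2 x)) = L2 s2 (t3 y z (L1 s1 x))" unfolding 3 by (rule t3_L2_right)
    show "t3 y z (L1 i1 (L2 s2 x)) = L2 s2 (L2 i2 (t3 y z x))" unfolding 2 by (simp only: t3_L2_right)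
    show "t3 y z (L1 i1 (L1 s1 (L2 s2 x))) = - L2 s2 (L2 i2 (t3 y z (L1 s1 x)))"
      unfolding 4 by (simp add: t3_L2_right)
  qed
  \<comment> \<open>The middle argument is x, on which i1 and i2 agree: going out to the left it is
    i2, to the right i1.\<close>
  have core: "t3 (L2 i2 y) x w = t3 y x (L1 i1 w)" for y w
    using t3_L2_mid[OF Q2.i_skw, of y x w] t3_L1_mid[OF Q1.i_skw, of y x w] by (simp add: x)
  have JB: "L1 i1 (L2 s2 x) = - L2 i2 (L2 s2 x)" by (simp add: x L_commute)
  have IA: "L1 i1 (L1 s1 x) = - L2 i2 (L1 s1 x)" unfolding L_commute x by simp
  \<comment> \<open>Hence i1 and i2 agree up to sign on each of the four cubic expressions.\<close>
  have e [simp]: "L2 i2 (t3 x x x) = L1 i1 (t3 x x x)"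
    "L2 i2 (t3 (L2 s2 x) x x) = - L1 i1 (t3 (L2 s2 x) x x)"
    "L2 i2 (t3 x x (L1 s1 x)) = - L1 i1 (t3 x x (L1 s1 x))"
    "L2 i2 (t3 (L2 s2 x) x (L1 s1 x)) = L1 i1 (t3 (L2 s2 x) x (L1 s1 x))"
  proof -
    have "L1 i1 (t3 x x x) = t3 x x (L1 i1 x)" by (simp only: t3_L1_left[symmetric] x[symmetric] core)
    then show "L2 i2 (t3 x x x) = L1 i1 (t3 x x x)" by simp
    have "L1 i1 (t3 (L2 s2 x) x x) = - t3 (L2 s2 x) x (L1 i1 x)"
      by (simp only: t3_L1_left[symmetric] JB core mn)
    then show "L2 i2 (t3 (L2 s2 x) x x) = - L1 i1 (t3 (L2 s2 x) x x)" by simp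
    have "L1 i1 (t3 x x (L1 s1 x)) = t3 x x (L1 i1 (L1 s1 x))"
      by (simp only: t3_L1_left[symmetric] x[symmetric] core)
    then show "L2 i2 (t3 x x (L1 s1 x)) = - L1 i1 (t3 x x (L1 s1 x))" by simp
    have "L1 i1 (t3 (L2 s2 x) x (L1 s1 x)) = - t3 (L2 s2 x) x (L1 i1 (L1 s1 x))"
      by (simp only: t3_L1_left[symmetric] JB core mn)
    then show "L2 i2 (t3 (L2 s2 x) x (L1 s1 x)) = L1 i1 (t3 (L2 s2 x) x (L1 s1 x))" by simp
  qed
  have gl: "g (L1 i1 y) z = - g y (L1 i1 z)" "g (L1 s1 y) z = - g y (L1 s1 z)"
     "g (L2 s2 y) z = - g y (L2 s2 z)" "g (L2 i2 y) z = - g y (L2 i2 z)" for y z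
    using sk by (simp_all add: g_L1 g_L2)
  have self0: "c = 0" if "c = - c" for c :: 'k using that A.two by (simp add: eq_neg_iff_add_eq_0 flip: mult_2)
  have g0 [simp]: "g x (L1 i1 x) = 0" "g x (L1 s1 x) = 0" "g x (L2 s2 x) = 0"
     "g x (L1 i1 (L1 s1 x)) = 0" "g x (L1 i1 (L2 s2 x)) = 0"
  proof -
    show "g x (L1 i1 x) = 0" by (rule self0) (metis gl(1) g_sym)
    show "g x (L1 s1 x) = 0" by (rule self0) (metis gl(2) g_sym)
    show "g x (L2 s2 x) = 0" by (rule self0) (metis gl(3) g_sym)
    have "g x (L1 i1 (L1 s1 x)) = g (L1 i1 (L1 s1 x)) x" by (rule g_sym)
    then show "g x (L1 i1 (L1 s1 x)) = 0" by (intro self0) (simp add: gl)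
    \<comment> \<open>Commuting skew maps have a symmetric product, so skewness alone is not enough
      here: i1 has to be replaced by i2 on x, which anticommutes with s2.\<close>
    have "g x (L1 i1 (L2 s2 x)) = g (L1 i1 (L2 s2 x)) x" by (rule g_sym)
    also have "\<dots> = g x (L2 s2 (L1 i1 x))" by (simp add: gl)
    also have "\<dots> = g x (L2 s2 (L2 i2 x))" by (simp only: x)
    also have "\<dots> = - g x (L2 i2 (L2 s2 x))" by simp
    also have "\<dots> = g (L2 i2 x) (L2 s2 x)" by (simp add: gl)
    also have "\<dots> = g (L1 i1 x) (L2 s2 x)" by (simp only: x)
    also have "\<dots> = - g x (L1 i1 (L2 s2 x))" by (simp add: gl)
    finally show "g x (L1 i1 (L2 s2 x)) = 0" by (rule self0)
  qed
  let ?y = "L2 s2 (L1 i1 x)" and ?z = "L1 s1 (L1 i1 x)"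
  let ?E = "L1 s1 (L1 (c1 ?y x) x - L2 (c2 ?y x) x) + L2 s2 (L1 (c1 ?z x) x - L2 (c2 ?z x) x)"
  \<comment> \<open>Doubling matches the factor 2 in the two expansions.\<close>
  have "2 *\<^sub>T ?E = L1 s1 (2 *\<^sub>T L1 (c1 ?y x) x - 2 *\<^sub>T L2 (c2 ?y x) x)
      + L2 s2 (2 *\<^sub>T L1 (c1 ?z x) x - 2 *\<^sub>T L2 (c2 ?z x) x)"
    by (simp only: mT_diff_right mT_scale_right T.scale_right_distrib T.scale_right_diff_distrib)
  also have "\<dots> = 0"
    unfolding c1_as_t3 c2_as_t3 part_def
    by (simp add: Q1.i_nz Q1.s_nz Q2.s_nz mv x gl N_i mT_add_right mT_diff_right mT_scale_right L_commute
       T.scale_right_distrib T.scale_right_diff_distrib)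
  finally show ?thesis using A.two by simp
qed

end

section \<open>Special modules over a Jordan algebra of a quadratic form\<close>

text \<open>The Jordan algebra of the quadratic form N with unit \<open>e0 + e1\<close>. Trace and
  norm of s in \<open>act_sq\<close> are \<open>polar N s (e0 + e1)\<close> and N(s), the right side
  of \<open>\<beta>_der\<close> is twice the Jordan product of j and \<open>\<beta> x y\<close>, and
  the hyperbolic pair e0, e1 consists of complementary idempotents.\<close>

locale jordan_spin = vector_space sT
  for sT :: "'k::field \<Rightarrow> 't::ab_group_add \<Rightarrow> 't" (infixr "*s" 75) +
  fixes S :: "'t set" and N :: "'t \<Rightarrow> 'k" and e0 e1 :: 't and act :: "'t \<Rightarrow> 't \<Rightarrow> 't" and \<beta> :: "'t \<Rightarrow> 't \<Rightarrow> 't"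
  assumes two: "(2::'k) \<noteq> 0"
    and S: "subspace S"
    and N: "quadratic_form_on sT S N"
    and e0 [simp]: "e0 \<in> S" and e1 [simp]: "e1 \<in> S"
    and N_e0 [simp]: "N e0 = 0" and N_e1 [simp]: "N e1 = 0" and N_e0_e1 [simp]: "polar N e0 e1 = 1"
    and act: "bilinear_on sT sT sT S UNIV UNIV act"
    and act_unit: "act (e0 + e1) x = x"
    and act_sq: "s \<in> S \<Longrightarrow> act s (act s x) = polar N s (e0 + e1) *s act s x - N s *s x"
    and \<beta>: "bilinear_on sT sT sT UNIV UNIV S \<beta>"
    and \<beta>_alt [simp]: "\<beta> x x = 0"
    and \<beta>_der: "j \<in> S \<Longrightarrow> \<beta> (act j x) y + \<beta> x (act j y) =
      polar N j (e0 + e1) *s \<beta> x y + polar N (\<beta> x y) (e0 + e1) *s j - polar N j (\<beta> x y) *s (e0 + e1)"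
begin

abbreviation e :: 't where "e \<equiv> e0 + e1"
abbreviation b :: "'t \<Rightarrow> 't \<Rightarrow> 'k" where "b \<equiv> polar N"
definition V :: "'t set" where "V = {v \<in> S. b v e0 = 0 \<and> b v e1 = 0}"
text \<open>The polarization of x^2 = tr(x) x - N(x) e.\<close>

definition jprod :: "'t \<Rightarrow> 't \<Rightarrow> 't" where
  "jprod x y = (1 / 2) *s (b x e *s y + b y e *s x - b x y *s e)"

lemmas S_closed [simp] = subspace_add[OF S] subspace_scale[OF S] subspace_diff[OF S] subspace_0[OF S]
  subspace_neg[OF S]

lemma b_add_left: "x \<in> S \<Longrightarrow> y \<in> S \<Longrightarrow> z \<in> S \<Longrightarrow> b (x + y) z = b x z + b y z"
  and b_add_right: "x \<in> S \<Longrightarrow> y \<in> S \<Longrightarrow> z \<in> S \<Longrightarrow> b z (x + y) = b z x + b z y"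
  and b_scale_left [simp]: "x \<in> S \<Longrightarrow> z \<in> S \<Longrightarrow> b (c *s x) z = c * b x z"
  and b_scale_right [simp]: "x \<in> S \<Longrightarrow> z \<in> S \<Longrightarrow> b z (c *s x) = c * b z x"
  and N_scale [simp]: "x \<in> S \<Longrightarrow> N (c *s x) = c\<^sup>2 * N x"
  using N by (auto simp: quadratic_form_on_def bilinear_on_def linear_on_def)

lemma b_sym: "b x y = b y x" by (simp add: polar_def add.commute)

lemma b_minus_left [simp]: "x \<in> S \<Longrightarrow> z \<in> S \<Longrightarrow> b (- x) z = - b x z" using b_scale_left[of x z "-1"] by simp
lemma b_minus_right [simp]: "x \<in> S \<Longrightarrow> z \<in> S \<Longrightarrow> b z (- x) = - b z x" using b_scale_right[of x z "-1"] by simp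
lemma b_diff_left: "x \<in> S \<Longrightarrow> y \<in> S \<Longrightarrow> z \<in> S \<Longrightarrow> b (x - y) z = b x z - b y z"
  using b_add_left[of x "- y" z] by simp
lemma b_diff_right: "x \<in> S \<Longrightarrow> y \<in> S \<Longrightarrow> z \<in> S \<Longrightarrow> b z (x - y) = b z x - b z y"
  using b_add_right[of x "- y" z] by simp
lemma b_zero [simp]: "x \<in> S \<Longrightarrow> b 0 x = 0" "x \<in> S \<Longrightarrow> b x 0 = 0"
  using b_scale_left[of 0 x 0] b_scale_right[of 0 x 0] by simp_all

lemmas b_lin = b_add_left b_add_right b_diff_left b_diff_right

lemma b_self: "x \<in> S \<Longrightarrow> b x x = 2 * N x"
proof -
  assume "x \<in> S"
  then have "N (2 *s x) = 4 * N x" by simp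
  moreover have "2 *s x = x + x" by (metis one_add_one scale_left_distrib scale_one)
  ultimately show ?thesis by (simp add: polar_def)
qed

lemma b_e0_e0 [simp]: "b e0 e0 = 0" and b_e1_e1 [simp]: "b e1 e1 = 0" and b_e1_e0 [simp]: "b e1 e0 = 1"
  by (simp_all add: b_self b_sym[of e1 e0])

lemma act_add_left: "s \<in> S \<Longrightarrow> t \<in> S \<Longrightarrow> act (s + t) x = act s x + act t x"
  and act_scale_left [simp]: "s \<in> S \<Longrightarrow> act (c *s s) x = c *s act s x"
  and act_add_right: "s \<in> S \<Longrightarrow> act s (x + y) = act s x + act s y"
  and act_scale_right [simp]: "s \<in> S \<Longrightarrow> act s (c *s x) = c *s act s x"
  using act by (auto simp: bilinear_on_def linear_on_def)

lemma act_minus_left [simp]: "s \<in> S \<Longrightarrow> act (- s) x = - act s x" using act_scale_left[of s "-1" x] by simp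
lemma act_minus_right [simp]: "s \<in> S \<Longrightarrow> act s (- x) = - act s x" using act_scale_right[of s "-1" x] by simp
lemma act_zero [simp]: "act 0 x = 0" "s \<in> S \<Longrightarrow> act s 0 = 0"
  using act_scale_left[of 0 0 x] act_scale_right[of s 0 0] by simp_all
lemma act_diff_left: "s \<in> S \<Longrightarrow> t \<in> S \<Longrightarrow> act (s - t) x = act s x - act t x"
  using act_add_left[of s "- t" x] by simp
lemma act_diff_right: "s \<in> S \<Longrightarrow> act s (x - y) = act s x - act s y"
  using act_add_right[of s x "- y"] by simp

lemmas act_lin = act_add_left act_add_right act_diff_left act_diff_right

lemma \<beta>_mem [simp]: "\<beta> x y \<in> S"
  and \<beta>_add_left: "\<beta> (x + x') y = \<beta> x y + \<beta> x' y"
  and \<beta>_add_right: "\<beta> y (x + x') = \<beta> y x + \<beta> y x'"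
  and \<beta>_scale_left [simp]: "\<beta> (c *s x) y = c *s \<beta> x y"
  and \<beta>_scale_right [simp]: "\<beta> y (c *s x) = c *s \<beta> y x"
  using \<beta> by (auto simp: bilinear_on_def linear_on_def)

lemma \<beta>_anti: "\<beta> x y = - \<beta> y x"
proof -
  have "0 = \<beta> (x + y) (x + y)" by (simp only: \<beta>_alt)
  also have "\<dots> = \<beta> x y + \<beta> y x" by (simp only: \<beta>_add_left \<beta>_add_right) simp
  finally show ?thesis by (simp add: eq_neg_iff_add_eq_0)
qed

lemma \<beta>_minus_right [simp]: "\<beta> y (- x) = - \<beta> y x" using \<beta>_scale_right[of y "-1" x] by simp
lemma \<beta>_diff_right: "\<beta> y (x - x') = \<beta> y x - \<beta> y x'" using \<beta>_add_right[of y x "- x'"] by simp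
lemma \<beta>_zero [simp]: "\<beta> 0 y = 0" "\<beta> y 0 = 0" using \<beta>_scale_left[of 0 0 y] \<beta>_scale_right[of y 0 0] by simp_all

lemma act_linearized:
  assumes "s \<in> S" "t \<in> S"
  shows "act s (act t x) = b s e *s act t x + b t e *s act s x - b s t *s x - act t (act s x)"
proof -
  have "act (s + t) (act (s + t) x) = b (s + t) e *s act (s + t) x - N (s + t) *s x"
    using assms by (simp add: act_sq)
  moreover have "N (s + t) = N s + N t + b s t" by (simp add: polar_def)
  ultimately show ?thesis using assms
    by (simp add: act_lin act_sq b_lin scale_left_distrib scale_right_distrib algebra_simps)
qed

lemma half_double: "(1 / 2) *s (x + x) = x"
proof -
  have "x + x = 2 *s x" by (metis one_add_one scale_left_distrib scale_one)
  then show ?thesis using two by simp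
qed

lemma jprod_mem [simp]: "x \<in> S \<Longrightarrow> y \<in> S \<Longrightarrow> jprod x y \<in> S" by (simp add: jprod_def)

lemma jprod_commute: "jprod x y = jprod y x" by (simp add: jprod_def b_sym add.commute)

lemma jprod_unit: "x \<in> S \<Longrightarrow> jprod e x = x"
  using two by (simp add: jprod_def b_lin b_sym[of x] half_double flip: scale_left_distrib)

lemma jprod_unit_right: "x \<in> S \<Longrightarrow> jprod x e = x"
  using jprod_unit[of x] by (simp only: jprod_commute[of x e])

lemma jprod_add_right: "x \<in> S \<Longrightarrow> y \<in> S \<Longrightarrow> z \<in> S \<Longrightarrow> jprod x (y + z) = jprod x y + jprod x z"
  by (simp add: jprod_def b_lin scale_left_distrib scale_right_distrib scale_right_diff_distrib)

lemma jprod_scale_right: "x \<in> S \<Longrightarrow> y \<in> S \<Longrightarrow> jprod x (c *s y) = c *s jprod x y"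
  by (simp add: jprod_def scale_right_distrib scale_right_diff_distrib mult.commute mult.left_commute)

lemma jprod_bilinear: "bilinear_on sT sT sT S S S jprod"
  unfolding bilinear_on_def linear_on_def
  by (simp add: jprod_add_right jprod_scale_right jprod_commute[of x z for x z])

lemma jprod_self: "x \<in> S \<Longrightarrow> jprod x x = b x e *s x - N x *s e"
  using two by (simp add: jprod_def b_self scale_right_diff_distrib half_double)

lemma jprod_square_left:
  assumes "x \<in> S" "y \<in> S"
  shows "jprod (jprod x x) y = b x e *s jprod x y - N x *s y"
proof -
  have "jprod (jprod x x) y = jprod y (b x e *s x + (- N x) *s e)"
    by (subst jprod_commute) (simp only: jprod_self[OF assms(1)] diff_conv_add_uminus scale_minus_left)
  also have "\<dots> = b x e *s jprod y x + (- N x) *s jprod y e"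
    using assms by (simp only: jprod_add_right jprod_scale_right S_closed e0 e1)
  also have "\<dots> = b x e *s jprod x y - N x *s y"
    unfolding jprod_unit_right[OF assms(2)] jprod_commute[of y x] by simp
  finally show ?thesis .
qed

text \<open>The square of x is a combination of x and the unit, so multiplication by it commutes
  with multiplication by x.\<close>

lemma jordan_identity:
  assumes "x \<in> S" "y \<in> S"
  shows "jprod (jprod (jprod x x) y) x = jprod (jprod x x) (jprod y x)"
proof -
  have "jprod (jprod (jprod x x) y) x = jprod x (b x e *s jprod x y + (- N x) *s y)"
    by (subst jprod_commute) (simp only: jprod_square_left[OF assms] diff_conv_add_uminus scale_minus_left)
  also have "\<dots> = b x e *s jprod x (jprod x y) + (- N x) *s jprod x y"
    using assms by (simp only: jprod_add_right jprod_scale_right S_closed jprod_mem)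
  also have "\<dots> = jprod (jprod x x) (jprod x y)"
    using jprod_square_left[OF assms(1) jprod_mem[OF assms]] by simp
  finally show ?thesis unfolding jprod_commute[of y x] .
qed

lemma act_jprod:
  assumes "x \<in> S" "y \<in> S"
  shows "act (jprod x y) w = (1 / 2) *s (act x (act y w) + act y (act x w))"
  using assms by (simp add: jprod_def act_lin act_unit act_linearized[of x y])

lemma \<beta>_jprod:
  assumes "j \<in> S" shows "jprod j (\<beta> x y) = (1 / 2) *s (\<beta> (act j x) y + \<beta> x (act j y))"
  using assms by (simp add: \<beta>_der jprod_def)

lemma U_formula:
  assumes "j \<in> S" "y \<in> S"
  shows "U_op sT jprod j y = jprod j (jprod j y) + jprod j (jprod j y) - jprod (jprod j j) y"
  unfolding U_op_def by (metis one_add_one scale_left_distrib scale_one)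

text \<open>By \<open>act_jprod\<close> the product acts as half an anticommutator, and for such a
  product 2 j(jy) - (jj)y is the associative jyj.\<close>

lemma act_U:
  assumes "j \<in> S" "y \<in> S"
  shows "act (U_op sT jprod j y) w = act j (act y (act j w))"
proof -
  have h: "x = (1 / 2) *s x + (1 / 2) *s x" for x by (metis half_double scale_right_distrib)
  have 1: "act (jprod j (jprod j y)) w + act (jprod j (jprod j y)) w
      = act j (act (jprod j y) w) + act (jprod j y) (act j w)"
    using assms by (simp add: act_jprod[of j "jprod j y"] half_double flip: scale_right_distrib)
  have 2: "act (jprod (jprod j j) y) w = (1 / 2) *s (act j (act j (act y w)) + act y (act j (act j w)))"
    using assms by (simp add: act_jprod half_double)
  have "act (U_op sT jprod j y) w = act j (act (jprod j y) w) + act (jprod j y) (act j w) - act (jprod (jprod j j) y) w"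
    unfolding U_formula[OF assms] using assms 1 by (simp add: act_lin)
  also have "\<dots> = (1 / 2) *s (act j (act y (act j w)) + act j (act y (act j w)))"
    unfolding 2 using assms by (simp add: act_jprod act_lin scale_right_distrib algebra_simps)
  finally show ?thesis by (simp add: half_double)
qed

text \<open>Multiplication by j on \<open>\<beta>\<close> is half the sum of the actions on its two
  arguments. In 2 j(j w) - (jj) w the terms with both actions on one argument cancel.\<close>

lemma \<beta>_U:
  assumes "j \<in> S"
  shows "U_op sT jprod j (\<beta> x y) = \<beta> (act j x) (act j y)"
proof -
  have "U_op sT jprod j (\<beta> x y) = 2 *s jprod j (jprod j (\<beta> x y)) - jprod (jprod j j) (\<beta> x y)"
    by (simp add: U_op_def)
  also have "2 *s jprod j (jprod j (\<beta> x y)) = jprod j (\<beta> (act j x) y) + jprod j (\<beta> x (act j y))"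
    using assms two by (simp add: \<beta>_jprod jprod_scale_right jprod_add_right)
  also have "\<dots> = (1 / 2) *s (\<beta> (act j (act j x)) y + \<beta> (act j x) (act j y) + (\<beta> (act j x) (act j y) + \<beta> x (act j (act j y))))"
    using assms by (simp add: \<beta>_jprod scale_right_distrib)
  also have "jprod (jprod j j) (\<beta> x y) = (1 / 2) *s (\<beta> (act j (act j x)) y + \<beta> x (act j (act j y)))"
    using assms by (simp add: \<beta>_jprod act_jprod half_double)
  finally have "U_op sT jprod j (\<beta> x y) = (1 / 2) *s (\<beta> (act j x) (act j y) + \<beta> (act j x) (act j y))"
    by (simp add: scale_right_distrib)
  then show ?thesis by (simp add: half_double)
qed

lemma special_module:
  assumes jm: "\<And>x y. x \<in> S \<Longrightarrow> y \<in> S \<Longrightarrow> jm x y = jprod x y"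
  shows "special_jordan_module sT S jm e sT UNIV act"
proof -
  have U: "U_op sT jm x y = U_op sT jprod x y" if "x \<in> S" "y \<in> S" for x y
    using that by (simp add: U_op_def jm)
  have "bilinear_on sT sT sT S S S jm"
    using jprod_bilinear by (simp add: bilinear_on_def linear_on_def jm)
  then show ?thesis
    by unfold_locales
      (simp_all only: S U jm jprod_unit jordan_identity act act_unit act_U subspace_UNIV jprod_mem S_closed e0 e1,
       simp_all add: jprod_commute)
qed

subsection \<open>The Peirce decomposition\<close>

lemma subspace_V: "subspace V"
proof (rule subspaceI)
  show "0 \<in> V" by (simp add: V_def)
  fix x y c assume x: "x \<in> V"
  then show "c *s x \<in> V" by (simp add: V_def)
  assume "y \<in> V"
  with x show "x + y \<in> V" by (simp add: V_def b_add_left)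
qed

lemma V_I: "v \<in> S \<Longrightarrow> b v e0 = 0 \<Longrightarrow> b v e1 = 0 \<Longrightarrow> v \<in> V" by (simp add: V_def)

lemma V_part: "x \<in> S \<Longrightarrow> x - b x e1 *s e0 - b x e0 *s e1 \<in> V" by (simp add: V_def b_lin)

lemma VD [simp]: "v \<in> V \<Longrightarrow> v \<in> S" "v \<in> V \<Longrightarrow> b v e0 = 0" "v \<in> V \<Longrightarrow> b v e1 = 0"
  by (simp_all add: V_def)
lemma VD' [simp]: "v \<in> V \<Longrightarrow> b e0 v = 0" "v \<in> V \<Longrightarrow> b e1 v = 0"
  by (simp_all add: b_sym[of e0 v] b_sym[of e1 v])

lemma spin_parts:
  assumes "x \<in> S"
  shows "spin_parts sT V e0 e1 x = (b x e1, x - b x e1 *s e0 - b x e0 *s e1, b x e0)"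
  unfolding spin_parts_def
proof (rule the_equality, clarify)
  show "x - b x e1 *s e0 - b x e0 *s e1 \<in> V \<and>
     x = b x e1 *s e0 + (x - b x e1 *s e0 - b x e0 *s e1) + b x e0 *s e1"
    using V_part[OF assms] by simp
next
  fix p assume *: "case p of (t0, v, t1) \<Rightarrow> v \<in> V \<and> x = t0 *s e0 + v + t1 *s e1"
  obtain t0 v t1 where p: "p = (t0, v, t1)" by (cases p)
  with * have v: "v \<in> V" and x: "x = t0 *s e0 + v + t1 *s e1" by auto
  have "b x e1 = t0" "b x e0 = t1" using v by (simp_all add: x b_lin)
  then show "p = (b x e1, x - b x e1 *s e0 - b x e0 *s e1, b x e0)" by (simp add: p x)
qed

text \<open>The sign reconciles two conventions: v in V has trace 0, so its square is -N(v) e, while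
  the spin factor sets it to Q(v) e.\<close>

lemma spin_mult:
  assumes "x \<in> S" "y \<in> S"
  shows "spin_mult sT V (\<lambda>v. - N v) e0 e1 x y = jprod x y"
proof -
  define t0 t1 v where "t0 = b x e1" "t1 = b x e0" "v = x - b x e1 *s e0 - b x e0 *s e1"
  define t0' t1' w where "t0' = b y e1" "t1' = b y e0" "w = y - b y e1 *s e0 - b y e0 *s e1"
  note d = t0_t1_v_def t0'_t1'_w_def
  have p: "spin_parts sT V e0 e1 x = (t0, v, t1)" "spin_parts sT V e0 e1 y = (t0', w, t1')"
    using spin_parts assms by (simp_all add: d)
  have V: "v \<in> V" "w \<in> V" using assms by (simp_all add: d V_part)
  have x: "x = t0 *s e0 + v + t1 *s e1" and y: "y = t0' *s e0 + w + t1' *s e1" by (simp_all add: d)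
  have pol: "polar (\<lambda>v. - N v) v w = - b v w" by (simp add: polar_def)
  have bx: "b x e = t0 + t1" "b y e = t0' + t1'" using assms by (simp_all add: d b_lin add.commute)
  have bxy: "b x y = t0 * t1' + t1 * t0' + b v w"
    using V by (simp add: x y b_lin)
  have h: "z = (1 / 2) *s z + (1 / 2) *s z" for z by (metis half_double scale_right_distrib)
  have j: "jprod x y = (1 / 2) *s ((t0 + t1) *s (t0' *s e0 + w + t1' *s e1) + (t0' + t1') *s (t0 *s e0 + v + t1 *s e1)
      - (t0 * t1' + t1 * t0' + b v w) *s (e0 + e1))"
    unfolding jprod_def bx bxy x[symmetric] y[symmetric] ..
  have "spin_mult sT V (\<lambda>v. - N v) e0 e1 x y = ((1 / 2) *s ((t0 * t0') *s e0) + (1 / 2) *s ((t0 * t0') *s e0))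
        + ((1 / 2) *s ((t1 * t1') *s e1) + (1 / 2) *s ((t1 * t1') *s e1))
        + (1/2 * t0) *s w + (1/2 * t1) *s w + (1/2 * t0') *s v + (1/2 * t1') *s v
        + (1/2 * - b v w) *s (e0 + e1)"
    unfolding spin_mult_def p h[symmetric] by (simp add: pol)
  also have "\<dots> = jprod x y"
    unfolding j by (simp only: scale_scale scale_left_distrib scale_right_distrib scale_right_diff_distrib
      scale_left_diff_distrib distrib_left distrib_right scale_minus_left mult_minus_right diff_conv_add_uminus
      minus_add_distrib) (simp add: algebra_simps)
  finally show ?thesis .
qed

end

section \<open>Peirce components of the module and of the values of the bilinear map\<close>

context jordan_spin
begin

abbreviation F :: "'t \<Rightarrow> 't \<Rightarrow> 'k" where "F v w \<equiv> - b v w"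
definition X0 :: "'t set" where "X0 = {x. act e0 x = x}"
definition X1 :: "'t set" where "X1 = {x. act e0 x = 0}"

lemma X0D: "x \<in> X0 \<Longrightarrow> act e0 x = x" and X1D: "x \<in> X1 \<Longrightarrow> act e0 x = 0"
  by (simp_all add: X0_def X1_def)

lemma subspace_X0: "subspace X0"
  by (auto simp: subspace_def X0_def act_add_right)

lemma b_e0_e [simp]: "b e0 e = 1" and V_tr [simp]: "v \<in> V \<Longrightarrow> b v e = 0"
  by (simp_all add: b_add_right)

lemma act_VV: "v \<in> V \<Longrightarrow> w \<in> V \<Longrightarrow> act v (act w x) = F v w *s x - act w (act v x)"
  using act_linearized[of v w x] by simp

lemma act_V_sq: "v \<in> V \<Longrightarrow> act v (act v x) = - (N v *s x)"
  by (simp add: act_sq)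

lemma act_e0_V: "v \<in> V \<Longrightarrow> act e0 (act v x) = act v x - act v (act e0 x)"
  using act_linearized[of e0 v x] by simp

lemma V_X0: "v \<in> V \<Longrightarrow> x \<in> X0 \<Longrightarrow> act v x \<in> X1" by (simp add: X0_def X1_def act_e0_V)
lemma V_X1: "v \<in> V \<Longrightarrow> x \<in> X1 \<Longrightarrow> act v x \<in> X0" by (simp add: X0_def X1_def act_e0_V)

lemma scaled_e_eq: "p *s e0 + r *s e1 = p' *s e0 + r' *s e1 \<Longrightarrow> p = p' \<and> r = r'"
proof -
  assume eq: "p *s e0 + r *s e1 = p' *s e0 + r' *s e1"
  have "b (p *s e0 + r *s e1) e1 = p" "b (p' *s e0 + r' *s e1) e1 = p'"
    "b (p *s e0 + r *s e1) e0 = r" "b (p' *s e0 + r' *s e1) e0 = r'" by (simp_all add: b_add_left)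
  with eq show ?thesis by metis
qed

text \<open>The coefficient of \<open>\<beta>\<close>: on \<open>X0\<close> its values are multiples
  of e0, on \<open>X1\<close> of e1.\<close>

definition \<tau> :: "'t \<Rightarrow> 't \<Rightarrow> 'k" where "\<tau> x y = b (\<beta> x y) e"

lemma two_cancel: "c = - c \<Longrightarrow> c = (0::'k)" using two by (simp add: eq_neg_iff_add_eq_0 flip: mult_2)

text \<open>The idempotent e0 acts by 0 and by 1 on the two arguments, hence multiplies the value by
  1/2, and V is its Peirce space for 1/2.\<close>

lemma \<beta>_X1_X0:
  assumes "x \<in> X1" "y \<in> X0" shows "\<beta> x y \<in> V"
proof -
  let ?w = "\<beta> x y"
  have *: "?w = ?w + b ?w e *s e0 - b e0 ?w *s e"
    using \<beta>_der[of e0 x y] assms by (simp add: X0D X1D)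
  have "b ?w e0 = b (?w + b ?w e *s e0 - b e0 ?w *s e) e0" by (subst *) (rule refl)
  then have 1: "b ?w e0 = 0" by (simp add: b_lin b_sym[of e0 "?w"])
  have "b ?w e1 = b (?w + b ?w e *s e0 - b e0 ?w *s e) e1" by (subst *) (rule refl)
  moreover have "(2::'k) \<noteq> 1" by (metis one_add_one add_cancel_left_left zero_neq_one)
  ultimately have 2: "b ?w e1 = 0" using 1 by (simp add: b_lin b_sym[of e0 "?w"])
  from 1 2 show ?thesis by (intro V_I) simp_all
qed

lemma \<beta>_X0:
  assumes "x \<in> X0" "y \<in> X0" shows "\<beta> x y = \<tau> x y *s e0"
proof -
  let ?w = "\<beta> x y"
  have "?w + ?w = ?w + b ?w e *s e0 - b e0 ?w *s e"
    using \<beta>_der[of e0 x y] assms by (simp add: X0D)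
  then have *: "?w = b ?w e *s e0 - b e0 ?w *s e" by (simp add: algebra_simps)
  have "b ?w e0 = b (b ?w e *s e0 - b e0 ?w *s e) e0" by (subst *) (rule refl)
  also have "\<dots> = - b ?w e0" by (simp add: b_lin b_sym[of e0 "?w"])
  finally have "b e0 ?w = 0" unfolding b_sym[of e0 ?w] by (rule two_cancel)
  with * show ?thesis by (simp add: \<tau>_def)
qed

lemma \<beta>_X1:
  assumes "x \<in> X1" "y \<in> X1" shows "\<beta> x y = \<tau> x y *s e1"
proof -
  let ?w = "\<beta> x y"
  have *: "?w = b e0 ?w *s e - b ?w e *s e0"
    using \<beta>_der[of e0 x y] assms by (simp add: X1D algebra_simps)
  have "b ?w e1 = b (b e0 ?w *s e - b ?w e *s e0) e1" by (subst *) (rule refl)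
  also have "\<dots> = - b ?w e1" by (simp add: b_lin b_sym[of e0 "?w"])
  finally have "b ?w e1 = 0" by (rule two_cancel)
  then have "b e0 ?w = b ?w e" by (simp add: b_lin b_sym[of e0 "?w"])
  with * show ?thesis by (simp add: \<tau>_def scale_right_distrib)
qed

text \<open>V exchanges \<open>X0\<close> and \<open>X1\<close>, so one term of the derivation rule
  is a multiple of e0 and the other of e1, whereas their sum is a multiple of
  \<open>e0 + e1\<close>; the coefficients must agree.\<close>

lemma der_V_mixed:
  assumes "v \<in> V" "x \<in> X1" "y \<in> X0"
  shows "\<tau> (act v x) y = F v (\<beta> x y)" "\<tau> x (act v y) = F v (\<beta> x y)"
proof -
  have m: "act v x \<in> X0" "act v y \<in> X1" using assms V_X0 V_X1 by auto
  have w: "\<beta> x y \<in> V" by (rule \<beta>_X1_X0[OF assms(2,3)])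
  have "\<tau> (act v x) y *s e0 + \<tau> x (act v y) *s e1 = F v (\<beta> x y) *s e0 + F v (\<beta> x y) *s e1"
    using \<beta>_der[of v x y] assms m w by (simp add: \<beta>_X0 \<beta>_X1 scale_right_distrib)
  then show "\<tau> (act v x) y = F v (\<beta> x y)" "\<tau> x (act v y) = F v (\<beta> x y)"
    using scaled_e_eq by blast+
qed

lemma der_V_X1:
  assumes "v \<in> V" "x \<in> X1" "y \<in> X1"
  shows "\<beta> (act v x) y + \<beta> x (act v y) = \<tau> x y *s v"
  using \<beta>_der[of v x y] assms by (simp add: \<beta>_X1 b_lin)

lemma der_V_X0:
  assumes "v \<in> V" "x \<in> X0" "y \<in> X0"
  shows "\<beta> (act v x) y + \<beta> x (act v y) = \<tau> x y *s v"
  using \<beta>_der[of v x y] assms by (simp add: \<beta>_X0 b_lin)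

end

section \<open>From the two conditions of (2) to the axioms of a quadrangular algebra\<close>

locale jordan_spin_base = jordan_spin sT S N e0 e1 act \<beta>
  for sT :: "'k::field \<Rightarrow> 't::ab_group_add \<Rightarrow> 't" (infixr "*s" 75)
    and S :: "'t set" and N :: "'t \<Rightarrow> 'k" and e0 e1 :: 't and act :: "'t \<Rightarrow> 't \<Rightarrow> 't" and \<beta> :: "'t \<Rightarrow> 't \<Rightarrow> 't" +
  fixes u :: 't
  assumes u: "u \<in> V" "N u = -1"
    and aniso: "v \<in> V \<Longrightarrow> N v = 0 \<Longrightarrow> v = 0"
    and cubic: "x \<in> X0 \<Longrightarrow> v \<in> V \<Longrightarrow> act (\<beta> (act v x) x) x = act v (act u (act (\<beta> (act u x) x) x))"
    and regular: "x \<in> X0 \<Longrightarrow> x \<noteq> 0 \<Longrightarrow> \<beta> (act u x) x \<noteq> 0"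
    and X0_nontrivial: "X0 \<noteq> {0}"
begin

lemma u_S [simp]: "u \<in> S" using u by simp

lemma uu [simp]: "act u (act u x) = x" using act_V_sq[OF u(1)] by (simp add: u(2))

lemma u_X0 [simp]: "x \<in> X0 \<Longrightarrow> act u x \<in> X1" and u_X1 [simp]: "x \<in> X1 \<Longrightarrow> act u x \<in> X0"
  using u V_X0 V_X1 by auto

lemma \<tau>_uu:
  assumes "x \<in> X0" "y \<in> X0"
  shows "\<tau> (act u x) (act u y) = \<tau> x y" "F u (\<beta> (act u x) y) = \<tau> x y"
  using der_V_mixed[OF u(1) u_X0[OF assms(1)] assms(2)] by simp_all

lemma \<tau>_self: "\<tau> x x = 0" by (simp add: \<tau>_def)

lemma \<tau>_anti: "\<tau> x y = - \<tau> y x" by (simp add: \<tau>_def \<beta>_anti[of x y])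

abbreviation xd where "xd x v \<equiv> act v (act u x)"
abbreviation h where "h x y \<equiv> \<beta> (act u x) y"

lemma pol_Q: "polar (\<lambda>v. - N v) v w = F v w" by (simp add: polar_def)

lemma xd_mem [simp]: "x \<in> X0 \<Longrightarrow> v \<in> V \<Longrightarrow> xd x v \<in> X0" using V_X1 by simp

lemma h_mem [simp]: "x \<in> X0 \<Longrightarrow> y \<in> X0 \<Longrightarrow> h x y \<in> V" by (rule \<beta>_X1_X0) simp_all

lemma quad_A3:
  assumes "x \<in> X0" "v \<in> V" "v \<noteq> 0"
  shows "xd (xd x v) (base_inverse sT (\<lambda>v. - N v) u v) = x"
proof -
  have n: "N v \<noteq> 0" using aniso assms by blast
  \<comment> \<open>The conjugate of v with respect to the base point u.\<close>
  let ?w = "F u v *s u - v"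
  have w: "?w \<in> V" using u assms subspace_V by (intro subspace_diff subspace_scale)
  have "act ?w (act u (act v (act u x))) = F u v *s act v (act u x) - act v (act u (act v (act u x)))"
    using assms u by (simp add: act_lin)
  also have "act v (act u (act v (act u x))) = F u v *s act v (act u x) + N v *s x"
    using assms u by (simp add: act_VV[of u v] act_lin act_V_sq)
  finally have "act ?w (act u (act v (act u x))) = - (N v *s x)" by simp
  then show ?thesis using n assms u w
    by (simp add: base_inverse_def base_sigma_def pol_Q)
qed

lemma quad_B2:
  assumes "x \<in> X0" "y \<in> X0" "v \<in> V"
  shows "h x (xd y v) = h y (xd x v) + F (h x y) u *s v"
proof -
  have "\<beta> (act v (act u x)) (act u y) + \<beta> (act u x) (act v (act u y)) = \<tau> x y *s v"
    using der_V_X1[OF assms(3) u_X0 u_X0] assms by (simp add: \<tau>_uu)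
  moreover have "F (h x y) u = \<tau> x y" using \<tau>_uu(2) assms by (simp add: b_sym[of "h x y" u])
  ultimately show ?thesis using \<beta>_anti[of "act v (act u x)" "act u y"] by (simp add: algebra_simps)
qed

lemma quad_B3:
  assumes "x \<in> X0" "y \<in> X0" "v \<in> V"
  shows "F (h (xd x v) y) u = F (h x y) v"
proof -
  have "F (h (xd x v) y) u = \<tau> (xd x v) y" using \<tau>_uu(2) assms by (simp add: b_sym[of "h (xd x v) y" u])
  also have "\<dots> = F (h x y) v" using der_V_mixed(1)[OF assms(3) u_X0 assms(2)] assms
    by (simp add: b_sym[of "h x y" v])
  finally show ?thesis .
qed

text \<open>Both sides equal -v(w x). On the left, h(x, x v) is a combination of u, w and c, and the
  cubic identity trades c x for v(u(w x)).\<close>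

lemma quad_D1:
  assumes x: "x \<in> X0" and v: "v \<in> V"
  shows "act (h x (xd x v)) (act u x) = act v (act u (act (h x x) (act u x)))"
proof -
  define w where "w = \<beta> (act u x) x"
  define c where "c = \<beta> (act v x) x"
  define f where "f = F u v"
  have V [simp]: "w \<in> V" "c \<in> V" "u \<in> V" "v \<in> V" using assms u by (simp_all add: w_def c_def \<beta>_X1_X0 V_X0)
  \<comment> \<open>As \<open>\<tau> x x\<close> vanishes, w is orthogonal to u, so their actions
    anticommute.\<close>
  have wu: "F u w = 0" using \<tau>_uu(2)[OF x x] by (simp add: w_def \<tau>_self)
  have 1: "\<beta> (act u x) (act u (act v x)) = - (F u c *s u) + c"
  proof -
    have m: "act u (act v x) \<in> X0" using assms by (simp add: V_X0)
    have "\<beta> (act u x) (act u (act v x)) + \<beta> x (act v x) = \<tau> x (act u (act v x)) *s u"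
      using der_V_X0[OF u(1) x m] by simp
    moreover have "\<tau> x (act u (act v x)) = - F u c"
      using der_V_mixed(1)[OF u(1) V_X0[OF v x] x] \<tau>_anti[of x "act u (act v x)"] by (simp add: c_def)
    moreover have "\<beta> x (act v x) = - c" unfolding c_def by (rule \<beta>_anti)
    ultimately show ?thesis by (simp add: algebra_simps)
  qed
  have "xd x v = f *s x - act u (act v x)" using act_VV[of v u x] v u by (simp add: f_def b_sym[of v u])
  then have "h x (xd x v) = f *s w + F u c *s u - c"
    by (simp add: \<beta>_diff_right 1 w_def)
  then have "act (h x (xd x v)) (act u x) = f *s act w (act u x) + F u c *s x - act c (act u x)"
    by (simp add: act_lin)
  also have "act c (act u x) = F u c *s x - act u (act c x)" by (simp add: act_VV[of c u x] b_sym[of c u])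
  also have "act c x = act v (act u (act w x))" using cubic[OF x v] by (simp add: c_def w_def)
  also have "act u (act v (act u (act w x))) = f *s act u (act w x) - act v (act w x)"
    by (simp add: act_VV[of u v] f_def)
  also have "act w (act u x) = - act u (act w x)" using wu by (simp add: act_VV[of w u x] b_sym[of w u])
  finally have "act (h x (xd x v)) (act u x) = - act v (act w x)" by simp
  moreover have "act (h x x) (act u x) = - act u (act w x)" using wu by (simp add: act_VV[of w u x] b_sym[of w u] flip: w_def)
  ultimately show ?thesis by simp
qed

lemma quadrangular: "quadrangular_algebra sT sT V (\<lambda>v. - N v) u X0 xd h"
proof -
  have char: "CHAR('k) \<noteq> 2" using two by (metis of_nat_CHAR of_nat_numeral)
  have h2: "(1 / 2) *s v \<in> V" if "v \<in> V" for v using that subspace_V by (rule subspace_scale[rotated])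
  show ?thesis
  proof
    show "CHAR('k) \<noteq> 2" by (rule char)
    show "subspace V" by (rule subspace_V)
    show "quadratic_form_on sT V (\<lambda>v. - N v)"
      using u by (simp add: quadratic_form_on_def bilinear_on_def linear_on_def pol_Q b_lin)
    show "anisotropic_on V (\<lambda>v. - N v)" using aniso by (simp add: anisotropic_on_def)
    show "u \<in> V" "- N u = 1" using u by simp_all
    show "subspace X0" by (rule subspace_X0)
    show "X0 \<noteq> {0}" by (rule X0_nontrivial)
    show "bilinear_on sT sT sT X0 V X0 xd"
      by (simp add: bilinear_on_def linear_on_def act_lin)
    show "bilinear_on sT sT sT X0 X0 V h"
      by (simp add: bilinear_on_def linear_on_def act_lin \<beta>_add_left \<beta>_add_right)
    show "xd x u = x" if "x \<in> X0" for x by simp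
    show "xd (xd x v) (base_inverse sT (\<lambda>v. - N v) u v) = x" if "x \<in> X0" "v \<in> V" "v \<noteq> 0" for x v
      using that by (rule quad_A3)
    show "h x (xd y v) = h y (xd x v) + polar (\<lambda>v. - N v) (h x y) u *s v" if "x \<in> X0" "y \<in> X0" "v \<in> V" for x y v
      unfolding pol_Q using that by (rule quad_B2)
    show "polar (\<lambda>v. - N v) (h (xd x v) y) u = polar (\<lambda>v. - N v) (h x y) v" if "x \<in> X0" "y \<in> X0" "v \<in> V" for x y v
      unfolding pol_Q using that by (rule quad_B3)
    show "xd x (theta_map sT xd h x v) = xd (xd x (theta_map sT xd h x u)) v" if "x \<in> X0" "v \<in> V" for x v
      using that by (simp add: theta_map_def quad_D1)
    show "theta_map sT xd h x u \<noteq> 0" if "x \<in> X0" "x \<noteq> 0" for x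
      using that regular two by (simp add: theta_map_def)
  qed
qed

end

section \<open>The Albert form and the isotope determined by a vector\<close>

context tensor_pair
begin

text \<open>On skew elements \<open>pr1\<close> and \<open>pr2\<close> invert \<open>emb\<close>; the map \<open>nat\<close> is the natural map, \<open>fA\<close> the polar form
  of the Albert form, and \<open>bt\<close>, defined below, is \<open>\<beta>\<close>.\<close>

definition emb :: "'a \<Rightarrow> 'b \<Rightarrow> 't" where "emb s t = s \<otimes> one2 + one1 \<otimes> t"
definition pr1 :: "'t \<Rightarrow> 'a" where "pr1 x = (1 / 2) *\<^sub>1 ctr2 x one2"
definition pr2 :: "'t \<Rightarrow> 'b" where "pr2 x = (1 / 2) *\<^sub>2 ctr1 x one1"
definition skS :: "'t set" where "skS = {emb s t |s t. s \<in> A.skw \<and> t \<in> B.skw}"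
definition nat :: "'t \<Rightarrow> 't" where "nat x = emb (pr1 x) (- pr2 x)"
definition fA :: "'t \<Rightarrow> 't \<Rightarrow> 'k" where "fA x y = A.f (pr1 x) (pr1 y) - B.f (pr2 x) (pr2 y)"

lemma pr1_add: "pr1 (x + y) = pr1 x + pr1 y" by (simp add: pr1_def ctr2_add A.scale_right_distrib)
lemma pr2_add: "pr2 (x + y) = pr2 x + pr2 y" by (simp add: pr2_def ctr1_add B.scale_right_distrib)
lemma pr1_scale [simp]: "pr1 (c *\<^sub>T x) = c *\<^sub>1 pr1 x" by (simp add: pr1_def mult.commute)
lemma pr2_scale [simp]: "pr2 (c *\<^sub>T x) = c *\<^sub>2 pr2 x" by (simp add: pr2_def mult.commute)

lemma pr1_minus [simp]: "pr1 (- x) = - pr1 x" using pr1_scale[of "-1" x] by simp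
lemma pr2_minus [simp]: "pr2 (- x) = - pr2 x" using pr2_scale[of "-1" x] by simp

lemma emb_add: "emb (s + s') (t + t') = emb s t + emb s' t'" by (simp add: emb_def tn_add_left tn_add_right)
lemma emb_scale: "emb (c *\<^sub>1 s) (c *\<^sub>2 t) = c *\<^sub>T emb s t" by (simp add: emb_def T.scale_right_distrib)
lemma pr_emb [simp]:
  assumes "s \<in> A.skw" "t \<in> B.skw"
  shows "pr1 (emb s t) = s" "pr2 (emb s t) = t"
  using assms A.two
  by (simp_all add: pr1_def pr2_def emb_def ctr1_add ctr2_add A.skw_def B.skw_def A.f_sym[of one1 s] B.f_sym[of one2 t])

lemma emb_mem [simp]: "s \<in> A.skw \<Longrightarrow> t \<in> B.skw \<Longrightarrow> emb s t \<in> skS" by (auto simp: skS_def)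

lemma skS_D:
  assumes "x \<in> skS"
  shows "pr1 x \<in> A.skw" "pr2 x \<in> B.skw" "emb (pr1 x) (pr2 x) = x"
  using assms by (auto simp: skS_def)

lemma subspace_skS: "T.subspace skS"
proof (rule T.subspaceI)
  show "0 \<in> skS" using emb_mem[of 0 0] by (simp add: emb_def A.skw_def B.skw_def)
  fix x y c assume x: "x \<in> skS"
  note xD = skS_D[OF x]
  show "c *\<^sub>T x \<in> skS"
    using emb_mem[OF A.subspace_scale[OF A.subspace_skw xD(1)] B.subspace_scale[OF B.subspace_skw xD(2)], of c c]
    by (simp add: emb_scale xD(3))
  assume y: "y \<in> skS"
  note yD = skS_D[OF y]
  show "x + y \<in> skS"
    using emb_mem[OF A.subspace_add[OF A.subspace_skw xD(1) yD(1)] B.subspace_add[OF B.subspace_skw xD(2) yD(2)]]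
    by (simp add: emb_add xD(3) yD(3))
qed

lemma mT_emb: "mT (emb s t) x = L1 s x + L2 t x" by (simp add: emb_def mT_add_left)

lemma nat_emb: "s \<in> A.skw \<Longrightarrow> t \<in> B.skw \<Longrightarrow> nat (emb s t) = emb s (- t)" by (simp add: nat_def)

lemma neg_skw [simp]: "t \<in> B.skw \<Longrightarrow> - t \<in> B.skw" by (simp add: B.skw_def)

lemma nat_mem [simp]: "x \<in> skS \<Longrightarrow> nat x \<in> skS" by (simp add: nat_def skS_D)
lemma nat_nat [simp]: "x \<in> skS \<Longrightarrow> nat (nat x) = x" by (simp add: nat_def skS_D)
lemma nat_add: "nat (x + y) = nat x + nat y" by (simp add: nat_def pr1_add pr2_add emb_add[symmetric])
lemma nat_scale: "nat (c *\<^sub>T x) = c *\<^sub>T nat x" by (simp add: nat_def flip: emb_scale)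

lemma fA_add_left: "fA (x + y) z = fA x z + fA y z" by (simp add: fA_def pr1_add pr2_add A.f_add_left B.f_add_left)
lemma fA_scale_left [simp]: "fA (c *\<^sub>T x) z = c * fA x z" by (simp add: fA_def algebra_simps)
lemma fA_sym: "fA x y = fA y x" by (simp add: fA_def A.f_sym[of "pr1 x" "pr1 y"] B.f_sym[of "pr2 x" "pr2 y"])
lemma fA_add_right: "fA z (x + y) = fA z x + fA z y" by (simp add: fA_def pr1_add pr2_add A.f_add_right B.f_add_right)
lemma fA_scale_right [simp]: "fA z (c *\<^sub>T x) = c * fA z x" by (simp add: fA_def algebra_simps)
lemma fA_minus [simp]: "fA (- x) z = - fA x z" "fA z (- x) = - fA z x"
  using fA_scale_left[of "-1"] fA_scale_right[of z "-1"] by simp_all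

lemma fA_diff_left: "fA (x - y) z = fA x z - fA y z" using fA_add_left[of x "- y" z] by simp

lemma fA_nat [simp]: "x \<in> skS \<Longrightarrow> y \<in> skS \<Longrightarrow> fA (nat x) (nat y) = fA x y"
  by (simp add: fA_def nat_def skS_D)
lemma skS_ext:
  assumes x: "x \<in> skS" and y: "y \<in> skS" and f: "\<And>t. t \<in> skS \<Longrightarrow> fA x t = fA y t"
  shows "x = y"
proof -
  note D = skS_D[OF x] skS_D[OF y]
  have z: "0 \<in> A.skw" "0 \<in> B.skw" by (simp_all add: A.skw_def B.skw_def)
  have "pr1 x = pr1 y"
  proof (rule A.skw_ext[OF D(1,4)])
    fix t assume "t \<in> A.skw"
    then show "A.f (pr1 x) t = A.f (pr1 y) t" using f[of "emb t 0"] z by (simp add: fA_def)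
  qed
  moreover have "pr2 x = pr2 y"
  proof (rule B.skw_ext[OF D(2,5)])
    fix t assume "t \<in> B.skw"
    then show "B.f (pr2 x) t = B.f (pr2 y) t" using f[of "emb 0 t"] z by (simp add: fA_def)
  qed
  ultimately show ?thesis using D by metis
qed

lemma L1_anticomm: "c \<in> A.skw \<Longrightarrow> c' \<in> A.skw \<Longrightarrow> L1 c (L1 c' x) = - (A.f c c' *\<^sub>T x) - L1 c' (L1 c x)"
  by (induction x rule: tensor_induct)
    (simp_all add: mT_tn mT_add_right A.skw_anticomm[of c c'] tn_diff_left T.scale_right_distrib)
lemma L2_anticomm: "c \<in> B.skw \<Longrightarrow> c' \<in> B.skw \<Longrightarrow> L2 c (L2 c' x) = - (B.f c c' *\<^sub>T x) - L2 c' (L2 c x)"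
  by (induction x rule: tensor_induct)
    (simp_all add: mT_tn mT_add_right B.skw_anticomm[of c c'] tn_diff_right T.scale_right_distrib)

text \<open>The Albert form is the quadratic form whose Clifford relation holds between the left
  multiplications with an element of the skew space and with its image under \<open>nat\<close>.\<close>

lemma clifford:
  assumes "s \<in> skS" "t \<in> skS"
  shows "mT s (mT (nat t) y) = - (fA s t *\<^sub>T y) - mT t (mT (nat s) y)"
proof -
  obtain s1 s2 t1 t2 where e: "s = emb s1 s2" "t = emb t1 t2" "s1 \<in> A.skw" "s2 \<in> B.skw" "t1 \<in> A.skw" "t2 \<in> B.skw"
    using assms by (auto simp: skS_def)
  then show ?thesis
    by (simp add: nat_emb mT_emb mT_add_right mT_diff_right L1_anticomm[of s1 t1] L2_anticomm[of s2 t2] L_commute fA_def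
        T.scale_left_diff_distrib)
qed

lemma clifford_sq:
  assumes "s \<in> skS"
  shows "mT s (mT (nat s) y) = - ((fA s s / 2) *\<^sub>T y)"
proof -
  have "mT s (mT (nat s) y) + mT s (mT (nat s) y) = - (fA s s *\<^sub>T y)"
    by (subst (1) clifford[OF assms assms]) (rule diff_add_cancel)
  then have "(1 / 2) *\<^sub>T (mT s (mT (nat s) y) + mT s (mT (nat s) y)) = (1 / 2) *\<^sub>T (- (fA s s *\<^sub>T y))" by simp
  moreover have "(1 / 2) *\<^sub>T (z + z) = z" for z
  proof -
    have "z + z = 2 *\<^sub>T z" by (metis one_add_one T.scale_left_distrib T.scale_one)
    then show ?thesis using A.two by simp
  qed
  ultimately show ?thesis by simp
qed

text \<open>The left side is the triple product symmetrized in its outer factors; the relation turns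
  it into a single skew element applied to y.\<close>

lemma clifford_triple:
  assumes "s \<in> skS" "t \<in> skS" "w \<in> skS"
  shows "mT s (mT (nat t) (mT w y)) + mT w (mT (nat t) (mT s y))
     = fA s w *\<^sub>T mT t y - fA s t *\<^sub>T mT w y - fA w t *\<^sub>T mT s y"
proof -
  have "mT (nat s) (mT w y) = - (fA s w *\<^sub>T y) - mT (nat w) (mT s y)"
    using clifford[of "nat s" "nat w" y] assms by simp
  then have "mT t (mT (nat s) (mT w y)) = - (fA s w *\<^sub>T mT t y) - mT t (mT (nat w) (mT s y))"
    by (simp add: mT_diff_right mT_scale_right)
  then show ?thesis using assms clifford[of s t "mT w y"] clifford[of w t "mT s y"] by (simp add: mT_scale_right)
qed

lemma g_minus_right [simp]: "g x (- y) = - g x y" using g_scale_right[of x "-1" y] by simp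
lemma g_diff_right: "g x (y - z) = g x y - g x z" using g_add_right[of x y "- z"] by simp

lemma g_skS: "s \<in> skS \<Longrightarrow> g (mT s x) y = - g x (mT s y)"
  by (auto simp: skS_def mT_emb g_add_left g_add_right g_L1 g_L2)

definition bt :: "'t \<Rightarrow> 't \<Rightarrow> 't" where "bt x y = emb (c1 x y) (c2 x y)"

lemma bt_mem [simp]: "bt x y \<in> skS" by (simp add: bt_def c1_skw c2_skw)

lemma fA_bt: "t \<in> skS \<Longrightarrow> fA (bt x y) t = g x (mT (nat t) y)"
proof -
  assume "t \<in> skS"
  then obtain t1 t2 where t: "t = emb t1 t2" "t1 \<in> A.skw" "t2 \<in> B.skw" by (auto simp: skS_def)
  then show ?thesis
    by (simp add: g_diff_right bt_def fA_def c1_skw c2_skw f_c1 f_c2 nat_emb mT_emb g_add_right)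
qed

lemma bt_bilinear: "bilinear_on sT sT sT UNIV UNIV skS bt"
  by (simp add: bilinear_on_def linear_on_def bt_def c1_skw c2_skw c1_add_left c1_add_right c2_add_left c2_add_right
      emb_add emb_scale)

lemma bt_alt: "bt x x = 0"
proof (rule skS_ext)
  show "(0::'t) \<in> skS" by (rule T.subspace_0[OF subspace_skS])
  fix t assume t: "t \<in> skS"
  have "g x (mT (nat t) x) = - g x (mT (nat t) x)" using g_skS[of "nat t" x x] t by (metis g_sym nat_mem)
  then have "g x (mT (nat t) x) = 0" using A.two by (simp add: eq_neg_iff_add_eq_0 flip: mult_2)
  then show "fA (bt x x) t = fA 0 t" using t fA_scale_left[of 0 0 t] by (simp add: fA_bt)
qed simp

text \<open>Paired with t, adjointness of \<open>bt\<close> and skewness of left multiplications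
  move everything onto y. There \<open>clifford_triple\<close> applies to the images of e, j and t
  under \<open>nat\<close>.\<close>

lemma bt_derivation:
  assumes e: "e \<in> skS" and j: "j \<in> skS"
  shows "bt (mT j (mT (nat e) x)) y + bt x (mT j (mT (nat e) y))
    = fA (bt x y) j *\<^sub>T e - fA e j *\<^sub>T bt x y - fA (bt x y) e *\<^sub>T j" (is "?l = ?r")
proof (rule skS_ext)
  note S = T.subspace_add[OF subspace_skS] T.subspace_diff[OF subspace_skS] T.subspace_scale[OF subspace_skS]
  show "?l \<in> skS" by (simp add: S)
  show "?r \<in> skS" using assms by (simp add: S)
  fix t assume t: "t \<in> skS"
  have "fA ?l t = g x (mT (nat e) (mT j (mT (nat t) y)) + mT (nat t) (mT j (mT (nat e) y)))"
    using e j t by (simp add: fA_add_left fA_bt g_skS g_add_right)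
  also have "mT (nat e) (mT j (mT (nat t) y)) + mT (nat t) (mT j (mT (nat e) y))
      = fA e t *\<^sub>T mT (nat j) y - fA e j *\<^sub>T mT (nat t) y - fA t j *\<^sub>T mT (nat e) y"
    using clifford_triple[of "nat e" "nat j" "nat t" y] e j t by simp
  also have "g x \<dots> = fA ?r t"
    using e j t
    by (simp add: fA_diff_left fA_bt g_diff_right fA_sym[of t j] mult.commute)
  finally show "fA ?l t = fA ?r t" .
qed

end

locale albert_setup = tensor_pair sc1 mu1 one1 N1 sc2 mu2 one2 N2 sT mT tn
  for sc1 :: "'k::field \<Rightarrow> 'a::ab_group_add \<Rightarrow> 'a" (infixr "*\<^sub>1" 75)
    and mu1 :: "'a \<Rightarrow> 'a \<Rightarrow> 'a" (infixl "\<cdot>\<^sub>1" 70) and one1 :: 'a and N1 :: "'a \<Rightarrow> 'k"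
    and sc2 :: "'k \<Rightarrow> 'b::ab_group_add \<Rightarrow> 'b" (infixr "*\<^sub>2" 75)
    and mu2 :: "'b \<Rightarrow> 'b \<Rightarrow> 'b" (infixl "\<cdot>\<^sub>2" 70) and one2 :: 'b and N2 :: "'b \<Rightarrow> 'k"
    and sT :: "'k \<Rightarrow> 't::ab_group_add \<Rightarrow> 't" (infixr "*\<^sub>T" 75)
    and mT :: "'t \<Rightarrow> 't \<Rightarrow> 't" and tn :: "'a \<Rightarrow> 'b \<Rightarrow> 't" (infixl "\<otimes>" 76) +
  fixes i1 :: 'a and i2 :: 'b and qA :: "'t \<Rightarrow> 'k" and u :: 't
  assumes i1: "i1 \<in> A.skw" "i1 \<noteq> 0" and i2: "i2 \<in> B.skw" "i2 \<noteq> 0" and N_i: "N2 i2 = N1 i1"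
    and qA: "\<And>s t. s \<in> A.skw \<Longrightarrow> t \<in> B.skw \<Longrightarrow> qA (emb s t) = N1 s - N2 t"
    and aniso: "\<And>s t. s \<in> A.skw \<Longrightarrow> t \<in> B.skw \<Longrightarrow> A.f s i1 = 0 \<Longrightarrow> B.f t i2 = 0 \<Longrightarrow> N1 s = N2 t \<Longrightarrow> s = 0"
    and u: "u \<in> skS" "A.f (pr1 u) i1 = 0" "B.f (pr2 u) i2 = 0" "u \<noteq> 0"
begin

definition a :: 'k where "a = - N1 i1"
definition n :: 'k where "n = qA u"
definition e0 :: 't where "e0 = emb i1 i2"
definition e1 :: 't where "e1 = (n / (4 * a)) *\<^sub>T emb i1 (- i2)"
text \<open>The inverse of \<open>e0 + e1\<close>: the Albert form takes the value -n there.\<close>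

definition r :: 't where "r = (1 / n) *\<^sub>T nat (e0 + e1)"
definition act :: "'t \<Rightarrow> 't \<Rightarrow> 't" where "act s x = mT s (mT r x)"
text \<open>The Albert form normalized to 1 at the unit \<open>e0 + e1\<close>; on V it equals
  -Q.\<close>

definition nq :: "'t \<Rightarrow> 'k" where "nq x = - (1 / n * qA x)"

lemma a_nz [simp]: "a \<noteq> 0" using i1 by (simp add: a_def)

lemma four: "(4::'k) \<noteq> 0" using A.two by (metis mult_eq_0_iff numeral_times_numeral semiring_norm(11,13))

lemma qA_fA: "x \<in> skS \<Longrightarrow> 2 * qA x = fA x x"
  using qA[of "pr1 x" "pr2 x"] by (simp add: skS_D fA_def A.f_self B.f_self right_diff_distrib)

lemma polar_qA: "x \<in> skS \<Longrightarrow> y \<in> skS \<Longrightarrow> polar qA x y = fA x y"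
proof -
  assume "x \<in> skS" "y \<in> skS"
  then have "2 * polar qA x y = 2 * fA x y"
    using qA_fA[of "x + y"] qA_fA[of x] qA_fA[of y] T.subspace_add[OF subspace_skS]
    by (simp add: polar_def right_diff_distrib fA_add_left fA_add_right fA_sym[of y x])
  then show ?thesis using A.two by simp
qed

lemma n_nz [simp]: "n \<noteq> 0"
proof
  assume "n = 0"
  note D = skS_D[OF u(1)]
  have "N1 (pr1 u) = N2 (pr2 u)" using qA[OF D(1,2)] \<open>n = 0\<close> by (simp add: D(3) n_def)
  then have "pr1 u = 0" using aniso[of "pr1 u" "pr2 u"] D u by simp
  moreover then have "pr2 u = 0" using \<open>N1 (pr1 u) = N2 (pr2 u)\<close> by simp
  ultimately show False using D(3) u(4) by (simp add: emb_def)
qed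

lemma e_mem [simp]: "e0 \<in> skS" "e1 \<in> skS" "e0 + e1 \<in> skS"
  using i1 i2 T.subspace_add[OF subspace_skS] T.subspace_scale[OF subspace_skS] by (simp_all add: e0_def e1_def)

lemma fA_e: "fA e0 e0 = 0" "fA e1 e1 = 0" "fA e0 e1 = - n" "fA e1 e0 = - n"
  using i1 i2 four by (simp_all add: e0_def e1_def fA_def A.f_self B.f_self N_i a_def)

lemma qA_scale: "x \<in> skS \<Longrightarrow> qA (c *\<^sub>T x) = c\<^sup>2 * qA x"
proof -
  assume x: "x \<in> skS"
  then have "2 * qA (c *\<^sub>T x) = 2 * (c\<^sup>2 * qA x)"
    using qA_fA[of "c *\<^sub>T x"] qA_fA[of x] T.subspace_scale[OF subspace_skS, of x c]
    by (simp add: power2_eq_square algebra_simps)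
  then show ?thesis using A.two by simp
qed

lemma polar_nq: "x \<in> skS \<Longrightarrow> y \<in> skS \<Longrightarrow> polar nq x y = - (1 / n * fA x y)"
  using polar_qA[of x y] by (simp add: polar_def nq_def algebra_simps diff_divide_distrib add_divide_distrib)

lemma qA_e: "qA e0 = 0" "qA e1 = 0"
  using qA_fA[of e0] qA_fA[of e1] A.two by (simp_all add: fA_e)

lemma act_unit: "act (e0 + e1) x = x"
  using clifford_sq[of "e0 + e1" x] A.two
  by (simp add: act_def r_def mT_scale_left mT_scale_right fA_add_left fA_add_right fA_e)

lemma act_sq:
  assumes s: "s \<in> skS"
  shows "act s (act s x) = polar nq s (e0 + e1) *\<^sub>T act s x - nq s *\<^sub>T x"
proof -
  let ?e = "e0 + e1"
  have q: "fA s s / 2 = qA s" using qA_fA[OF s, symmetric] A.two by simp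
  have 1: "mT s (mT (nat ?e) (mT s y)) = - (fA s ?e *\<^sub>T mT s y) + qA s *\<^sub>T mT ?e y" for y
  proof -
    have "mT (nat s) (mT s y) = - (qA s *\<^sub>T y)"
      using clifford_sq[of "nat s" y] s by (simp add: q)
    then show ?thesis using clifford[OF s e_mem(3), of "mT s y"] by (simp add: mT_scale_right)
  qed
  have "mT s (mT r y) = (1 / n) *\<^sub>T mT s (mT (nat ?e) y)" for y
    by (simp add: r_def mT_scale_left mT_scale_right)
  then have "act s (act s x) = (1 / n) *\<^sub>T mT s (mT (nat ?e) (mT s (mT r x)))" by (simp add: act_def)
  also have "\<dots> = - ((1 / n * fA s ?e) *\<^sub>T act s x) + (1 / n * qA s) *\<^sub>T x"
    unfolding 1 using act_unit[of x] by (simp add: act_def T.scale_right_distrib T.scale_right_diff_distrib)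
  finally show ?thesis using s by (simp add: polar_nq nq_def)
qed

lemma bt_der:
  assumes "j \<in> skS"
  shows "bt (act j x) y + bt x (act j y) = polar nq j (e0 + e1) *\<^sub>T bt x y
    + polar nq (bt x y) (e0 + e1) *\<^sub>T j - polar nq j (bt x y) *\<^sub>T (e0 + e1)"
proof -
  have sc: "bt (c *\<^sub>T x) y = c *\<^sub>T bt x y" "bt x (c *\<^sub>T y) = c *\<^sub>T bt x y" for c x y
    using bt_bilinear by (auto simp: bilinear_on_def linear_on_def)
  have "bt (act j x) y + bt x (act j y) = (1 / n) *\<^sub>T (bt (mT j (mT (nat (e0 + e1)) x)) y + bt x (mT j (mT (nat (e0 + e1)) y)))"
    by (simp add: act_def r_def mT_scale_left mT_scale_right sc T.scale_right_distrib)
  then show ?thesis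
    unfolding bt_derivation[OF e_mem(3) assms] using assms
    by (simp add: polar_nq fA_sym[of "e0 + e1" j] fA_sym[of j "bt x y"] T.scale_right_diff_distrib)
qed

sublocale J: jordan_spin sT skS nq e0 e1 act bt
proof
  show "(2::'k) \<noteq> 0" by (rule A.two)
  show "T.subspace skS" by (rule subspace_skS)
  show "quadratic_form_on sT skS nq"
    using T.subspace_add[OF subspace_skS] T.subspace_scale[OF subspace_skS]
    by (simp add: quadratic_form_on_def bilinear_on_def linear_on_def polar_nq fA_add_left fA_add_right nq_def qA_scale
        add_divide_distrib)
  show "bilinear_on sT sT sT skS UNIV UNIV act"
    by (simp add: bilinear_on_def linear_on_def act_def mT_add_left mT_add_right mT_scale_left mT_scale_right)
qed (simp_all add: polar_nq fA_e nq_def qA_e act_unit act_sq bt_bilinear bt_alt bt_der)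

end

section \<open>The cubic identity and its regularity\<close>

context albert_setup
begin

definition W1 :: "'a set" where "W1 = {s \<in> A.skw. A.f s i1 = 0}"
definition W2 :: "'b set" where "W2 = {t \<in> B.skw. B.f t i2 = 0}"

lemma W1D: "s \<in> W1 \<Longrightarrow> s \<in> A.skw" "s \<in> W1 \<Longrightarrow> A.f s i1 = 0" "s \<in> W1 \<Longrightarrow> A.f i1 s = 0"
  by (simp_all add: W1_def A.f_sym[of i1 s])
lemma W2D: "t \<in> W2 \<Longrightarrow> t \<in> B.skw" "t \<in> W2 \<Longrightarrow> B.f t i2 = 0" "t \<in> W2 \<Longrightarrow> B.f i2 t = 0"
  by (simp_all add: W2_def B.f_sym[of i2 t])

lemma W1_zero: "0 \<in> W1" and W2_zero: "0 \<in> W2" by (simp_all add: W1_def W2_def A.skw_def B.skw_def)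

lemma V_iff: "x \<in> J.V \<longleftrightarrow> x \<in> skS \<and> pr1 x \<in> W1 \<and> pr2 x \<in> W2"
proof (cases "x \<in> skS")
  case True
  note D = skS_D[OF True]
  let ?p = "A.f (pr1 x) i1" and ?q = "B.f (pr2 x) i2"
  have "polar nq x e0 = 0 \<longleftrightarrow> ?p = ?q"
    using True i1 i2 by (simp add: polar_nq) (simp add: e0_def fA_def)
  moreover have "polar nq x e1 = 0 \<longleftrightarrow> ?p = - ?q"
    using True i1 i2 four
    by (simp add: polar_nq) (simp add: e1_def fA_def eq_neg_iff_add_eq_0 flip: add_divide_distrib distrib_left)
  moreover have "?p = ?q \<and> ?p = - ?q \<longleftrightarrow> ?p = 0 \<and> ?q = 0"
    by (metis J.two_cancel minus_zero)
  ultimately show ?thesis using True D by (simp add: J.V_def W1_def W2_def del: J.VD)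
qed (simp add: J.V_def del: J.VD)

lemma emb_V: "s \<in> W1 \<Longrightarrow> t \<in> W2 \<Longrightarrow> emb s t \<in> J.V" by (simp add: V_iff W1D W2D)

lemma V_emb: "v \<in> J.V \<Longrightarrow> \<exists>s\<in>W1. \<exists>t\<in>W2. v = emb s t" using V_iff skS_D by metis

lemma qA_emb: "s \<in> W1 \<Longrightarrow> t \<in> W2 \<Longrightarrow> qA (emb s t) = N1 s - N2 t" by (simp add: qA W1D W2D)

lemma u_V: "u \<in> J.V" using u skS_D[OF u(1)] by (simp add: V_iff W1_def W2_def)

lemma nq_u: "nq u = -1" by (simp add: nq_def n_def[symmetric])

lemma nq_aniso: assumes v: "v \<in> J.V" and z: "nq v = 0" shows "v = 0"
proof -
  obtain s t where st: "s \<in> W1" "t \<in> W2" "v = emb s t" using V_emb v by blast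
  then have eq: "N1 s = N2 t" using z by (simp add: nq_def qA_emb)
  then have "s = 0" using aniso[of s t] st by (simp add: W1_def W2_def)
  moreover then have "t = 0" using eq by simp
  ultimately show ?thesis using st by (simp add: emb_def)
qed

text \<open>The factor between e1 and \<open>nat e0\<close>.\<close>

definition k :: 'k where "k = n / (4 * a)"

lemma mT_r: "mT r x = (1 / n) *\<^sub>T ((1 + k) *\<^sub>T L1 i1 x - (1 - k) *\<^sub>T L2 i2 x)"
proof -
  have "nat (e0 + e1) = (1 + k) *\<^sub>T (i1 \<otimes> one2) - (1 - k) *\<^sub>T (one1 \<otimes> i2)"
    unfolding e0_def e1_def k_def[symmetric] nat_add nat_scale
    using i1 i2 by (simp add: nat_emb) (simp add: emb_def T.scale_left_distrib T.scale_right_distrib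
        T.scale_left_diff_distrib algebra_simps)
  then show ?thesis
    by (simp add: r_def mT_scale_left mT_diff_left)
qed

lemma I1_sq: "L1 i1 (L1 i1 x) = a *\<^sub>T x" and I2_sq: "L2 i2 (L2 i2 x) = a *\<^sub>T x"
  using L1_sq[OF i1(1), of x] L2_sq[OF i2(1), of x] by (simp_all add: a_def N_i)

lemma two_k: "2 * k = n / (2 * a)"
  using A.two four by (simp add: k_def divide_simps)

text \<open>The left multiplications by i1 and i2 commute and both have square a. Hence e0 acts as
  the projection onto the space where they agree, which is \<open>X0\<close>; they are opposite on
  \<open>X1\<close>.\<close>

lemma act_e0: "act e0 x = (1 / 2) *\<^sub>T (x + (1 / a) *\<^sub>T L1 i1 (L2 i2 x))"
proof -
  have "mT e0 y = L1 i1 y + L2 i2 y" for y unfolding e0_def by (rule mT_emb)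
  then have "act e0 x = (1 / n) *\<^sub>T (((1 + k) * a) *\<^sub>T x - (1 - k) *\<^sub>T L1 i1 (L2 i2 x)
      + ((1 + k) *\<^sub>T L1 i1 (L2 i2 x) - ((1 - k) * a) *\<^sub>T x))"
    by (simp add: act_def mT_r mT_scale_right mT_diff_right mT_add_right I1_sq I2_sq L_commute algebra_simps)
  also have "((1 + k) * a) *\<^sub>T x - (1 - k) *\<^sub>T L1 i1 (L2 i2 x) + ((1 + k) *\<^sub>T L1 i1 (L2 i2 x) - ((1 - k) * a) *\<^sub>T x)
     = ((1 + k) * a - (1 - k) * a) *\<^sub>T x + ((1 + k) - (1 - k)) *\<^sub>T L1 i1 (L2 i2 x)"
    by (simp only: T.scale_left_diff_distrib) simp
  also have "(1 + k) * a - (1 - k) * a = n / 2"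
    using two_k by (simp flip: left_diff_distrib)
  also have "(1 + k) - (1 - k) = n / (2 * a)" using two_k by simp
  finally show ?thesis by (simp add: T.scale_right_distrib)
qed

lemma X0_iff: "x \<in> J.X0 \<longleftrightarrow> L2 i2 x = L1 i1 x"
proof
  assume "L2 i2 x = L1 i1 x"
  then show "x \<in> J.X0" using J.half_double[of x] by (simp add: J.X0_def act_e0 I1_sq)
next
  assume "x \<in> J.X0"
  then have "(1 / 2) *\<^sub>T (x + (1 / a) *\<^sub>T L1 i1 (L2 i2 x)) = (1 / 2) *\<^sub>T (x + x)"
    using J.half_double[of x] by (simp add: J.X0_def act_e0)
  then have "x = (1 / a) *\<^sub>T L1 i1 (L2 i2 x)" using A.two by simp
  then have "L1 i1 x = L1 i1 ((1 / a) *\<^sub>T L1 i1 (L2 i2 x))" by simp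
  then show "L2 i2 x = L1 i1 x" by (simp add: mT_scale_right I1_sq)
qed

lemma X1_iff: "x \<in> J.X1 \<longleftrightarrow> L2 i2 x = - L1 i1 x"
proof
  assume "L2 i2 x = - L1 i1 x"
  then show "x \<in> J.X1" by (simp add: J.X1_def act_e0 I1_sq)
next
  assume "x \<in> J.X1"
  then have "x + (1 / a) *\<^sub>T L1 i1 (L2 i2 x) = 0" using A.two by (simp add: J.X1_def act_e0)
  then have "x = - ((1 / a) *\<^sub>T L1 i1 (L2 i2 x))" by (simp add: eq_neg_iff_add_eq_0)
  then have "L1 i1 x = L1 i1 (- ((1 / a) *\<^sub>T L1 i1 (L2 i2 x)))" by simp
  then show "L2 i2 x = - L1 i1 x" by (simp add: mT_scale_right I1_sq)
qed

text \<open>On a Peirce component the two terms of \<open>mT_r\<close> are proportional, so r acts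
  as a multiple of the left multiplication by i1.\<close>

lemma act_X0: "x \<in> J.X0 \<Longrightarrow> act s x = (1 / (2 * a)) *\<^sub>T mT s (L1 i1 x)"
proof -
  assume "x \<in> J.X0"
  then have "mT r x = (1 / n * (1 + k - (1 - k))) *\<^sub>T L1 i1 x"
    by (simp add: mT_r X0_iff flip: T.scale_left_diff_distrib)
  moreover have "1 + k - (1 - k) = n / (2 * a)" using two_k by simp
  ultimately show ?thesis by (simp add: act_def mT_scale_right)
qed

lemma act_X1: "x \<in> J.X1 \<Longrightarrow> act s x = (2 / n) *\<^sub>T mT s (L1 i1 x)"
proof -
  assume "x \<in> J.X1"
  then have "mT r x = (1 / n * (1 + k + (1 - k))) *\<^sub>T L1 i1 x"
    by (simp add: mT_r X1_iff flip: T.scale_left_distrib)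
  then show ?thesis by (simp add: act_def mT_scale_right)
qed

lemma L1_W1: "s \<in> W1 \<Longrightarrow> L1 i1 (L1 s x) = - L1 s (L1 i1 x)"
  by (rule L1_orth) (simp_all add: i1 W1D)

lemma act_act_X0:
  assumes x: "x \<in> J.X0" and v: "v \<in> J.V" and s: "s \<in> W1" and t: "t \<in> W2"
  shows "act v (act (emb s t) x) = (- 1 / n) *\<^sub>T mT v (L1 s x - L2 t x)"
proof -
  have "act (emb s t) x \<in> J.X1" by (rule J.V_X0[OF emb_V[OF s t] x])
  then have "act v (act (emb s t) x) = (2 / n * (1 / (2 * a))) *\<^sub>T mT v (L1 i1 (mT (emb s t) (L1 i1 x)))"
    by (simp add: act_X1 act_X0[OF x] mT_scale_right)
  also have "L1 i1 (mT (emb s t) (L1 i1 x)) = (- a) *\<^sub>T (L1 s x - L2 t x)"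
    by (simp add: mT_emb mT_add_right L1_W1[OF s] I1_sq mT_scale_right T.scale_right_diff_distrib flip: L_commute)
  finally show ?thesis using A.two by (simp add: mT_scale_right)
qed

text \<open>The cubic identity says that the quadratic map \<open>v \<mapsto> v \<bullet> (\<beta>(v \<bullet> x, x) \<bullet> x)\<close> on \<open>V\<close> is a
  multiple of \<open>Q\<close>.\<close>

definition cub :: "'t \<Rightarrow> 't \<Rightarrow> 't" where "cub x v = act v (act (bt (act v x) x) x)"

lemma bt_act_V: "x \<in> J.X0 \<Longrightarrow> v \<in> J.V \<Longrightarrow> bt (act v x) x \<in> J.V"
  by (intro J.\<beta>_X1_X0 J.V_X0)

text \<open>Polarize at v and u. As u acts with square 1 and \<open>nq u = -1\<close>, the value at
  u identifies w, and the mixed term can be solved for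
  \<open>\<beta>(v \<bullet> x, x) \<bullet> x\<close>.\<close>

lemma cubic_if_multiple:
  assumes x: "x \<in> J.X0" and w: "\<And>v. v \<in> J.V \<Longrightarrow> cub x v = nq v *\<^sub>T w" and v: "v \<in> J.V"
  shows "act (bt (act v x) x) x = act v (act u (act (bt (act u x) x) x))"
proof -
  note S = J.VD(1)
  have vu: "v + u \<in> J.V" by (rule T.subspace_add[OF J.subspace_V v u_V])
  let ?b = "\<lambda>v. act (bt (act v x) x) x"
  have add: "?b (v + u) = ?b v + ?b u"
    using S[OF v] S[OF u_V] by (simp add: J.act_lin J.\<beta>_add_left)
  have "cub x (v + u) = cub x v + cub x u + (act v (?b u) + act u (?b v))"
    unfolding cub_def add using S[OF v] S[OF u_V] by (simp add: J.act_lin)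
  then have *: "act v (?b u) + act u (?b v) = polar nq v u *\<^sub>T w"
    using w[OF vu] w[OF v] w[OF u_V] by (simp add: polar_def T.scale_left_diff_distrib)
  have wu: "w = - act u (?b u)" using w[OF u_V] by (simp add: cub_def nq_u)
  have uu: "act u (act u y) = y" for y using J.act_V_sq[OF u_V] by (simp add: nq_u)
  have "act u (?b v) = polar nq v u *\<^sub>T w - act v (?b u)" using * by (simp add: eq_diff_eq add.commute)
  then have "?b v = act u (polar nq v u *\<^sub>T w - act v (?b u))" by (metis uu)
  also have "\<dots> = - (polar nq v u *\<^sub>T ?b u) - act u (act v (?b u))"
    using S[OF u_V] by (simp add: J.act_diff_right wu uu)
  also have "\<dots> = act v (act u (?b u))" using J.act_VV[OF u_V v, of "?b u"] by (simp add: J.b_sym[of u v])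
  finally show ?thesis .
qed

end

section \<open>The cubic identity\<close>

locale octonion_setup = albert_setup sc1 mu1 one1 N1 sc2 mu2 one2 N2 sT mT tn i1 i2 qA u
  for sc1 :: "'k::field \<Rightarrow> 'a::ab_group_add \<Rightarrow> 'a" (infixr "*\<^sub>1" 75)
    and mu1 :: "'a \<Rightarrow> 'a \<Rightarrow> 'a" (infixl "\<cdot>\<^sub>1" 70) and one1 :: 'a and N1 :: "'a \<Rightarrow> 'k"
    and sc2 :: "'k \<Rightarrow> 'b::ab_group_add \<Rightarrow> 'b" (infixr "*\<^sub>2" 75)
    and mu2 :: "'b \<Rightarrow> 'b \<Rightarrow> 'b" (infixl "\<cdot>\<^sub>2" 70) and one2 :: 'b and N2 :: "'b \<Rightarrow> 'k"
    and sT :: "'k \<Rightarrow> 't::ab_group_add \<Rightarrow> 't" (infixr "*\<^sub>T" 75)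
    and mT :: "'t \<Rightarrow> 't \<Rightarrow> 't" and tn :: "'a \<Rightarrow> 'b \<Rightarrow> 't" (infixl "\<otimes>" 76)
    and i1 :: 'a and i2 :: 'b and qA :: "'t \<Rightarrow> 'k" and u :: 't +
  assumes dim1: "A.dim UNIV = 8" and dim2: "B.dim UNIV = 2 \<or> B.dim UNIV = 4 \<or> B.dim UNIV = 8"
begin

lemma quaternion_pair_A: "s \<in> W1 \<Longrightarrow> s \<noteq> 0 \<Longrightarrow> quaternion_pair sc1 mu1 one1 N1 i1 s"
  by unfold_locales (simp_all add: i1 W1D)

lemma quaternion_pair_B: "t \<in> W2 \<Longrightarrow> t \<noteq> 0 \<Longrightarrow> quaternion_pair sc2 mu2 one2 N2 i2 t"
  by unfold_locales (simp_all add: i2 W2D)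

lemma one_i_orthogonal_A: "A.norm.orthogonal [one1, i1]"
  using A.two i1 by (simp add: A.norm.orthogonal_def A.f_self A.skw_def A.f_sym[of one1 i1])

lemma one_i_orthogonal_B: "B.norm.orthogonal [one2, i2]"
  using A.two i2 by (simp add: B.norm.orthogonal_def B.f_self B.skw_def B.f_sym[of one2 i2])

lemma W1_exists: "\<exists>s\<in>W1. s \<noteq> 0"
  using A.norm.orthogonal_extend[OF one_i_orthogonal_A] by (auto simp: dim1 W1_def A.skw_def)

lemma W1_exists_next:
  assumes "s \<in> W1" "s \<noteq> 0"
  shows "\<exists>l. l \<noteq> 0 \<and> A.f l one1 = 0 \<and> A.f l i1 = 0 \<and> A.f l s = 0 \<and> A.f l (i1 \<cdot>\<^sub>1 s) = 0"
proof -
  interpret Q: quaternion_pair sc1 mu1 one1 N1 i1 s by (rule quaternion_pair_A[OF assms])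
  show ?thesis
    using A.norm.orthogonal_extend[OF Q.block_orthogonal[OF A.one_neq_zero]] by (auto simp: dim1 Q.block_def)
qed

lemma W2_zero_if_dim_2: "B.dim UNIV = 2 \<Longrightarrow> t \<in> W2 \<Longrightarrow> t = 0"
  using B.skw_perp_zero_if_dim_2 i2 W2D by blast

lemma W2_exists:
  assumes "B.dim UNIV \<noteq> 2" shows "\<exists>t\<in>W2. t \<noteq> 0"
  using B.norm.orthogonal_extend[OF one_i_orthogonal_B] dim2 assms by (auto simp: W2_def B.skw_def)

lemma mixed:
  assumes x: "x \<in> J.X0" and s: "s \<in> W1" "s \<noteq> 0" and t: "t \<in> W2" "t \<noteq> 0"
  shows "act (emb s 0) (act (bt (act (emb 0 t) x) x) x) + act (emb 0 t) (act (bt (act (emb s 0) x) x) x) = 0"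
proof -
  have "B.dim UNIV \<noteq> 2" using W2_zero_if_dim_2 t by blast
  then interpret Q: linked_tensor sc1 mu1 one1 N1 sc2 mu2 one2 N2 sT mT tn i1 s i2 t
    using dim1 dim2 N_i
    by (intro linked_tensor.intro tensor_quaternion.intro quaternion_pair_A[OF s] quaternion_pair_B[OF t]
        tensor_pair_axioms tensor_quaternion_axioms.intro linked_tensor_axioms.intro) auto
  have V: "emb s 0 \<in> J.V" "emb 0 t \<in> J.V" using s t W1_zero W2_zero by (auto intro: emb_V)
  have c: "c1 (act v x) x \<in> W1" "c2 (act v x) x \<in> W2" "bt (act v x) x = emb (c1 (act v x) x) (c2 (act v x) x)"
    if "v \<in> J.V" for v
    using bt_act_V[OF x that] by (simp_all add: V_iff bt_def c1_skw c2_skw)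
  have as: "act (emb s 0) x = (1 / (2 * a)) *\<^sub>T L1 s (L1 i1 x)" "act (emb 0 t) x = (1 / (2 * a)) *\<^sub>T L2 t (L1 i1 x)"
    by (simp_all add: act_X0[OF x] mT_emb)
  have "act (emb s 0) (act (bt (act (emb 0 t) x) x) x) + act (emb 0 t) (act (bt (act (emb s 0) x) x) x)
     = (- 1 / n * (1 / (2 * a))) *\<^sub>T (L1 s (L1 (c1 (L2 t (L1 i1 x)) x) x - L2 (c2 (L2 t (L1 i1 x)) x) x)
       + L2 t (L1 (c1 (L1 s (L1 i1 x)) x) x - L2 (c2 (L1 s (L1 i1 x)) x) x))"
    unfolding c(3)[OF V(1)] c(3)[OF V(2)] act_act_X0[OF x V(1) c(1,2)[OF V(2)]] act_act_X0[OF x V(2) c(1,2)[OF V(1)]]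
    by (simp add: as mT_emb mT_scale_left mT_scale_right mT_diff_right T.scale_right_distrib T.scale_right_diff_distrib)
  also have "\<dots> = 0" unfolding Q.mixed_identity[OF x[unfolded X0_iff]] by simp
  finally show ?thesis .
qed

end

lemma (in bilinear_form_on) orthogonal_expand_list:
  assumes "orthogonal bs" "x \<in> span (set bs)"
  shows "x = (\<Sum>c\<leftarrow>bs. (B x c / B c c) *s c)"
  using orthogonal_expand[OF assms] by (simp add: sum_list_sum_nth atLeast0LessThan)

context tensor_pair
begin

lemma expand_left:
  assumes "A.norm.orthogonal bs" "A.span (set bs) = UNIV"
  shows "x = (\<Sum>b\<leftarrow>bs. (1 / A.f b b) *\<^sub>T (b \<otimes> ctr1 x b))"
proof (induction x rule: tensor_induct)
  case (pure p q)
  have *: "(\<Sum>b\<leftarrow>cs. c b *\<^sub>1 b) \<otimes> q = (\<Sum>b\<leftarrow>cs. c b *\<^sub>T (b \<otimes> q))" for c cs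
    by (induction cs) (simp_all add: tn_add_left)
  have "p \<otimes> q = (\<Sum>b\<leftarrow>bs. (A.f p b / A.f b b) *\<^sub>1 b) \<otimes> q"
    using A.norm.orthogonal_expand_list[OF assms(1), of p] assms(2) by simp
  also have "\<dots> = (\<Sum>b\<leftarrow>bs. (1 / A.f b b) *\<^sub>T (b \<otimes> ctr1 (p \<otimes> q) b))" by (simp add: *)
  finally show ?case .
next
  case (add x y)
  have *: "(\<Sum>b\<leftarrow>cs. F b) + (\<Sum>b\<leftarrow>cs. G b) = (\<Sum>b\<leftarrow>cs. F b + G b)" for F G :: "'a \<Rightarrow> 't" and cs
    by (induction cs) (simp_all add: algebra_simps)
  have "x + y = (\<Sum>b\<leftarrow>bs. (1 / A.f b b) *\<^sub>T (b \<otimes> ctr1 x b)) + (\<Sum>b\<leftarrow>bs. (1 / A.f b b) *\<^sub>T (b \<otimes> ctr1 y b))"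
    using add by (rule arg_cong2)
  also have "\<dots> = (\<Sum>b\<leftarrow>bs. (1 / A.f b b) *\<^sub>T (b \<otimes> ctr1 (x + y) b))"
    by (simp add: * ctr1_add tn_add_right T.scale_right_distrib)
  finally show ?case .
qed

lemma g_pure_right': "g x (p \<otimes> q) = B.f (ctr1 x p) q"
  by (induction x rule: tensor_induct) (simp_all add: g_add_left ctr1_add B.f_add_left)

lemma ctr1_L1: "c \<in> A.skw \<Longrightarrow> ctr1 (L1 c x) p = - ctr1 x (c \<cdot>\<^sub>1 p)"
  by (induction x rule: tensor_induct) (simp_all add: mT_tn mT_add_right ctr1_add A.skw_adj)

lemma ctr1_L2: "ctr1 (L2 d x) p = d \<cdot>\<^sub>2 ctr1 x p"
  by (induction x rule: tensor_induct) (simp_all add: mT_tn mT_add_right ctr1_add B.mult_add_right)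

end

context octonion_setup
begin

lemma nq_emb: "s \<in> W1 \<Longrightarrow> t \<in> W2 \<Longrightarrow> nq (emb s t) = - (1 / n * (N1 s - N2 t))"
  by (simp add: nq_def qA_emb)

lemma emb_split: "emb s t = emb s 0 + emb 0 t" using emb_add[of s 0 0 t] by simp

lemma emb_00: "emb 0 0 = 0" by (simp add: emb_def)

text \<open>Write b(v) for \<open>\<beta>(v \<bullet> x, x) \<bullet> x\<close>. The mixed identity
  is v b(w) = - w b(v); applying w and anticommuting it with v compares the two pure values.\<close>

lemma cub_proportional:
  assumes x: "x \<in> J.X0" and s: "s \<in> W1" and t: "t \<in> W2"
  shows "nq (emb 0 t) *\<^sub>T cub x (emb s 0) = nq (emb s 0) *\<^sub>T cub x (emb 0 t)"
    and "cub x (emb s t) = cub x (emb s 0) + cub x (emb 0 t)"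
proof -
  let ?v = "emb s 0" and ?w = "emb 0 t" and ?b = "\<lambda>v. act (bt (act v x) x) x"
  have V: "?v \<in> J.V" "?w \<in> J.V" using s t W1_zero W2_zero by (auto intro: emb_V)
  note S = J.VD(1)[OF V(1)] J.VD(1)[OF V(2)]
  have m: "act ?v (?b ?w) = - act ?w (?b ?v)"
  proof (cases "s = 0 \<or> t = 0")
    case True
    then show ?thesis using S by (auto simp: emb_00)
  next
    case False
    then show ?thesis using mixed[OF x s _ t] by (simp add: eq_neg_iff_add_eq_0)
  qed
  have "?b (?v + ?w) = ?b ?v + ?b ?w" using S by (simp add: J.act_lin J.\<beta>_add_left)
  then have "cub x (?v + ?w) = cub x ?v + cub x ?w + (act ?v (?b ?w) + act ?w (?b ?v))"
    unfolding cub_def using S by (simp add: J.act_lin)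
  then show "cub x (emb s t) = cub x ?v + cub x ?w" by (simp add: m flip: emb_split)
  have "polar nq ?v ?w = 0" using S s t W1_zero W2_zero W1D W2D
    by (simp add: polar_nq fA_def)
  then have anti: "act ?w (act ?v y) = - act ?v (act ?w y)" for y
    using J.act_VV[OF V(2,1), of y] by (simp add: J.b_sym[of ?w ?v])
  have "nq ?w *\<^sub>T ?b ?v = - act ?w (act ?w (?b ?v))" using J.act_V_sq[OF V(2)] by simp
  also have "act ?w (?b ?v) = - act ?v (?b ?w)" using m by simp
  also have "- act ?w (- act ?v (?b ?w)) = - act ?v (cub x ?w)" using S by (simp add: anti cub_def)
  finally have "act ?v (nq ?w *\<^sub>T ?b ?v) = act ?v (- act ?v (cub x ?w))" by simp
  then show "nq ?w *\<^sub>T cub x ?v = nq ?v *\<^sub>T cub x ?w"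
    using S J.act_V_sq[OF V(1)] by (simp add: cub_def)
qed

text \<open>Here V has only its first summand, and x in \<open>X0\<close> is determined by its
  coefficient p at 1: the one at i2 is i1 p / a. The value of \<open>\<beta>\<close> is a multiple
  of z, the product of s(i1 p) with the conjugate of p, and multiplying z by p or by i1 p cancels
  that conjugate.\<close>

lemma cub_dim_2:
  assumes dim: "B.dim UNIV = 2" and x: "x \<in> J.X0" and v: "v \<in> J.V"
  shows "cub x v = nq v *\<^sub>T ((- 2 / a * N1 ((1 / 2) *\<^sub>1 ctr2 x one2)) *\<^sub>T L1 i1 x)"
proof -
  define p where "p = (1 / 2) *\<^sub>1 ctr2 x one2"
  define q where "q = (1 / B.f i2 i2) *\<^sub>1 ctr2 x i2"
  obtain s t where st: "s \<in> W1" "t \<in> W2" "v = emb s t" using V_emb v by blast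
  have v0: "v = emb s 0" using W2_zero_if_dim_2[OF dim st(2)] st(3) by simp
  note sW = W1D[OF st(1)]
  have c20: "c2 (act v x) x = 0" "c1 (act v x) x \<in> W1"
    using bt_act_V[OF x v] W2_zero_if_dim_2[OF dim] by (simp_all add: V_iff bt_def c1_skw c2_skw)
  have fi: "B.f one2 i2 = 0" "B.f i2 one2 = 0" "B.f i2 i2 = - (2 * a)" "B.f i2 i2 \<noteq> 0"
    using i1 i2 A.two by (simp_all add: B.skw_def B.f_sym[of one2 i2] B.f_self N_i a_def)
  interpret sw: tensor_pair sc2 mu2 one2 N2 sc1 mu1 one1 N1 sT mT "\<lambda>q p. p \<otimes> q" by (rule tensor_pair_swap)
  have "B.span (set [one2, i2]) = UNIV" using B.norm.orthogonal_span_UNIV[OF one_i_orthogonal_B] dim by simp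
  from sw.expand_left[OF one_i_orthogonal_B this, of x]
  have xpq: "x = p \<otimes> one2 + q \<otimes> i2" by (simp add: swap_ctr1 p_def q_def)
  have "ctr2 (L2 i2 x) one2 = ctr2 (L1 i1 x) one2" using x by (simp add: X0_iff)
  moreover have "i2 \<cdot>\<^sub>2 i2 = a *\<^sub>2 one2" using B.skw_sq[OF i2(1), of one2] by (simp add: a_def N_i)
  ultimately have "(2 * a) *\<^sub>1 q = 2 *\<^sub>1 (i1 \<cdot>\<^sub>1 p)"
    by (simp add: xpq mT_tn mT_add_right ctr2_add fi mult.commute)
  then have "(1 / (2 * a)) *\<^sub>1 ((2 * a) *\<^sub>1 q) = (1 / (2 * a)) *\<^sub>1 (2 *\<^sub>1 (i1 \<cdot>\<^sub>1 p))" by simp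
  then have q: "q = (1 / a) *\<^sub>1 (i1 \<cdot>\<^sub>1 p)" using A.two by simp
  have ii: "i1 \<cdot>\<^sub>1 (i1 \<cdot>\<^sub>1 w) = a *\<^sub>1 w" for w using A.skw_sq[OF i1(1), of w] by (simp add: a_def)
  have isw: "i1 \<cdot>\<^sub>1 (s \<cdot>\<^sub>1 w) = - (s \<cdot>\<^sub>1 (i1 \<cdot>\<^sub>1 w))" for w by (rule A.skw_orth) (simp_all add: i1 sW)
  have y: "L1 s (L1 i1 x) = (s \<cdot>\<^sub>1 (i1 \<cdot>\<^sub>1 p)) \<otimes> one2 + (s \<cdot>\<^sub>1 p) \<otimes> i2"
    by (simp add: xpq q mT_tn mT_add_right ii mT_scale_right)
  define z where "z = (s \<cdot>\<^sub>1 (i1 \<cdot>\<^sub>1 p)) \<cdot>\<^sub>1 A.cj p"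
  have adj: "A.f (w \<cdot>\<^sub>1 A.cj w') t = A.f w (t \<cdot>\<^sub>1 w')" for w w' t by (simp add: A.f_adj_right[of w "A.cj w'"])
  have z1: "A.f z one1 = 0"
    using A.f_mult_right[of s p i1] A.skw_adj[OF i1(1), of "s \<cdot>\<^sub>1 p" p] sW isw[of p]
    by (simp add: z_def adj A.f_sym[of "i1 \<cdot>\<^sub>1 p"])
  then have zs: "z \<in> A.skw" by (simp add: A.skw_def)
  have im: "A.im ((s \<cdot>\<^sub>1 p) \<cdot>\<^sub>1 A.cj (i1 \<cdot>\<^sub>1 p)) = - z"
  proof (rule A.skw_ext[OF A.im_skw])
    show "- z \<in> A.skw" using zs by (simp add: A.skw_def)
    fix t assume t: "t \<in> A.skw"
    have "A.f ((s \<cdot>\<^sub>1 p) \<cdot>\<^sub>1 A.cj (i1 \<cdot>\<^sub>1 p)) t = A.f (s \<cdot>\<^sub>1 p) (- (A.f t i1 *\<^sub>1 p) - i1 \<cdot>\<^sub>1 (t \<cdot>\<^sub>1 p))"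
      unfolding adj A.skw_anticomm[OF t i1(1), of p] ..
    also have "\<dots> = A.f (i1 \<cdot>\<^sub>1 (s \<cdot>\<^sub>1 p)) (t \<cdot>\<^sub>1 p)"
      using A.f_skw_self[OF sW(1)] by (simp add: A.f_diff_right A.skw_adj[OF i1(1)])
    also have "\<dots> = A.f (- z) t" by (simp add: isw z_def adj)
    finally show "A.f (A.im ((s \<cdot>\<^sub>1 p) \<cdot>\<^sub>1 A.cj (i1 \<cdot>\<^sub>1 p))) t = A.f (- z) t" using t by (simp add: A.f_im)
  qed
  \<comment> \<open>The coefficient at 1 contributes 2z because f(1, 1) = 2, and the one at i2
    contributes another 2z because f(i2, i2) = -2a and the skew part is -z.\<close>
  have c: "c1 (L1 s (L1 i1 x)) x = 4 *\<^sub>1 z"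
    unfolding y using A.im_of_skw[OF zs]
    by (subst xpq) (simp add: q c1_add_left c1_add_right fi im flip: z_def A.scale_left_distrib)
  have "act v x = (1 / (2 * a)) *\<^sub>T L1 s (L1 i1 x)" by (simp add: act_X0[OF x] v0 mT_emb)
  then have c1v: "c1 (act v x) x = (2 / a) *\<^sub>1 z"
    using A.two four by (simp add: c) (simp add: divide_simps)
  \<comment> \<open>The value of \<open>bt\<close> lies in V, so z is orthogonal to i1 and
    anticommutes with it.\<close>
  have "A.f ((2 / a) *\<^sub>1 z) i1 = 0" using c20(2) by (simp only: c1v W1D)
  then have zi: "A.f z i1 = 0" using A.two by simp
  have zp: "z \<cdot>\<^sub>1 p = N1 p *\<^sub>1 (s \<cdot>\<^sub>1 (i1 \<cdot>\<^sub>1 p))" by (simp add: z_def A.cj_mult_cancel_right)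
  have "z \<cdot>\<^sub>1 (i1 \<cdot>\<^sub>1 p) = - (i1 \<cdot>\<^sub>1 (z \<cdot>\<^sub>1 p))" by (rule A.skw_orth[OF zs i1(1) zi])
  also have "\<dots> = N1 p *\<^sub>1 (a *\<^sub>1 (s \<cdot>\<^sub>1 p))" by (simp add: zp isw ii)
  finally have zip: "z \<cdot>\<^sub>1 (i1 \<cdot>\<^sub>1 p) = N1 p *\<^sub>1 (a *\<^sub>1 (s \<cdot>\<^sub>1 p))" .
  have zx: "L1 z x = N1 p *\<^sub>T L1 s (L1 i1 x)"
    unfolding y by (subst xpq) (simp add: q mT_tn mT_add_right mT_scale_right zp zip T.scale_right_distrib mult.commute)
  have bt: "bt (act v x) x = emb ((2 / a) *\<^sub>1 z) 0" by (simp add: bt_def c20(1) c1v)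
  have "cub x v = (- 1 / n) *\<^sub>T mT v (L1 ((2 / a) *\<^sub>1 z) x - L2 0 x)"
    unfolding cub_def bt by (rule act_act_X0[OF x v]) (use c20(2) c1v W2_zero in simp_all)
  also have "\<dots> = (2 / (n * a) * N1 p * N1 s) *\<^sub>T L1 i1 x"
    using L1_sq[OF sW(1)] by (simp add: v0 mT_emb mT_scale_left mT_scale_right zx mult.commute mult.left_commute)
  also have "\<dots> = nq v *\<^sub>T ((- 2 / a * N1 p) *\<^sub>T L1 i1 x)"
    using st(1) W2_zero by (simp add: v0 nq_emb mult.commute mult.left_commute)
  finally show ?thesis unfolding p_def .
qed

lemma cub_multiple:
  assumes x: "x \<in> J.X0"
  shows "\<exists>w. \<forall>v\<in>J.V. cub x v = nq v *\<^sub>T w"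
proof (cases "B.dim UNIV = 2")
  case True
  then show ?thesis using cub_dim_2[OF _ x] by blast
next
  case False
  obtain s0 t0 where s0: "s0 \<in> W1" "s0 \<noteq> 0" and t0: "t0 \<in> W2" "t0 \<noteq> 0"
    using W1_exists W2_exists[OF False] by blast
  \<comment> \<open>Comparison with the fixed t0 yields the factor on the first summand; s0 then
    carries it over to the second.\<close>
  define w where "w = (1 / nq (emb 0 t0)) *\<^sub>T cub x (emb 0 t0)"
  have nz: "nq (emb 0 t0) \<noteq> 0" "nq (emb s0 0) \<noteq> 0"
    using s0 t0 W1_zero W2_zero by (simp_all add: nq_emb)
  have 1: "cub x (emb s 0) = nq (emb s 0) *\<^sub>T w" if s: "s \<in> W1" for s
  proof -
    have "(1 / nq (emb 0 t0)) *\<^sub>T (nq (emb 0 t0) *\<^sub>T cub x (emb s 0)) = nq (emb s 0) *\<^sub>T w"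
      unfolding cub_proportional(1)[OF x s t0(1)] by (simp add: w_def mult.commute)
    then show ?thesis using nz by simp
  qed
  have 2: "cub x (emb 0 t) = nq (emb 0 t) *\<^sub>T w" if t: "t \<in> W2" for t
  proof -
    have "nq (emb s0 0) *\<^sub>T cub x (emb 0 t) = nq (emb s0 0) *\<^sub>T (nq (emb 0 t) *\<^sub>T w)"
      unfolding cub_proportional(1)[OF x s0(1) t, symmetric] 1[OF s0(1)] by (simp add: mult.commute)
    then show ?thesis by (rule T.scale_left_imp_eq[OF nz(2)])
  qed
  have "cub x v = nq v *\<^sub>T w" if "v \<in> J.V" for v
  proof -
    obtain s t where st: "s \<in> W1" "t \<in> W2" "v = emb s t" using V_emb \<open>v \<in> J.V\<close> by blast
    have "nq v = nq (emb s 0) + nq (emb 0 t)" using st W1_zero W2_zero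
      by (simp add: nq_emb diff_divide_distrib)
    then show ?thesis using cub_proportional(2)[OF x st(1,2)] 1 2 st by (simp add: T.scale_left_distrib)
  qed
  then show ?thesis by blast
qed

lemma cubic:
  assumes "x \<in> J.X0" "v \<in> J.V"
  shows "act (bt (act v x) x) x = act v (act u (act (bt (act u x) x) x))"
  using cub_multiple[OF assms(1)] cubic_if_multiple[OF assms(1) _ assms(2)] by blast

end

section \<open>Regularity\<close>

lemma two_equations_three_unknowns:
  fixes a1 a2 a3 b1 b2 b3 :: "'k::field"
  shows "\<exists>x y z. (x \<noteq> 0 \<or> y \<noteq> 0 \<or> z \<noteq> 0) \<and> x * a1 + y * a2 + z * a3 = 0 \<and> x * b1 + y * b2 + z * b3 = 0"
proof (cases "a2 * b3 - a3 * b2 = 0 \<and> a3 * b1 - a1 * b3 = 0 \<and> a1 * b2 - a2 * b1 = 0")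
  case False
  \<comment> \<open>The cross product of the two coefficient rows.\<close>
  then show ?thesis
    by (intro exI[of _ "a2 * b3 - a3 * b2"] exI[of _ "a3 * b1 - a1 * b3"] exI[of _ "a1 * b2 - a2 * b1"])
      (simp add: algebra_simps)
next
  case dep: True
  have one_eq: "\<exists>x y z. (x \<noteq> 0 \<or> y \<noteq> 0 \<or> z \<noteq> 0) \<and> x * c1 + y * c2 + z * c3 = 0" for c1 c2 c3 :: 'k
  proof (cases "c1 = 0")
    case True
    then show ?thesis by (intro exI[of _ 1] exI[of _ 0]) simp
  next
    case False
    then show ?thesis by (intro exI[of _ "- c2"] exI[of _ c1] exI[of _ 0]) simp
  qed
  show ?thesis
  proof (cases "a1 = 0 \<and> a2 = 0 \<and> a3 = 0")
    case True
    then show ?thesis using one_eq[of b1 b2 b3] by auto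
  next
    case False
    obtain x y z where x: "x \<noteq> 0 \<or> y \<noteq> 0 \<or> z \<noteq> 0" "x * a1 + y * a2 + z * a3 = 0" using one_eq by blast
    have d: "a2 * b3 = a3 * b2" "a3 * b1 = a1 * b3" "a1 * b2 = a2 * b1" using dep by simp_all
    have "a1 * (x * b1 + y * b2 + z * b3) = b1 * (x * a1 + y * a2 + z * a3)"
      "a2 * (x * b1 + y * b2 + z * b3) = b2 * (x * a1 + y * a2 + z * a3)"
      "a3 * (x * b1 + y * b2 + z * b3) = b3 * (x * a1 + y * a2 + z * a3)"
      using d by algebra+
    then have "x * b1 + y * b2 + z * b3 = 0" using False x(2) by auto
    then show ?thesis using x by blast
  qed
qed

context octonion_setup
begin

text \<open>Read as a linear map between the algebras, x in \<open>X0\<close> is semilinear: i1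
  becomes -i2. Half of the basis thus determines all norms of contractions.\<close>

lemma ctr1_i: "x \<in> J.X0 \<Longrightarrow> ctr1 x (i1 \<cdot>\<^sub>1 p) = - (i2 \<cdot>\<^sub>2 ctr1 x p)"
  using ctr1_L1[OF i1(1), of x p] by (simp add: X0_iff flip: ctr1_L2)

lemma N_ctr1_i: "x \<in> J.X0 \<Longrightarrow> N2 (ctr1 x (i1 \<cdot>\<^sub>1 p)) = N1 i1 * N2 (ctr1 x p)"
  by (simp add: ctr1_i N_i)

lemma W1_full_orthogonal:
  assumes "s \<in> W1" "s \<noteq> 0" "l \<noteq> 0" "A.f l one1 = 0" "A.f l i1 = 0" "A.f l s = 0" "A.f l (i1 \<cdot>\<^sub>1 s) = 0"
  shows "A.norm.orthogonal [one1, s, i1, i1 \<cdot>\<^sub>1 s, l, s \<cdot>\<^sub>1 l, i1 \<cdot>\<^sub>1 l, i1 \<cdot>\<^sub>1 (s \<cdot>\<^sub>1 l)]"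
    and "A.span (set [one1, s, i1, i1 \<cdot>\<^sub>1 s, l, s \<cdot>\<^sub>1 l, i1 \<cdot>\<^sub>1 l, i1 \<cdot>\<^sub>1 (s \<cdot>\<^sub>1 l)]) = UNIV"
proof -
  interpret Q: quaternion_pair sc1 mu1 one1 N1 i1 s by (rule quaternion_pair_A[OF assms(1,2)])
  show o: "A.norm.orthogonal [one1, s, i1, i1 \<cdot>\<^sub>1 s, l, s \<cdot>\<^sub>1 l, i1 \<cdot>\<^sub>1 l, i1 \<cdot>\<^sub>1 (s \<cdot>\<^sub>1 l)]"
    using Q.two_blocks_orthogonal[of one1 l] assms by (simp add: Q.block_def)
  show "A.span (set [one1, s, i1, i1 \<cdot>\<^sub>1 s, l, s \<cdot>\<^sub>1 l, i1 \<cdot>\<^sub>1 l, i1 \<cdot>\<^sub>1 (s \<cdot>\<^sub>1 l)]) = UNIV"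
    by (rule A.norm.orthogonal_span_UNIV[OF o]) (simp_all add: dim1)
qed

text \<open>Pairing the vanishing element with t = i1 s gives g(x, D x) = 0 for the product D of the
  left multiplications by i1, s and t. On the block of 1 it is the scalar -N(i1) N(s), on the block
  of l the opposite one; expanding x in the orthogonal basis equates the sums of ratios over the two
  blocks.\<close>

lemma norm_ratio_relation:
  assumes x: "x \<in> J.X0" and s: "s \<in> W1" "s \<noteq> 0"
    and l: "l \<noteq> 0" "A.f l one1 = 0" "A.f l i1 = 0" "A.f l s = 0" "A.f l (i1 \<cdot>\<^sub>1 s) = 0"
    and zero: "c1 (L1 s (L1 i1 x)) x = 0"
  defines "\<rho> \<equiv> \<lambda>p. N2 (ctr1 x p) / N1 p"
  shows "\<rho> one1 + \<rho> s = \<rho> l + \<rho> (s \<cdot>\<^sub>1 l)"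
proof -
  interpret Q: quaternion_pair sc1 mu1 one1 N1 i1 s by (rule quaternion_pair_A[OF s])
  define t where "t = i1 \<cdot>\<^sub>1 s"
  have t: "t \<in> A.skw" using W1D[OF s(1)] A.f_sym[of s i1] Q.f_i[of s one1] by (simp add: t_def A.skw_def)
  have ti: "A.f t i1 = 0" using W1D[OF s(1)] A.f_mult_left[of i1 s one1] by (simp add: t_def A.skw_def)
  have ts: "A.f t s = 0" by (simp add: t_def)
  have l_skw: "l \<in> A.skw" using l by (simp add: A.skw_def)
  define d where "d w = i1 \<cdot>\<^sub>1 (s \<cdot>\<^sub>1 (t \<cdot>\<^sub>1 w))" for w
  have di: "d (i1 \<cdot>\<^sub>1 w) = i1 \<cdot>\<^sub>1 d w" and ds: "d (s \<cdot>\<^sub>1 w) = s \<cdot>\<^sub>1 d w" for w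
    using A.skw_orth[OF t i1(1) ti, of w] A.skw_orth[OF t W1D(1)[OF s(1)] ts, of w] by (simp_all add: d_def Q.s_i)
  have t1: "t \<cdot>\<^sub>1 one1 = i1 \<cdot>\<^sub>1 (s \<cdot>\<^sub>1 one1)" by (simp add: t_def)
  have d1: "d one1 = (- (N1 i1 * N1 s)) *\<^sub>1 one1"
    using Q.sis[of one1] Q.ii[of one1] by (simp only: d_def t1) (simp add: mult.commute)
  \<comment> \<open>Three anticommutations give tl = -i1(sl), whereas t1 = i1(s1). This sign is the
    failure of associativity.\<close>
  have "t \<cdot>\<^sub>1 (l \<cdot>\<^sub>1 one1) = - (l \<cdot>\<^sub>1 (i1 \<cdot>\<^sub>1 (s \<cdot>\<^sub>1 one1)))"
    unfolding t1[symmetric] by (rule A.skw_orth[OF t l_skw]) (use l(5) in \<open>simp add: t_def A.f_sym[of l]\<close>)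
  also have "l \<cdot>\<^sub>1 (i1 \<cdot>\<^sub>1 (s \<cdot>\<^sub>1 one1)) = - (i1 \<cdot>\<^sub>1 (l \<cdot>\<^sub>1 (s \<cdot>\<^sub>1 one1)))"
    by (rule A.skw_orth[OF l_skw i1(1) l(3)])
  also have "l \<cdot>\<^sub>1 (s \<cdot>\<^sub>1 one1) = - (s \<cdot>\<^sub>1 (l \<cdot>\<^sub>1 one1))"
    by (rule A.skw_orth[OF l_skw W1D(1)[OF s(1)] l(4)])
  finally have "t \<cdot>\<^sub>1 l = - (i1 \<cdot>\<^sub>1 (s \<cdot>\<^sub>1 l))" by simp
  then have dl: "d l = (N1 i1 * N1 s) *\<^sub>1 l" by (simp add: d_def mult.commute)
  let ?bs = "[one1, s, i1, i1 \<cdot>\<^sub>1 s, l, s \<cdot>\<^sub>1 l, i1 \<cdot>\<^sub>1 l, i1 \<cdot>\<^sub>1 (s \<cdot>\<^sub>1 l)]"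
  let ?D = "\<lambda>w. L1 i1 (L1 s (L1 t w))"
  have "A.f (c1 (L1 s (L1 i1 x)) x) t = g x (?D x)"
    using t i1 W1D(1)[OF s(1)] by (simp add: f_c1 g_L1)
  then have gD: "g x (?D x) = 0" by (simp add: zero)
  have Dsum: "?D (\<Sum>b\<leftarrow>cs. (1 / A.f b b) *\<^sub>T (b \<otimes> \<psi> b)) = (\<Sum>b\<leftarrow>cs. (1 / A.f b b) *\<^sub>T (d b \<otimes> \<psi> b))" for cs \<psi>
    by (induction cs) (simp_all add: mT_add_right mT_scale_right mT_tn d_def)
  have "?D x = (\<Sum>b\<leftarrow>?bs. (1 / A.f b b) *\<^sub>T (d b \<otimes> ctr1 x b))"
    using arg_cong[OF expand_left[OF W1_full_orthogonal[OF s l], of x], of ?D] unfolding Dsum .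
  then have sum: "g x (\<Sum>b\<leftarrow>?bs. (1 / A.f b b) *\<^sub>T (d b \<otimes> ctr1 x b)) = 0"
    using gD by simp
  have ds1: "d s = s \<cdot>\<^sub>1 d one1" "d i1 = i1 \<cdot>\<^sub>1 d one1" using ds[of one1] di[of one1] by simp_all
  \<comment> \<open>The basis vectors b and i1 b have equal ratios, whence the factor 2.\<close>
  have val: "g x (\<Sum>b\<leftarrow>?bs. (1 / A.f b b) *\<^sub>T (d b \<otimes> ctr1 x b))
    = N1 i1 * N1 s * (2 * (\<rho> l + \<rho> (s \<cdot>\<^sub>1 l) - (\<rho> one1 + \<rho> s)))"
    using i1 s l A.two N_ctr1_i[OF x, of one1] N_ctr1_i[OF x, of s] N_ctr1_i[OF x, of l] N_ctr1_i[OF x, of "s \<cdot>\<^sub>1 l"]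
    by (simp add: di ds ds1 d1 dl g_add_right g_diff_right g_pure_right' A.f_self B.f_self \<rho>_def mult.assoc)
      (simp add: field_simps)
  have "\<rho> l + \<rho> (s \<cdot>\<^sub>1 l) - (\<rho> one1 + \<rho> s) = 0"
    using trans[OF val[symmetric] sum] i1 s A.two unfolding mult_eq_0_iff by simp
  then show ?thesis by simp
qed

text \<open>Up to sign and scalars, s, l and sl are permuted by taking products, so
  \<open>norm_ratio_relation\<close> holds with each of them in the distinguished place.\<close>

lemma norm_ratio_constant:
  assumes x: "x \<in> J.X0" and s: "s \<in> W1" "s \<noteq> 0"
    and zero: "\<And>s. s \<in> W1 \<Longrightarrow> c1 (L1 s (L1 i1 x)) x = 0"
  shows "N2 (ctr1 x s) = N1 s * N2 (ctr1 x one1)"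
proof -
  interpret Q: quaternion_pair sc1 mu1 one1 N1 i1 s by (rule quaternion_pair_A[OF s])
  obtain l where l: "l \<noteq> 0" "A.f l one1 = 0" "A.f l i1 = 0" "A.f l s = 0" "A.f l (i1 \<cdot>\<^sub>1 s) = 0"
    using W1_exists_next[OF s] by blast
  note sW = W1D[OF s(1)]
  have lW: "l \<in> W1" and lS: "l \<in> A.skw" using l by (simp_all add: W1_def A.skw_def)
  have ls: "l \<cdot>\<^sub>1 s = - (s \<cdot>\<^sub>1 l)" using A.skw_orth[OF lS sW(1) l(4), of one1] by simp
  let ?r = "\<lambda>p. N2 (ctr1 x p) / N1 p"
  have m: "ctr1 x (- p) = - ctr1 x p" for p using ctr1_scale_right[of x "-1" p] by simp
  have s1: "A.f s one1 = 0" using sW by (simp add: A.skw_def)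
  have 1: "?r one1 + ?r s = ?r l + ?r (s \<cdot>\<^sub>1 l)"
    by (rule norm_ratio_relation[OF x s l zero[OF s(1)]])
  have 2: "?r one1 + ?r l = ?r s + ?r (s \<cdot>\<^sub>1 l)"
  proof -
    have "A.f s (i1 \<cdot>\<^sub>1 l) = 0" using l(5) Q.f_flip(1)[of s l] by simp
    then have "?r one1 + ?r l = ?r s + ?r (l \<cdot>\<^sub>1 s)"
      using norm_ratio_relation[OF x lW l(1) s(2) s1 sW(2) _ _ zero[OF lW]] l(4) by (simp add: A.f_sym[of s l])
    then show ?thesis by (simp add: ls m)
  qed
  let ?m = "s \<cdot>\<^sub>1 l"
  have f1: "A.f ?m one1 = 0" using l(4) A.skw_adj[OF sW(1), of l one1] by simp
  have f2: "A.f ?m i1 = 0" using l(5) A.skw_adj[OF sW(1), of l i1] Q.s_i[of one1] by simp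
  have mW: "?m \<in> W1" using f1 f2 by (simp add: W1_def A.skw_def)
  have f3: "A.f s ?m = 0" using A.f_mult_left[of s one1 l] l(2) by (simp add: A.f_sym[of one1 l])
  have f4: "A.f s (i1 \<cdot>\<^sub>1 ?m) = 0"
  proof -
    have "A.f s (i1 \<cdot>\<^sub>1 (s \<cdot>\<^sub>1 l)) = - A.f (s \<cdot>\<^sub>1 one1) (s \<cdot>\<^sub>1 (i1 \<cdot>\<^sub>1 l))" by (simp add: Q.s_i)
    also have "\<dots> = - (N1 s * A.f one1 (i1 \<cdot>\<^sub>1 l))" by (simp only: A.f_mult_left)
    also have "A.f one1 (i1 \<cdot>\<^sub>1 l) = - A.f i1 l" using Q.f_i[of one1 l] by simp
    finally show ?thesis using l(3) by (simp add: A.f_sym[of i1 l])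
  qed
  have ms: "?m \<cdot>\<^sub>1 s = N1 s *\<^sub>1 l"
  proof -
    have "?m \<cdot>\<^sub>1 (s \<cdot>\<^sub>1 one1) = - (s \<cdot>\<^sub>1 (?m \<cdot>\<^sub>1 one1))"
      by (rule A.skw_orth) (use mW sW f3 in \<open>simp_all add: W1_def A.f_sym[of "s \<cdot>\<^sub>1 l" s]\<close>)
    then show ?thesis by simp
  qed
  have 3: "?r one1 + ?r ?m = ?r s + ?r l"
  proof -
    have "?r one1 + ?r ?m = ?r s + ?r (?m \<cdot>\<^sub>1 s)"
      by (rule norm_ratio_relation[OF x mW _ s(2) s1 sW(2) f3 f4 zero[OF mW]]) (use s l in simp)
    moreover have "?r (c *\<^sub>1 p) = ?r p" if "c \<noteq> 0" for c p using that by simp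
    ultimately show ?thesis using s by (simp add: ms)
  qed
  \<comment> \<open>In the sum of the second and third relations the ratios of l and sl
    cancel.\<close>
  have "2 * (?r one1 - ?r s) = (?r one1 + ?r s - (?r l + ?r ?m)) - (?r one1 + ?r s - (?r l + ?r ?m))
    + (?r one1 + ?r ?m - (?r s + ?r l)) + (?r one1 + ?r l - (?r s + ?r ?m))" by (simp add: algebra_simps)
  also have "\<dots> = 0" unfolding 2 3 by simp
  finally have "?r one1 - ?r s = 0" using A.two unfolding mult_eq_0_iff by blast
  then show ?thesis using s by (simp add: field_simps)
qed

text \<open>Contraction with 1 or with an element of \<open>W1\<close> scales the norm by a common
  factor. If the factor is 0, all contractions vanish and x = 0. Otherwise the quotient of a
  suitable contraction by that of 1 is an element of \<open>W2\<close> with the norm of some w in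
  \<open>W1\<close>.\<close>

lemma regular:
  assumes x: "x \<in> J.X0" and z: "bt (act u x) x = 0"
  shows "x = 0"
proof (rule ccontr)
  assume nz: "x \<noteq> 0"
  have b0: "bt (act v x) x = 0" if v: "v \<in> J.V" for v
  proof -
    let ?b = "bt (act v x) x"
    have bV: "?b \<in> J.V" by (rule bt_act_V[OF x v])
    \<comment> \<open>The cubic identity kills \<open>?b \<bullet> x\<close>; acting with
      \<open>?b\<close> once more gives its norm times x.\<close>
    have "act ?b x = 0" using cubic[OF x v] J.VD(1)[OF v] J.VD(1)[OF u_V] by (simp add: z)
    then have "nq ?b *\<^sub>T x = 0" using J.act_V_sq[OF bV, of x] J.VD(1)[OF bV] by simp
    then show ?thesis using nz nq_aniso[OF bV] by simp
  qed
  have zero: "c1 (L1 s (L1 i1 x)) x = 0" if s: "s \<in> W1" for s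
  proof -
    have "(1 / (2 * a)) *\<^sub>T bt (L1 s (L1 i1 x)) x = 0"
      using b0[OF emb_V[OF s W2_zero]] by (simp add: act_X0[OF x] mT_emb)
    then have "bt (L1 s (L1 i1 x)) x = 0" using A.two by simp
    then have "pr1 (bt (L1 s (L1 i1 x)) x) = 0" using pr1_scale[of 0 0] by simp
    then show ?thesis by (simp add: bt_def c1_skw c2_skw)
  qed
  note ratio = norm_ratio_constant[OF x _ _ zero]
  obtain s where s: "s \<in> W1" "s \<noteq> 0" using W1_exists by blast
  interpret Q: quaternion_pair sc1 mu1 one1 N1 i1 s by (rule quaternion_pair_A[OF s])
  obtain l where l: "l \<noteq> 0" "A.f l one1 = 0" "A.f l i1 = 0" "A.f l s = 0" "A.f l (i1 \<cdot>\<^sub>1 s) = 0"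
    using W1_exists_next[OF s] by blast
  let ?m = "s \<cdot>\<^sub>1 l"
  let ?bs = "[one1, s, i1, i1 \<cdot>\<^sub>1 s, l, ?m, i1 \<cdot>\<^sub>1 l, i1 \<cdot>\<^sub>1 ?m]"
  note full = W1_full_orthogonal[OF s l]
  have orth: "A.f s l = 0" "A.f s ?m = 0" "A.f l ?m = 0" "A.f ?m one1 = 0" "A.f i1 ?m = 0"
    using full(1) A.f_sym[of ?m one1] by (simp_all add: A.norm.orthogonal_def)
  have W: "l \<in> W1" "?m \<in> W1" using l orth by (simp_all add: W1_def A.skw_def A.f_sym[of "s \<cdot>\<^sub>1 l" i1])
  let ?c = "N2 (ctr1 x one1)"
  show False
  proof (cases "?c = 0")
    case True
    have "N2 (ctr1 x s) = 0" "N2 (ctr1 x l) = 0" "N2 (ctr1 x ?m) = 0"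
      using ratio[OF s] ratio[OF W(1) l(1)] ratio[OF W(2)] s l True by simp_all
    then have "N2 (ctr1 x b) = 0" if "b \<in> set ?bs" for b
      using that True N_ctr1_i[OF x, of one1] N_ctr1_i[OF x, of s] N_ctr1_i[OF x, of l] N_ctr1_i[OF x, of ?m] by auto
    then have *: "ctr1 x b = 0" if "b \<in> set ?bs" for b using that B.N_eq_0_iff by blast
    have "(\<Sum>b\<leftarrow>cs. (1 / A.f b b) *\<^sub>T (b \<otimes> ctr1 x b)) = 0" if "set cs \<subseteq> set ?bs" for cs
      using that by (induction cs) (use * in \<open>simp_all\<close>)
    from this[OF subset_refl] show False using expand_left[OF full, of x] nz by simp
  next
    case False
    let ?y = "ctr1 x one1"
    \<comment> \<open>In the span of s, l, sl two linear conditions leave a nonzero w whose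
      contraction is orthogonal to y and i2 y; this makes the quotient by y orthogonal to 1 and
      i2.\<close>
    obtain p q r' where pqr: "p \<noteq> 0 \<or> q \<noteq> 0 \<or> r' \<noteq> 0"
      "p * B.f (ctr1 x s) ?y + q * B.f (ctr1 x l) ?y + r' * B.f (ctr1 x ?m) ?y = 0"
      "p * B.f (ctr1 x s) (i2 \<cdot>\<^sub>2 ?y) + q * B.f (ctr1 x l) (i2 \<cdot>\<^sub>2 ?y) + r' * B.f (ctr1 x ?m) (i2 \<cdot>\<^sub>2 ?y) = 0"
      using two_equations_three_unknowns by blast
    define w where "w = p *\<^sub>1 s + q *\<^sub>1 l + r' *\<^sub>1 ?m"
    define z where "z = (1 / ?c) *\<^sub>2 (ctr1 x w \<cdot>\<^sub>2 B.cj ?y)"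
    have "A.f w s = p * A.f s s" "A.f w l = q * A.f l l" "A.f w ?m = r' * A.f ?m ?m"
      using orth by (simp_all add: w_def A.bilin A.f_sym[of l s] A.f_sym[of "s \<cdot>\<^sub>1 l" s] A.f_sym[of "s \<cdot>\<^sub>1 l" l])
    then have wnz: "w \<noteq> 0" using pqr(1) s l A.two by (auto simp: A.f_self)
    have wW: "w \<in> W1" using s W by (simp add: w_def W1_def A.skw_def A.bilin)
    have cw: "ctr1 x w = p *\<^sub>2 ctr1 x s + q *\<^sub>2 ctr1 x l + r' *\<^sub>2 ctr1 x ?m"
      by (simp add: w_def ctr1_add_right)
    have adj: "B.f (b \<cdot>\<^sub>2 B.cj b') t = B.f b (t \<cdot>\<^sub>2 b')" for b b' t by (simp add: B.f_adj_right[of b "B.cj b'"])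
    have "B.f (ctr1 x w) ?y = 0" "B.f (ctr1 x w) (i2 \<cdot>\<^sub>2 ?y) = 0"
      using pqr(2,3) by (simp_all add: cw B.f_add_left)
    then have "B.f z one2 = 0" "B.f z i2 = 0" by (simp_all add: z_def adj)
    then have "z \<in> B.skw" "B.f z i2 = 0" by (simp_all add: B.skw_def)
    moreover have "N2 z = N1 w" using False ratio[OF wW wnz] by (simp add: z_def power2_eq_square)
    ultimately show False using aniso[of w z] wW wnz by (simp add: W1_def)
  qed
qed

end

section \<open>Diagonalizations and multiples of norm forms from orthogonal bases\<close>

context bilinear_form_on
begin

lemma orthogonal_coordinates:
  assumes o: "orthogonal bs" and L: "L = span (set bs)" and q: "\<And>x. x \<in> L \<Longrightarrow> 2 * q x = B x x"
    and two: "(2::'k) \<noteq> 0"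
  defines "\<phi> \<equiv> \<lambda>i x. B x (bs ! i) / B (bs ! i) (bs ! i)"
  shows "i < length bs \<Longrightarrow> linear_on scale (*) L UNIV (\<phi> i)"
    and "\<exists>!x. x \<in> L \<and> (\<forall>i<length bs. \<phi> i x = y i)"
    and "x \<in> L \<Longrightarrow> q x = (\<Sum>i<length bs. q (bs ! i) * (\<phi> i x)\<^sup>2)"
proof -
  have m: "bs ! i \<in> L" "B (bs ! i) (bs ! i) \<noteq> 0" if "i < length bs" for i
    using o that by (auto simp: orthogonal_def)
  show "linear_on scale (*) L UNIV (\<phi> i)" if "i < length bs"
    using m[OF that] by (simp add: linear_on_def \<phi>_def B_add B_scale add_divide_distrib)
  have ex: "x = (\<Sum>i<length bs. \<phi> i x *s bs ! i)" if "x \<in> L" for x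
    using orthogonal_expand[OF o] that by (simp add: \<phi>_def L)
  define x0 where "x0 = (\<Sum>i<length bs. y i *s bs ! i)"
  have "x0 \<in> L" unfolding x0_def using m by (intro subspace_sum[OF sub] subspace_scale[OF sub]) auto
  moreover have "\<phi> i x0 = y i" if "i < length bs" for i
    using orthogonal_sum[OF o that, of y] m[OF that] by (simp add: \<phi>_def x0_def)
  moreover have "x = x0" if "x \<in> L" "\<forall>i<length bs. \<phi> i x = y i" for x
    using ex[OF that(1)] that(2) by (simp add: x0_def)
  ultimately show "\<exists>!x. x \<in> L \<and> (\<forall>i<length bs. \<phi> i x = y i)" by blast
  show "q x = (\<Sum>i<length bs. q (bs ! i) * (\<phi> i x)\<^sup>2)" if x: "x \<in> L"
  proof -
    have "B x x = B (\<Sum>i<length bs. \<phi> i x *s bs ! i) x" using ex[OF x] by simp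
    also have "\<dots> = (\<Sum>i<length bs. \<phi> i x * B (bs ! i) x)" using m x by (intro B_sum) auto
    also have "\<dots> = (\<Sum>i<length bs. 2 * (q (bs ! i) * (\<phi> i x)\<^sup>2))"
    proof (intro sum.cong refl)
      fix i assume "i \<in> {..<length bs}"
      then have i: "i < length bs" by simp
      have "\<phi> i x * B (bs ! i) x = (\<phi> i x)\<^sup>2 * B (bs ! i) (bs ! i)"
        using m[OF i] B_sym[OF m(1)[OF i] x] by (simp add: \<phi>_def power2_eq_square)
      then show "\<phi> i x * B (bs ! i) x = 2 * (q (bs ! i) * (\<phi> i x)\<^sup>2)"
        using q[OF m(1)[OF i]] by (simp add: mult.commute mult.left_commute)
    qed
    also have "\<dots> = 2 * (\<Sum>i<length bs. q (bs ! i) * (\<phi> i x)\<^sup>2)" by (simp add: sum_distrib_left)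
    finally show ?thesis using q[OF x] two by simp
  qed
qed

lemma isometric_to_diagonal_orthogonal:
  assumes "orthogonal bs" "L = span (set bs)" "\<And>x. x \<in> L \<Longrightarrow> 2 * q x = B x x" "(2::'k) \<noteq> 0"
    and "ds = map q bs"
  shows "isometric_to_diagonal scale L q ds"
  unfolding isometric_to_diagonal_def isometric_to_multiple_def
  using orthogonal_coordinates[OF assms(1-4)] assms(5)
  by (intro exI[of _ "\<lambda>i x. B x (bs ! i) / B (bs ! i) (bs ! i)"]) simp

lemma sum_split_double: "(\<Sum>i<n + n. F i) = (\<Sum>i<n. F i + (F (n + i) :: 'k))" for n :: nat
proof -
  have "(\<Sum>i<n + n. F i) = (\<Sum>i<n. F i) + (\<Sum>i\<in>{n..<n + n}. F i)"
    by (subst sum.union_disjoint[symmetric]) (auto intro!: sum.cong)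
  also have "(\<Sum>i\<in>{n..<n + n}. F i) = (\<Sum>i<n. F (n + i))"
    using sum.shift_bounds_nat_ivl[of F 0 n n] by (simp add: atLeast0LessThan add.commute)
  finally show ?thesis by (simp add: sum.distrib)
qed

text \<open>A pair v, w of basis vectors with q(w) = -a q(v) contributes q(v) (x^2 - a y^2), a
  multiple of the norm of k(sqrt a).\<close>

lemma isometric_to_norm_multiple_orthogonal:
  assumes o: "orthogonal (vs @ ws)" and L: "L = span (set (vs @ ws))"
    and q: "\<And>x. x \<in> L \<Longrightarrow> 2 * q x = B x x" and two: "(2::'k) \<noteq> 0"
    and len: "length ws = length vs" and ws: "\<And>i. i < length vs \<Longrightarrow> q (ws ! i) = - a * q (vs ! i)"
    and ds: "ds = map q vs"
  shows "isometric_to_multiple scale L q (\<lambda>c (x, y). (c * x, c * y)) (\<lambda>(x, y). x\<^sup>2 - a * y\<^sup>2) ds"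
proof -
  let ?n = "length vs" and ?bs = "vs @ ws"
  define \<phi> where "\<phi> = (\<lambda>i x. B x (?bs ! i) / B (?bs ! i) (?bs ! i))"
  have c: "j < length ?bs \<Longrightarrow> linear_on scale (*) L UNIV (\<phi> j)"
    "\<exists>!x. x \<in> L \<and> (\<forall>i<length ?bs. \<phi> i x = y i)"
    "x \<in> L \<Longrightarrow> q x = (\<Sum>i<length ?bs. q (?bs ! i) * (\<phi> i x)\<^sup>2)" for j x y
    unfolding \<phi>_def by (rule orthogonal_coordinates[OF o L q two]; assumption)+
  have lin: "linear_on scale (\<lambda>c (x, y). (c * x, c * y)) L UNIV (\<lambda>x. (\<phi> i x, \<phi> (?n + i) x))" if "i < ?n" for i
    using c(1)[of i] c(1)[of "?n + i"] that len by (simp add: linear_on_def)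
  have ex1: "\<exists>!x. x \<in> L \<and> (\<forall>i<?n. (\<phi> i x, \<phi> (?n + i) x) = y i)" for y
  proof -
    have "(\<forall>i<length ?bs. \<phi> i x = (if i < ?n then fst (y i) else snd (y (i - ?n)))) \<longleftrightarrow>
        (\<forall>i<?n. (\<phi> i x, \<phi> (?n + i) x) = y i)" for x
    proof safe
      fix i assume "\<forall>i<length ?bs. \<phi> i x = (if i < ?n then fst (y i) else snd (y (i - ?n)))" "i < ?n"
      then have "\<phi> i x = fst (y i)" "\<phi> (?n + i) x = snd (y i)" using len by auto
      then show "(\<phi> i x, \<phi> (?n + i) x) = y i" by simp
    next
      fix i assume *: "\<forall>i<?n. (\<phi> i x, \<phi> (?n + i) x) = y i" and i: "i < length ?bs"
      show "\<phi> i x = (if i < ?n then fst (y i) else snd (y (i - ?n)))"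
      proof (cases "i < ?n")
        case True
        then show ?thesis using *[rule_format, OF True, symmetric] by simp
      next
        case False
        then have "i - ?n < ?n" using i len by simp
        from *[rule_format, OF this, symmetric] False show ?thesis by simp
      qed
    qed
    then show ?thesis using c(2)[of "\<lambda>i. if i < ?n then fst (y i) else snd (y (i - ?n))"] by simp
  qed
  have val: "q x = (\<Sum>i<?n. q (vs ! i) * ((\<phi> i x)\<^sup>2 - a * (\<phi> (?n + i) x)\<^sup>2))" if x: "x \<in> L" for x
  proof -
    have "q x = (\<Sum>i<?n + ?n. q (?bs ! i) * (\<phi> i x)\<^sup>2)" using c(3)[OF x] len by simp
    also have "\<dots> = (\<Sum>i<?n. q (vs ! i) * (\<phi> i x)\<^sup>2 + q (ws ! i) * (\<phi> (?n + i) x)\<^sup>2)"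
      unfolding sum_split_double by (intro sum.cong refl) (simp add: nth_append)
    also have "\<dots> = (\<Sum>i<?n. q (vs ! i) * ((\<phi> i x)\<^sup>2 - a * (\<phi> (?n + i) x)\<^sup>2))"
      by (intro sum.cong refl) (simp add: ws algebra_simps)
    finally show ?thesis .
  qed
  show ?thesis
    unfolding isometric_to_multiple_def using lin ex1 val ds
    by (intro exI[of _ "\<lambda>i x. (\<phi> i x, \<phi> (?n + i) x)"]) simp
qed

lemma orthogonal_product:
  assumes "distinct xs" "distinct ys" "\<And>x y. x \<in> set xs \<Longrightarrow> y \<in> set ys \<Longrightarrow> F x y \<in> L"
    and "\<And>x y x' y'. x \<in> set xs \<Longrightarrow> y \<in> set ys \<Longrightarrow> x' \<in> set xs \<Longrightarrow> y' \<in> set ys \<Longrightarrow>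
      (B (F x y) (F x' y') = 0) \<longleftrightarrow> (x, y) \<noteq> (x', y')"
  shows "orthogonal (map (\<lambda>(x, y). F x y) (List.product xs ys))"
proof -
  have pw: "sorted_wrt P zs" if "distinct zs" "\<And>x y. x \<in> set zs \<Longrightarrow> y \<in> set zs \<Longrightarrow> x \<noteq> y \<Longrightarrow> P x y"
    for P :: "'c \<times> 'd \<Rightarrow> 'c \<times> 'd \<Rightarrow> bool" and zs
    using that by (induction zs) auto
  have "sorted_wrt (\<lambda>p p'. B (case p of (x, y) \<Rightarrow> F x y) (case p' of (x, y) \<Rightarrow> F x y) = 0) (List.product xs ys)"
    by (rule pw) (use assms in \<open>auto simp: distinct_product\<close>)
  then show ?thesis using assms(3,4) by (auto simp: orthogonal_def sorted_wrt_map)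
qed

end

section \<open>Quadratic extensions\<close>

definition adjoin_sqrt :: "'k::field \<Rightarrow> ('k, 'k \<times> 'k) nonassoc_algebra" where
  "adjoin_sqrt a = \<lparr>scal = (\<lambda>c (x, y). (c * x, c * y)),
     mul = (\<lambda>(x, y) (z, w). (x * z + a * (y * w), x * w + y * z)), unt = (1, 0)\<rparr>"

lemma adjoin_sqrt_simps:
  "scal (adjoin_sqrt a) c (x, y) = (c * x, c * y)" "unt (adjoin_sqrt a) = (1, 0)"
  "mul (adjoin_sqrt a) (x, y) (z, w) = (x * z + a * (y * w), x * w + y * z)"
  by (simp_all add: adjoin_sqrt_def)

lemma norm_adjoin_sqrt_nonzero:
  fixes a :: "'k::field"
  assumes a: "\<And>c. a \<noteq> c\<^sup>2" and z: "x\<^sup>2 - a * y\<^sup>2 = 0"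
  shows "x = 0 \<and> y = 0"
proof (cases "y = 0")
  case False
  then have "a = (x / y)\<^sup>2" using z by (simp add: power_divide)
  with a show ?thesis by blast
qed (use z in simp)

lemma vector_space_adjoin_sqrt: "vector_space (scal (adjoin_sqrt a))"
  by unfold_locales (auto simp: adjoin_sqrt_def algebra_simps)

lemma dim_adjoin_sqrt: "algebra_dim (adjoin_sqrt a) = 2"
proof -
  interpret vector_space "scal (adjoin_sqrt a)" by (rule vector_space_adjoin_sqrt)
  have ne: "(1, 0) \<noteq> ((0, 1) :: 'a \<times> 'a)" by simp
  have "(0, 1) \<notin> span {(1::'a, 0::'a)}" by (auto simp: span_singleton adjoin_sqrt_simps)
  moreover have "(1, 0) \<notin> span {}" for z by (simp add: zero_prod_def)
  ultimately have ind: "independent {(0, 1), (1::'a, 0::'a)}"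
    by (auto simp: independent_insert independent_empty)
  have "UNIV \<subseteq> span {(0, 1), (1::'a, 0::'a)}"
  proof
    fix z :: "'a \<times> 'a"
    obtain x y where z: "z = scal (adjoin_sqrt a) x (1, 0) + scal (adjoin_sqrt a) y (0, 1)"
      by (cases z) (simp add: adjoin_sqrt_simps)
    show "z \<in> span {(0, 1), (1, 0)}" unfolding z by (intro span_add span_scale span_base) simp_all
  qed
  then show ?thesis using dim_unique[OF _ _ ind, of UNIV 2] by simp
qed

lemma separable_adjoin_sqrt:
  fixes a :: "'k::field"
  assumes a: "\<And>c. a \<noteq> c\<^sup>2" and two: "(2::'k) \<noteq> 0"
  shows "separable_quadratic_extension (adjoin_sqrt a)"
proof -
  have a0: "a \<noteq> 0" using a[of 0] by simp
  have "\<exists>w. mul (adjoin_sqrt a) z w = unt (adjoin_sqrt a)" if "z \<noteq> 0" for z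
  proof -
    obtain x y where z: "z = (x, y)" by (cases z)
    have n: "x\<^sup>2 - a * y\<^sup>2 \<noteq> 0" using norm_adjoin_sqrt_nonzero[OF a] that z by (auto simp: zero_prod_def)
    have "x * (x / (x\<^sup>2 - a * y\<^sup>2)) + a * (y * (- y / (x\<^sup>2 - a * y\<^sup>2))) = (x\<^sup>2 - a * y\<^sup>2) / (x\<^sup>2 - a * y\<^sup>2)"
      by (simp add: power2_eq_square flip: diff_divide_distrib)
    also have "\<dots> = 1" using n by simp
    finally show ?thesis
      by (intro exI[of _ "(x / (x\<^sup>2 - a * y\<^sup>2), - y / (x\<^sup>2 - a * y\<^sup>2))"]) (simp add: z adjoin_sqrt_simps)
  qed
  then have field: "field_extension (adjoin_sqrt a)"
    using vector_space_adjoin_sqrt[of a]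
    by (auto simp: field_extension_def unital_algebra_def bilinear_on_def linear_on_def adjoin_sqrt_simps
        algebra_simps zero_prod_def)
  have "\<exists>p. coprime p (pderiv p) \<and> poly_at (adjoin_sqrt a) p z = 0" for z
  proof -
    obtain x y where z: "z = (x, y)" by (cases z)
    show ?thesis
    proof (cases "y = 0")
      case True
      have "coprime [:- x, 1:] [:1:]" by (simp flip: one_pCons)
      then show ?thesis using True
        by (intro exI[of _ "[:- x, 1:]"]) (simp add: pderiv_pCons poly_at_def z adjoin_sqrt_simps zero_prod_def)
    next
      case False
      \<comment> \<open>The minimal polynomial of x + y sqrt a.\<close>
      let ?p = "[:x\<^sup>2 - a * y\<^sup>2, - 2 * x, 1:]"
      have d: "pderiv ?p = [:- 2 * x, 2:]" by (simp add: pderiv_pCons)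
      \<comment> \<open>A Bezout relation: the polynomial minus (X - x)/2 times its derivative is
        the unit -a y^2.\<close>
      have e: "[:- a * y\<^sup>2:] = ?p - pderiv ?p * [:- x / 2, 1 / 2:]"
        unfolding d using two by (simp add: power2_eq_square algebra_simps)
      have "is_unit c" if "c dvd ?p" "c dvd pderiv ?p" for c
      proof -
        have "c dvd [:- a * y\<^sup>2:]" unfolding e by (intro dvd_diff dvd_mult2 that)
        moreover have "is_unit [:- a * y\<^sup>2:]" using False a0 
          by (intro dvdI[of _ _ "[:1 / (- a * y\<^sup>2):]"]) (simp add: one_pCons)
        ultimately show ?thesis by (rule dvd_trans)
      qed
      then have "coprime ?p (pderiv ?p)" by (rule coprimeI)
      moreover have "poly_at (adjoin_sqrt a) ?p z = 0"
        by (simp add: poly_at_def z adjoin_sqrt_simps zero_prod_def power2_eq_square algebra_simps)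
      ultimately show ?thesis by blast
    qed
  qed
  with field show ?thesis by (simp add: separable_quadratic_extension_def dim_adjoin_sqrt)
qed

lemma norm_adjoin_sqrt:
  fixes a :: "'k::field"
  assumes two: "(2::'k) \<noteq> 0"
  shows "quadratic_extension_norm (adjoin_sqrt a) (\<lambda>(x, y). x\<^sup>2 - a * y\<^sup>2)"
  unfolding quadratic_extension_norm_def
proof (intro exI[of _ "\<lambda>(x, y). (x, - y)"] conjI)
  show "bij (\<lambda>(x, y). (x, - y) :: 'k \<times> 'k)"
    by (rule o_bij[of "\<lambda>(x, y). (x, - y)"]) (auto simp: fun_eq_iff)
  have "(1::'k) \<noteq> - 1" using two by (metis one_add_one add.right_inverse)
  then show "(\<lambda>(x, y). (x, - y)) \<noteq> (id :: 'k \<times> 'k \<Rightarrow> _)"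
    by (metis (mono_tags, lifting) case_prod_conv id_apply prod.inject)
qed (auto simp: linear_on_def adjoin_sqrt_simps power2_eq_square algebra_simps)

section \<open>The dimension of the module and the type of the form\<close>

context bilinear_form_on
begin

lemma orthogonal_reorder:
  assumes o: "orthogonal bs" and s: "set cs = set bs" "length cs = length bs"
  shows "orthogonal cs"
proof -
  have "card (set cs) = length cs" using s distinct_card[OF orthogonal_distinct[OF o]] by simp
  then have d: "distinct cs" by (rule card_distinct)
  have "B x y = 0" if xy: "x \<in> set bs" "y \<in> set bs" "x \<noteq> y" for x y
  proof -
    obtain i j where "i < length bs" "j < length bs" "x = bs ! i" "y = bs ! j"
      using xy by (auto simp: in_set_conv_nth)
    then show ?thesis using orthogonal_nth[OF o] xy(3) by metis
  qed
  then have "sorted_wrt (\<lambda>x y. B x y = 0) cs"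
    using d s(1) unfolding sorted_wrt_iff_nth_less
    by (metis nth_eq_iff_index_eq nth_mem less_irrefl order_less_trans)
  then show ?thesis using o s(1) by (simp add: orthogonal_def)
qed

end

context octonion_setup
begin

sublocale gg: bilinear_form_on sT UNIV g
  by unfold_locales (simp_all add: g_add_left, rule g_sym)

abbreviation E where "E z \<equiv> mT e0 z"

lemma E_def: "E z = L1 i1 z + L2 i2 z" unfolding e0_def by (rule mT_emb)

lemma X0_eq_range: "J.X0 = range E"
proof
  show "range E \<subseteq> J.X0"
    by (auto simp: X0_iff E_def mT_add_right I1_sq I2_sq L_commute)
  show "J.X0 \<subseteq> range E"
  proof
    fix x assume x: "x \<in> J.X0"
    have "E (L1 i1 x) = a *\<^sub>T x + a *\<^sub>T x" using x by (simp add: E_def I1_sq L_commute X0_iff)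
    then have "(1 / (2 * a)) *\<^sub>T E (L1 i1 x) = x"
      using A.two by (simp flip: T.scale_left_distrib)
    then have "x = E ((1 / (2 * a)) *\<^sub>T L1 i1 x)" by (simp add: mT_scale_right)
    then show "x \<in> range E" by blast
  qed
qed

text \<open>\<open>X0\<close> is the image of E, left multiplication by e0. The vectors E(b
  \<otimes> c) with b in a basis of the first algebra and c in half a basis of the second form an
  orthogonal basis: E is skew, and the part i1 i2 of its square drops out because the c are
  orthogonal to the i2 c'.\<close>

lemma dim_X0:
  assumes cs: "B.norm.orthogonal (cs @ map (\<lambda>c. i2 \<cdot>\<^sub>2 c) cs)" "B.span (set (cs @ map (\<lambda>c. i2 \<cdot>\<^sub>2 c) cs)) = UNIV"
  shows "T.dim J.X0 = 8 * length cs"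
proof -
  obtain s where s: "s \<in> W1" "s \<noteq> 0" using W1_exists by blast
  obtain l where l: "l \<noteq> 0" "A.f l one1 = 0" "A.f l i1 = 0" "A.f l s = 0" "A.f l (i1 \<cdot>\<^sub>1 s) = 0"
    using W1_exists_next[OF s] by blast
  define bs where "bs = [one1, s, i1, i1 \<cdot>\<^sub>1 s, l, s \<cdot>\<^sub>1 l, i1 \<cdot>\<^sub>1 l, i1 \<cdot>\<^sub>1 (s \<cdot>\<^sub>1 l)]"
  have bs: "A.norm.orthogonal bs" "A.span (set bs) = UNIV" "length bs = 8"
    using W1_full_orthogonal[OF s l] by (simp_all add: bs_def)
  have csi: "B.f c (i2 \<cdot>\<^sub>2 c') = 0" if "c \<in> set cs" "c' \<in> set cs" for c c'
    using cs(1) that by (auto simp: B.norm.orthogonal_def sorted_wrt_append)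
  have cs': "B.norm.orthogonal cs" using cs(1) by (auto simp: B.norm.orthogonal_def sorted_wrt_append)
  let ?F = "\<lambda>b c. E (b \<otimes> c)"
  define ws where "ws = map (\<lambda>(b, c). ?F b c) (List.product bs cs)"
  have pair_A: "A.f b b' = 0 \<longleftrightarrow> b \<noteq> b'" if "b \<in> set bs" "b' \<in> set bs" for b b'
    using that bs(1) A.norm.orthogonal_nth[OF bs(1)] by (metis A.norm.orthogonal_def in_set_conv_nth)
  have pair_B: "B.f c c' = 0 \<longleftrightarrow> c \<noteq> c'" if "c \<in> set cs" "c' \<in> set cs" for c c'
    using that cs' B.norm.orthogonal_nth[OF cs'] by (metis B.norm.orthogonal_def in_set_conv_nth)
  have EE: "E (E z) = (2 * a) *\<^sub>T z + 2 *\<^sub>T L1 i1 (L2 i2 z)" for z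
  proof -
    have d: "x + x = 2 *\<^sub>T x" for x using T.scale_left_distrib[of 1 1 x] by simp
    have "E (E z) = (a *\<^sub>T z + a *\<^sub>T z) + (L1 i1 (L2 i2 z) + L1 i1 (L2 i2 z))"
      by (simp add: E_def mT_add_right I1_sq I2_sq L_commute algebra_simps)
    then show ?thesis by (simp only: d T.scale_scale)
  qed
  have val: "g (?F b c) (?F b' c') = - (2 * a * (A.f b b' * B.f c c'))"
    if "c \<in> set cs" "c' \<in> set cs" for b c b' c'
    using csi[OF that] by (simp add: g_skS EE g_add_right mT_tn)
  have o: "gg.orthogonal ws"
    unfolding ws_def
    by (rule gg.orthogonal_product)
      (use bs cs' A.norm.orthogonal_distinct B.norm.orthogonal_distinct pair_A pair_B A.two in \<open>auto simp: val\<close>)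
  have "T.span (set ws) = range E"
  proof (rule subset_antisym)
    show "T.span (set ws) \<subseteq> range E"
      unfolding X0_eq_range[symmetric]
      by (rule T.span_minimal) (auto simp: ws_def X0_eq_range J.subspace_X0[unfolded X0_eq_range])
    have Eadd: "E (z + z') = E z + E z'" "E (c *\<^sub>T z) = c *\<^sub>T E z" "E 0 = 0" for z z' c
      by (simp_all add: mT_add_right mT_scale_right)
    have 1: "E (p \<otimes> c) \<in> T.span (set ws)" if c: "c \<in> set cs" for p c
    proof -
      have "p \<in> A.span (set bs)" using bs by simp
      then show ?thesis
      proof (rule A.span_induct)
        show "A.subspace {p. E (p \<otimes> c) \<in> T.span (set ws)}"
          by (auto simp: A.subspace_def tn_add_left Eadd T.span_zero intro: T.span_add T.span_scale)
        fix b assume "b \<in> set bs"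
        then show "E (b \<otimes> c) \<in> T.span (set ws)" using c by (intro T.span_base) (auto simp: ws_def)
      qed
    qed
    have 2: "E (p \<otimes> (i2 \<cdot>\<^sub>2 c)) \<in> T.span (set ws)" if c: "c \<in> set cs" for p c
    proof -
      \<comment> \<open>E turns i2 in the second factor into i1 in the first, so \<open>cs\<close>
        already yields the whole image.\<close>
      have "E (L2 i2 z) = E (L1 i1 z)" for z by (simp add: E_def I1_sq I2_sq L_commute add.commute)
      from this[of "p \<otimes> c"] have "E (p \<otimes> (i2 \<cdot>\<^sub>2 c)) = E ((i1 \<cdot>\<^sub>1 p) \<otimes> c)" by (simp add: mT_tn)
      then show ?thesis using 1[OF c] by simp
    qed
    have 3: "E (p \<otimes> q) \<in> T.span (set ws)" for p q
    proof -
      have "q \<in> B.span (set (cs @ map (\<lambda>c. i2 \<cdot>\<^sub>2 c) cs))" using cs by simp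
      then show ?thesis
      proof (rule B.span_induct)
        show "B.subspace {q. E (p \<otimes> q) \<in> T.span (set ws)}"
          by (auto simp: B.subspace_def tn_add_right Eadd T.span_zero intro: T.span_add T.span_scale)
        fix c assume "c \<in> set (cs @ map (\<lambda>c. i2 \<cdot>\<^sub>2 c) cs)"
        then show "E (p \<otimes> c) \<in> T.span (set ws)" using 1 2 by auto
      qed
    qed
    have "E z \<in> T.span (set ws)" for z
      by (induction z rule: tensor_induct) (use 3 in \<open>auto simp: Eadd intro: T.span_add\<close>)
    then show "range E \<subseteq> T.span (set ws)" by blast
  qed
  then have "T.dim J.X0 = length ws" using gg.orthogonal_dim[OF o] by (simp add: X0_eq_range)
  then show ?thesis using bs by (simp add: ws_def)
qed

lemma K_basis_2:
  assumes "B.dim UNIV = 2"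
  shows "B.norm.orthogonal ([one2] @ map (\<lambda>c. i2 \<cdot>\<^sub>2 c) [one2])" "B.span (set ([one2] @ map (\<lambda>c. i2 \<cdot>\<^sub>2 c) [one2])) = UNIV"
  using one_i_orthogonal_B B.norm.orthogonal_span_UNIV[OF one_i_orthogonal_B] assms by simp_all

lemma K_basis_4:
  assumes dim: "B.dim UNIV = 4" and t: "t \<in> W2" "t \<noteq> 0"
  shows "B.norm.orthogonal ([one2, t] @ map (\<lambda>c. i2 \<cdot>\<^sub>2 c) [one2, t])"
    "B.span (set ([one2, t] @ map (\<lambda>c. i2 \<cdot>\<^sub>2 c) [one2, t])) = UNIV"
proof -
  interpret Q: quaternion_pair sc2 mu2 one2 N2 i2 t by (rule quaternion_pair_B[OF t])
  show o: "B.norm.orthogonal ([one2, t] @ map (\<lambda>c. i2 \<cdot>\<^sub>2 c) [one2, t])"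
    using Q.block_orthogonal[OF B.one_neq_zero] by (simp add: Q.block_def)
  show "B.span (set ([one2, t] @ map (\<lambda>c. i2 \<cdot>\<^sub>2 c) [one2, t])) = UNIV"
    by (rule B.norm.orthogonal_span_UNIV[OF o]) (simp_all add: dim)
qed

lemma W2_exists_next:
  assumes "B.dim UNIV = 8" "t \<in> W2" "t \<noteq> 0"
  shows "\<exists>l. l \<noteq> 0 \<and> B.f l one2 = 0 \<and> B.f l i2 = 0 \<and> B.f l t = 0 \<and> B.f l (i2 \<cdot>\<^sub>2 t) = 0"
proof -
  interpret Q: quaternion_pair sc2 mu2 one2 N2 i2 t by (rule quaternion_pair_B[OF assms(2,3)])
  show ?thesis
    using B.norm.orthogonal_extend[OF Q.block_orthogonal[OF B.one_neq_zero]] by (auto simp: assms Q.block_def)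
qed

lemma K_basis_8:
  assumes dim: "B.dim UNIV = 8" and t: "t \<in> W2" "t \<noteq> 0"
    and l: "l \<noteq> 0" "B.f l one2 = 0" "B.f l i2 = 0" "B.f l t = 0" "B.f l (i2 \<cdot>\<^sub>2 t) = 0"
  shows "B.norm.orthogonal ([one2, t, l, t \<cdot>\<^sub>2 l] @ map (\<lambda>c. i2 \<cdot>\<^sub>2 c) [one2, t, l, t \<cdot>\<^sub>2 l])"
    "B.span (set ([one2, t, l, t \<cdot>\<^sub>2 l] @ map (\<lambda>c. i2 \<cdot>\<^sub>2 c) [one2, t, l, t \<cdot>\<^sub>2 l])) = UNIV"
proof -
  interpret Q: quaternion_pair sc2 mu2 one2 N2 i2 t by (rule quaternion_pair_B[OF t])
  have "B.norm.orthogonal (Q.block one2 @ Q.block l)"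
    by (rule Q.two_blocks_orthogonal) (use l in simp_all)
  then show o: "B.norm.orthogonal ([one2, t, l, t \<cdot>\<^sub>2 l] @ map (\<lambda>c. i2 \<cdot>\<^sub>2 c) [one2, t, l, t \<cdot>\<^sub>2 l])"
    by (rule B.norm.orthogonal_reorder) (auto simp: Q.block_def)
  show "B.span (set ([one2, t, l, t \<cdot>\<^sub>2 l] @ map (\<lambda>c. i2 \<cdot>\<^sub>2 c) [one2, t, l, t \<cdot>\<^sub>2 l])) = UNIV"
    by (rule B.norm.orthogonal_span_UNIV[OF o]) (simp_all add: dim)
qed

lemma dim_X0_eq: "T.dim J.X0 = 4 * B.dim UNIV"
proof -
  consider "B.dim UNIV = 2" | "B.dim UNIV = 4" | "B.dim UNIV = 8" using dim2 by blast
  then show ?thesis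
  proof cases
    case 1
    then show ?thesis using dim_X0[OF K_basis_2] by simp
  next
    case 2
    then obtain t where "t \<in> W2" "t \<noteq> 0" using W2_exists by auto
    then show ?thesis using dim_X0[OF K_basis_4[OF 2]] 2 by simp
  next
    case 3
    then obtain t where t: "t \<in> W2" "t \<noteq> 0" using W2_exists by auto
    then obtain l where "l \<noteq> 0" "B.f l one2 = 0" "B.f l i2 = 0" "B.f l t = 0" "B.f l (i2 \<cdot>\<^sub>2 t) = 0"
      using W2_exists_next[OF 3] by blast
    from dim_X0[OF K_basis_8[OF 3 t this]] 3 show ?thesis by simp
  qed
qed

lemma X0_nontrivial: "J.X0 \<noteq> {0}"
proof
  assume "J.X0 = {0}"
  then have "E (one1 \<otimes> one2) = 0" using X0_eq_range by blast
  then have "g (E (one1 \<otimes> one2)) (i1 \<otimes> one2) = 0" using g_scale_left[of 0 0] by simp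
  moreover have "g (E (one1 \<otimes> one2)) (i1 \<otimes> one2) = 4 * N1 i1"
    using i2 by (simp add: E_def mT_tn g_add_left A.f_self B.skw_def)
  ultimately show False using i1 four by simp
qed

lemma spin_base: "jordan_spin_base sT skS nq e0 e1 act bt u"
proof (rule jordan_spin_base.intro[OF J.jordan_spin_axioms], rule jordan_spin_base_axioms.intro)
  show "bt (act u x) x \<noteq> 0" if "x \<in> J.X0" "x \<noteq> 0" for x using regular[OF that(1)] that(2) by blast
qed (fact u_V nq_u nq_aniso cubic X0_nontrivial)+

end

lemma sorted_wrt_pairwise: "sorted_wrt P xs \<Longrightarrow> x \<in> set xs \<Longrightarrow> y \<in> set xs \<Longrightarrow> x = y \<or> P x y \<or> P y x"
  by (induction xs) auto

section \<open>V as a space over k(sqrt a), and the types\<close>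

context octonion_setup
begin

text \<open>Multiplication by sqrt a on V: its square is a, and it is skew for
  \<open>fA\<close>.\<close>

definition KI :: "'t \<Rightarrow> 't" where "KI x = emb (i1 \<cdot>\<^sub>1 pr1 x) (i2 \<cdot>\<^sub>2 pr2 x)"

lemma i_W1: "s \<in> W1 \<Longrightarrow> i1 \<cdot>\<^sub>1 s \<in> W1"
  using A.f_mult_left[of i1 s one1] A.skw_adj[OF i1(1), of s one1]
  by (simp add: W1_def A.skw_def)

lemma i_W2: "t \<in> W2 \<Longrightarrow> i2 \<cdot>\<^sub>2 t \<in> W2"
  using B.f_mult_left[of i2 t one2] B.skw_adj[OF i2(1), of t one2]
  by (simp add: W2_def B.skw_def)

lemma pr_KI [simp]:
  assumes "x \<in> J.V" shows "pr1 (KI x) = i1 \<cdot>\<^sub>1 pr1 x" "pr2 (KI x) = i2 \<cdot>\<^sub>2 pr2 x"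
  using assms i_W1 i_W2 by (simp_all add: KI_def V_iff W1D W2D)

lemma KI_V: "x \<in> J.V \<Longrightarrow> KI x \<in> J.V"
  unfolding KI_def by (rule emb_V) (simp_all add: V_iff i_W1 i_W2)

lemma KI_emb: "s \<in> W1 \<Longrightarrow> t \<in> W2 \<Longrightarrow> KI (emb s t) = emb (i1 \<cdot>\<^sub>1 s) (i2 \<cdot>\<^sub>2 t)"
  by (simp add: KI_def W1D W2D)

lemma fA_emb: "s \<in> W1 \<Longrightarrow> t \<in> W2 \<Longrightarrow> s' \<in> W1 \<Longrightarrow> t' \<in> W2 \<Longrightarrow>
    fA (emb s t) (emb s' t') = A.f s s' - B.f t t'"
  by (simp add: fA_def W1D W2D)

lemma fA_KI: "x \<in> J.V \<Longrightarrow> y \<in> J.V \<Longrightarrow> fA (KI x) y = - fA x (KI y)"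
  by (simp add: fA_def A.skw_adj[OF i1(1)] B.skw_adj[OF i2(1)])

lemma fA_KI_KI: "x \<in> J.V \<Longrightarrow> y \<in> J.V \<Longrightarrow> fA (KI x) (KI y) = - a * fA x y"
  by (simp add: fA_def A.f_mult_left B.f_mult_left N_i a_def algebra_simps)

lemma V_skS: "x \<in> J.V \<Longrightarrow> x \<in> skS" by (simp add: V_iff)

lemma nq_fA: "x \<in> J.V \<Longrightarrow> 2 * - nq x = fA x x / n"
  using qA_fA[OF V_skS, of x] by (simp add: nq_def)

lemma fA_nonzero: "x \<in> J.V \<Longrightarrow> x \<noteq> 0 \<Longrightarrow> fA x x \<noteq> 0"
  using nq_fA[of x] nq_aniso[of x] A.two by auto

text \<open>If a were c^2, then i1 + c would have norm c^2 - a = 0.\<close>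

lemma a_nonsquare: "a \<noteq> c\<^sup>2"
proof
  assume "a = c\<^sup>2"
  then have "N1 i1 = - c\<^sup>2" by (metis a_def minus_minus)
  then have "N1 (i1 + c *\<^sub>1 one1) = 0" using i1 by (simp add: A.N_add A.skw_def)
  then have "A.f (i1 + c *\<^sub>1 one1) i1 = 0" by (simp only: A.N_eq_0_iff A.f_zero_left)
  then show False using i1 A.two by (simp add: A.f_add_left A.f_self A.skw_def A.f_sym[of one1 i1])
qed

text \<open>The hypotheses make \<open>vs\<close> a basis of V over k(sqrt a) that is orthogonal for
  the hermitian form with components \<open>fA v w\<close> and \<open>fA v (KI w)\<close>.\<close>

lemma norm_multiple_V:
  assumes vs: "set vs \<subseteq> J.V" "sorted_wrt (\<lambda>v w. fA v w = 0 \<and> fA v (KI w) = 0) vs" "0 \<notin> set vs"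
    and sp: "J.V \<subseteq> T.span (set (vs @ map KI vs))"
  shows "norm_multiple sT J.V (\<lambda>v. - nq v) (adjoin_sqrt a) (\<lambda>(x, y). x\<^sup>2 - a * y\<^sup>2) (map (\<lambda>v. - nq v) vs)"
proof -
  interpret VV: bilinear_form_on sT J.V "\<lambda>x y. fA x y / n"
  proof
    show "T.subspace J.V" by (rule J.subspace_V)
    show "fA x y / n = fA y x / n" for x y by (simp add: fA_sym[of x y])
  qed (simp_all add: fA_add_left add_divide_distrib)
  have KI0: "fA v (KI v) = 0" if "v \<in> J.V" for v
  proof (rule J.two_cancel)
    show "fA v (KI v) = - fA v (KI v)" using fA_KI[OF that that] fA_sym[of v "KI v"] by metis
  qed
  have sub: "v \<in> J.V" if "v \<in> set vs" for v using vs(1) that by blast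
  have cross: "fA v (KI w) = 0" if vw: "v \<in> set vs" "w \<in> set vs" for v w
    using sorted_wrt_pairwise[OF vs(2) vw] KI0[OF sub[OF vw(1)]] fA_KI[OF sub[OF vw(1)] sub[OF vw(2)]]
      fA_sym[of w "KI v"] by auto
  have "sorted_wrt (\<lambda>v w. fA v w / n = 0) vs"
    by (rule sorted_wrt_mono_rel[OF _ vs(2)]) simp
  moreover have "sorted_wrt (\<lambda>v w. fA (KI v) (KI w) / n = 0) vs"
    by (rule sorted_wrt_mono_rel[OF _ vs(2)]) (use sub fA_KI_KI in simp)
  moreover have "fA v v \<noteq> 0" if "v \<in> set vs" for v
    using fA_nonzero[OF sub[OF that]] vs(3) that by metis
  ultimately have o: "VV.orthogonal (vs @ map KI vs)"
    using cross vs(1) sub KI_V fA_KI_KI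
    by (auto simp: VV.orthogonal_def sorted_wrt_append sorted_wrt_map)
  have L: "J.V = T.span (set (vs @ map KI vs))"
    using sp KI_V sub by (intro subset_antisym T.span_minimal J.subspace_V) auto
  have "isometric_to_multiple sT J.V (\<lambda>v. - nq v) (\<lambda>c (x, y). (c * x, c * y)) (\<lambda>(x, y). x\<^sup>2 - a * y\<^sup>2)
      (map (\<lambda>v. - nq v) vs)"
  proof (rule VV.isometric_to_norm_multiple_orthogonal[OF o L nq_fA A.two])
    fix i assume "i < length vs"
    then have v: "vs ! i \<in> J.V" using sub by simp
    have "2 * - nq (KI (vs ! i)) = 2 * (- a * - nq (vs ! i))"
    proof -
      have "2 * - nq (KI (vs ! i)) = - a * (fA (vs ! i) (vs ! i) / n)"
        unfolding nq_fA[OF KI_V[OF v]] fA_KI_KI[OF v v] by simp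
      then show ?thesis unfolding nq_fA[OF v, symmetric] by (simp only: mult.left_commute)
    qed
    then have "- nq (KI (vs ! i)) = - a * - nq (vs ! i)" using A.two unfolding mult_cancel_left by blast
    then show "- nq (map KI vs ! i) = - a * - nq (vs ! i)" using \<open>i < length vs\<close> by simp
  qed simp_all
  moreover have "scal (adjoin_sqrt a) = (\<lambda>c (x, y). (c * x, c * y))" by (simp add: adjoin_sqrt_def)
  moreover have "0 \<notin> set (map (\<lambda>v. - nq v) vs)"
  proof
    assume "0 \<in> set (map (\<lambda>v. - nq v) vs)"
    then obtain v where v: "v \<in> set vs" "nq v = 0" by auto
    then have "v = 0" using nq_aniso sub by blast
    with v vs(3) show False by simp
  qed
  ultimately show ?thesis
    using separable_adjoin_sqrt[OF a_nonsquare A.two] norm_adjoin_sqrt[OF A.two] by (simp add: norm_multiple_def)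
qed

lemma emb_W1_mem:
  assumes s: "s \<in> W1" "s \<noteq> 0" and l: "l \<noteq> 0" "A.f l one1 = 0" "A.f l i1 = 0" "A.f l s = 0" "A.f l (i1 \<cdot>\<^sub>1 s) = 0"
    and U: "T.subspace U"
    and mem: "\<And>w. w \<in> {s, i1 \<cdot>\<^sub>1 s, l, i1 \<cdot>\<^sub>1 l, s \<cdot>\<^sub>1 l, i1 \<cdot>\<^sub>1 (s \<cdot>\<^sub>1 l)} \<Longrightarrow> emb w 0 \<in> U"
    and p: "p \<in> W1"
  shows "emb p 0 \<in> U"
proof -
  note full = W1_full_orthogonal[OF s l]
  let ?bs = "[one1, s, i1, i1 \<cdot>\<^sub>1 s, l, s \<cdot>\<^sub>1 l, i1 \<cdot>\<^sub>1 l, i1 \<cdot>\<^sub>1 (s \<cdot>\<^sub>1 l)]"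
  have e: "p = (\<Sum>b\<leftarrow>?bs. (A.f p b / A.f b b) *\<^sub>1 b)"
    by (rule A.norm.orthogonal_expand_list[OF full(1)]) (simp only: full(2) UNIV_I)
  have add: "emb (x + y) 0 = emb x 0 + emb y 0" "emb (c *\<^sub>1 x) 0 = c *\<^sub>T emb x 0" "emb 0 0 = 0" for x y c
    using emb_add[of x y 0 0] emb_scale[of c x 0] by (simp_all add: emb_def)
  have "A.f p one1 = 0" "A.f p i1 = 0" using p by (simp_all add: W1_def A.skw_def)
  then show ?thesis
    by (subst e) (auto simp: add intro!: T.subspace_add[OF U] T.subspace_scale[OF U] mem)
qed

lemma emb_W2_mem:
  assumes o: "B.norm.orthogonal bs" and sp: "B.span (set bs) = UNIV"
    and U: "T.subspace U" and mem: "\<And>w. w \<in> set bs \<Longrightarrow> w = one2 \<or> w = i2 \<or> emb 0 w \<in> U"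
    and q: "q \<in> W2"
  shows "emb 0 q \<in> U"
proof -
  have e: "q = (\<Sum>b\<leftarrow>bs. (B.f q b / B.f b b) *\<^sub>2 b)"
    by (rule B.norm.orthogonal_expand_list[OF o]) (simp add: sp)
  have add: "emb 0 (x + y) = emb 0 x + emb 0 y" "emb 0 (c *\<^sub>2 x) = c *\<^sub>T emb 0 x" "emb 0 0 = 0" for x y c
    using emb_add[of 0 0 x y] emb_scale[of c 0 x] by (simp_all add: emb_def)
  have q0: "B.f q one2 = 0" "B.f q i2 = 0" using q by (simp_all add: W2_def B.skw_def)
  have "emb 0 (\<Sum>b\<leftarrow>cs. (B.f q b / B.f b b) *\<^sub>2 b) \<in> U" if "set cs \<subseteq> set bs" for cs
    using that
  proof (induction cs)
    case Nil
    then show ?case by (simp add: add T.subspace_0[OF U])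
  next
    case (Cons c cs)
    have "emb 0 ((B.f q c / B.f c c) *\<^sub>2 c) \<in> U"
    proof (cases "c = one2 \<or> c = i2")
      case True
      then have "B.f q c = 0" using q0 by blast
      then show ?thesis by (simp add: add T.subspace_0[OF U])
    next
      case False
      then have "emb 0 c \<in> U" using mem[of c] Cons by auto
      then show ?thesis by (simp add: add T.subspace_scale[OF U])
    qed
    then show ?case using Cons by (simp add: add T.subspace_add[OF U])
  qed
  from this[OF subset_refl] show ?thesis by (subst e)
qed

lemma V_subset_if:
  assumes U: "T.subspace U" and 1: "\<And>p. p \<in> W1 \<Longrightarrow> emb p 0 \<in> U" and 2: "\<And>q. q \<in> W2 \<Longrightarrow> emb 0 q \<in> U"
  shows "J.V \<subseteq> U"
proof
  fix v assume "v \<in> J.V"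
  then obtain p q where pq: "p \<in> W1" "q \<in> W2" "v = emb p q" using V_emb by blast
  then have "v = emb p 0 + emb 0 q" by (simp flip: emb_add)
  then show "v \<in> U" using T.subspace_add[OF U 1[OF pq(1)] 2[OF pq(2)]] by simp
qed

lemma W1_frame:
  assumes s: "s \<in> W1" "s \<noteq> 0"
  obtains l where "l \<noteq> 0" "A.f l one1 = 0" "A.f l i1 = 0" "A.f l s = 0" "A.f l (i1 \<cdot>\<^sub>1 s) = 0"
    "l \<in> W1" "s \<cdot>\<^sub>1 l \<in> W1" "s \<cdot>\<^sub>1 l \<noteq> 0" "A.f s l = 0" "A.f s (s \<cdot>\<^sub>1 l) = 0" "A.f l (s \<cdot>\<^sub>1 l) = 0"
    "A.f s (i1 \<cdot>\<^sub>1 l) = 0" "A.f s (i1 \<cdot>\<^sub>1 (s \<cdot>\<^sub>1 l)) = 0" "A.f l (i1 \<cdot>\<^sub>1 (s \<cdot>\<^sub>1 l)) = 0"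
proof -
  obtain l where l: "l \<noteq> 0" "A.f l one1 = 0" "A.f l i1 = 0" "A.f l s = 0" "A.f l (i1 \<cdot>\<^sub>1 s) = 0"
    using W1_exists_next[OF s] by blast
  note o = W1_full_orthogonal(1)[OF s l]
  have "l \<in> W1" "s \<cdot>\<^sub>1 l \<in> W1"
    using l o A.f_sym[of "s \<cdot>\<^sub>1 l" one1] A.f_sym[of "s \<cdot>\<^sub>1 l" i1]
    by (simp_all add: W1_def A.skw_def A.norm.orthogonal_def)
  moreover have "s \<cdot>\<^sub>1 l \<noteq> 0" using s l by simp
  moreover have "A.f s l = 0" "A.f s (s \<cdot>\<^sub>1 l) = 0" "A.f l (s \<cdot>\<^sub>1 l) = 0"
    "A.f s (i1 \<cdot>\<^sub>1 l) = 0" "A.f s (i1 \<cdot>\<^sub>1 (s \<cdot>\<^sub>1 l)) = 0" "A.f l (i1 \<cdot>\<^sub>1 (s \<cdot>\<^sub>1 l)) = 0"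
    using o by (simp_all add: A.norm.orthogonal_def)
  ultimately show thesis using l that by blast
qed

lemma aniso_V: "anisotropic_on J.V (\<lambda>v. - nq v)"
  using nq_aniso by (simp add: anisotropic_on_def)

lemma Q_emb: "s \<in> W1 \<Longrightarrow> t \<in> W2 \<Longrightarrow> - nq (emb s t) = (N1 s - N2 t) / n"
  by (simp add: nq_def qA_emb)

lemma emb_nonzero: "s \<in> W1 \<Longrightarrow> t \<in> W2 \<Longrightarrow> s \<noteq> 0 \<or> t \<noteq> 0 \<Longrightarrow> emb s t \<noteq> 0"
proof
  assume "s \<in> W1" "t \<in> W2" "s \<noteq> 0 \<or> t \<noteq> 0" "emb s t = 0"
  then have "s = 0" "t = 0" using pr_emb[of s t] pr1_scale[of 0 0] pr2_scale[of 0 0] by (simp_all add: W1D W2D)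
  with \<open>s \<noteq> 0 \<or> t \<noteq> 0\<close> show False by blast
qed

lemma type_E6:
  assumes dim: "B.dim UNIV = 2"
  shows "quadratic_space_E6 sT J.V (\<lambda>v. - nq v)"
proof -
  have W2: "q = 0" if "q \<in> W2" for q using W2_zero_if_dim_2[OF dim that] .
  obtain s q where "s \<in> W1" "q \<in> W2" "u = emb s q" using V_emb[OF u_V] by blast
  then have s: "s \<in> W1" "u = emb s 0" using W2 by auto
  have s0: "s \<noteq> 0" using s u(4) by (auto simp: emb_def)
  obtain l where l: "l \<noteq> 0" "A.f l one1 = 0" "A.f l i1 = 0" "A.f l s = 0" "A.f l (i1 \<cdot>\<^sub>1 s) = 0"
    "l \<in> W1" "s \<cdot>\<^sub>1 l \<in> W1" "s \<cdot>\<^sub>1 l \<noteq> 0" "A.f s l = 0" "A.f s (s \<cdot>\<^sub>1 l) = 0" "A.f l (s \<cdot>\<^sub>1 l) = 0"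
    "A.f s (i1 \<cdot>\<^sub>1 l) = 0" "A.f s (i1 \<cdot>\<^sub>1 (s \<cdot>\<^sub>1 l)) = 0" "A.f l (i1 \<cdot>\<^sub>1 (s \<cdot>\<^sub>1 l)) = 0"
    by (rule W1_frame[OF s(1) s0])
  \<comment> \<open>The first vector is u, so the first coefficient is Q(u) = 1.\<close>
  define vs where "vs = [emb s 0, emb l 0, emb (s \<cdot>\<^sub>1 l) 0]"
  note W = s(1) s0 l W2_zero
  have "norm_multiple sT J.V (\<lambda>v. - nq v) (adjoin_sqrt a) (\<lambda>(x, y). x\<^sup>2 - a * y\<^sup>2) (map (\<lambda>v. - nq v) vs)"
  proof (rule norm_multiple_V)
    show "set vs \<subseteq> J.V" using W by (simp add: vs_def emb_V)
    show "sorted_wrt (\<lambda>v w. fA v w = 0 \<and> fA v (KI w) = 0) vs"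
      using W i_W1 by (simp add: vs_def KI_emb fA_emb)
    show "0 \<notin> set vs" using emb_nonzero[OF s(1) W2_zero] emb_nonzero[OF l(6) W2_zero] emb_nonzero[OF l(7) W2_zero] W
      by (simp add: vs_def)
    let ?U = "T.span (set (vs @ map KI vs))"
    have "emb p 0 \<in> ?U" if "p \<in> W1" for p
      by (rule emb_W1_mem[OF s(1) s0 l(1-5) T.subspace_span _ that])
        (use W in \<open>auto simp: vs_def KI_emb intro!: T.span_base\<close>)
    moreover have "emb 0 q \<in> ?U" if "q \<in> W2" for q
      using W2[OF that] by (simp add: emb_def T.span_zero)
    ultimately show "J.V \<subseteq> ?U" by (intro V_subset_if T.subspace_span)
  qed
  moreover have "map (\<lambda>v. - nq v) vs = [1, - nq (emb l 0), - nq (emb (s \<cdot>\<^sub>1 l) 0)]"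
    using nq_u s by (simp add: vs_def)
  ultimately show ?thesis using aniso_V unfolding quadratic_space_E6_def by metis
qed

lemma KI_add: "KI (x + y) = KI x + KI y"
  by (simp add: KI_def pr1_add pr2_add A.bilin B.bilin emb_add)

lemma KI_scale: "KI (c *\<^sub>T x) = c *\<^sub>T KI x"
  by (simp add: KI_def emb_scale)

text \<open>Writing \<open>u = \<epsilon> s + \<delta> t\<close>, the vector \<open>u'\<close> spans the orthogonal complement of \<open>u\<close> in the plane of \<open>s\<close> and \<open>t\<close>;
  the coefficients are scaled so that \<open>Q(u') = - N(s) N(t)\<close>.\<close>

lemma u_frame:
  assumes "B.dim UNIV \<noteq> 2"
  obtains s t u' where "s \<in> W1" "s \<noteq> 0" "t \<in> W2" "t \<noteq> 0"
    "u' \<in> J.V" "u' \<noteq> 0" "- nq u' = - (N1 s * N2 t)" "fA u u' = 0" "fA u (KI u') = 0"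
    "\<And>p q. p \<in> W1 \<Longrightarrow> q \<in> W2 \<Longrightarrow> A.f s p = 0 \<Longrightarrow> B.f t q = 0 \<Longrightarrow> fA u (emb p q) = 0 \<and> fA u' (emb p q) = 0"
    "\<And>U. T.subspace U \<Longrightarrow> {u, u', KI u, KI u'} \<subseteq> U \<Longrightarrow>
      emb s 0 \<in> U \<and> emb (i1 \<cdot>\<^sub>1 s) 0 \<in> U \<and> emb 0 t \<in> U \<and> emb 0 (i2 \<cdot>\<^sub>2 t) \<in> U"
proof -
  obtain p q where pq: "p \<in> W1" "q \<in> W2" "u = emb p q" using V_emb[OF u_V] by blast
  \<comment> \<open>A direction is needed even if this component of u vanishes; then any nonzero s
    serves, with coefficient 0.\<close>
  obtain s \<epsilon> where s: "s \<in> W1" "s \<noteq> 0" "p = \<epsilon> *\<^sub>1 s"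
  proof (cases "p = 0")
    case True
    obtain s where s: "s \<in> W1" "s \<noteq> 0" using W1_exists by blast
    show ?thesis by (rule that[OF s, of 0]) (simp add: True)
  next
    case False
    show ?thesis by (rule that[OF pq(1) False, of 1]) simp
  qed
  obtain t \<delta> where t: "t \<in> W2" "t \<noteq> 0" "q = \<delta> *\<^sub>2 t"
  proof (cases "q = 0")
    case True
    obtain t where t: "t \<in> W2" "t \<noteq> 0" using W2_exists[OF assms] by blast
    show ?thesis by (rule that[OF t, of 0]) (simp add: True)
  next
    case False
    show ?thesis by (rule that[OF pq(2) False, of 1]) simp
  qed
  have sc: "c *\<^sub>1 s \<in> W1" "c *\<^sub>2 t \<in> W2" for c
    using s t by (simp_all add: W1_def W2_def A.skw_def B.skw_def)
  have u_eq: "u = emb (\<epsilon> *\<^sub>1 s) (\<delta> *\<^sub>2 t)" using pq s t by simp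
  have n_eq: "n = \<epsilon>\<^sup>2 * N1 s - \<delta>\<^sup>2 * N2 t"
    using qA_emb[OF sc(1)[of \<epsilon>] sc(2)[of \<delta>], folded u_eq] by (simp add: n_def)
  define u' where "u' = emb ((\<delta> * N2 t) *\<^sub>1 s) ((\<epsilon> * N1 s) *\<^sub>2 t)"
  have u'V: "u' \<in> J.V" unfolding u'_def by (rule emb_V[OF sc])
  have "N1 ((\<delta> * N2 t) *\<^sub>1 s) - N2 ((\<epsilon> * N1 s) *\<^sub>2 t) = - (N1 s * N2 t) * n"
    by (simp add: n_eq power2_eq_square algebra_simps)
  then have nq': "- nq u' = - (N1 s * N2 t)"
    unfolding u'_def Q_emb[OF sc] by simp
  have u'0: "u' \<noteq> 0"
  proof
    assume "u' = 0"
    then have "- nq u' = 0" using Q_emb[OF W1_zero W2_zero] by (simp add: emb_def)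
    then show False using nq' s t by simp
  qed
  have f0: "A.f s (i1 \<cdot>\<^sub>1 s) = 0" "B.f t (i2 \<cdot>\<^sub>2 t) = 0"
    using A.f_skw_self[OF i1(1), of s] B.f_skw_self[OF i2(1), of t]
      A.f_sym[of s "i1 \<cdot>\<^sub>1 s"] B.f_sym[of t "i2 \<cdot>\<^sub>2 t"] by simp_all
  have fu: "fA u u' = 0" "fA u (KI u') = 0"
    unfolding u_eq u'_def KI_emb[OF sc] using i_W1[OF sc(1)] i_W2[OF sc(2)] sc f0
    by (simp_all add: fA_emb A.f_self B.f_self)
  have perp: "fA u (emb p q) = 0 \<and> fA u' (emb p q) = 0"
    if "p \<in> W1" "q \<in> W2" "A.f s p = 0" "B.f t q = 0" for p q
    unfolding u_eq u'_def using that sc by (simp add: fA_emb)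
  \<comment> \<open>Solving for s and t: the determinant of the passage to u, u' is n.\<close>
  have st: "emb s 0 = (1 / n) *\<^sub>T ((\<epsilon> * N1 s) *\<^sub>T u - \<delta> *\<^sub>T u')"
    "emb 0 t = (1 / n) *\<^sub>T (\<epsilon> *\<^sub>T u' - (\<delta> * N2 t) *\<^sub>T u)"
  proof -
    have "(\<epsilon> * N1 s) *\<^sub>T u - \<delta> *\<^sub>T u' = emb (n *\<^sub>1 s) 0" "\<epsilon> *\<^sub>T u' - (\<delta> * N2 t) *\<^sub>T u = emb 0 (n *\<^sub>2 t)"
      unfolding n_eq by (simp_all add: u_eq u'_def emb_def tn_add_left tn_add_right A.scale_left_diff_distrib B.scale_left_diff_distrib tn_diff_left tn_diff_right T.scale_right_distrib
          T.scale_left_diff_distrib power2_eq_square algebra_simps)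
    moreover have "(1 / n) *\<^sub>T emb (n *\<^sub>1 s) 0 = emb s 0" "(1 / n) *\<^sub>T emb 0 (n *\<^sub>2 t) = emb 0 t"
      by (simp_all add: emb_def)
    ultimately show "emb s 0 = (1 / n) *\<^sub>T ((\<epsilon> * N1 s) *\<^sub>T u - \<delta> *\<^sub>T u')"
      "emb 0 t = (1 / n) *\<^sub>T (\<epsilon> *\<^sub>T u' - (\<delta> * N2 t) *\<^sub>T u)" by simp_all
  qed
  have gen: "emb s 0 \<in> U \<and> emb (i1 \<cdot>\<^sub>1 s) 0 \<in> U \<and> emb 0 t \<in> U \<and> emb 0 (i2 \<cdot>\<^sub>2 t) \<in> U"
    if U: "T.subspace U" "{u, u', KI u, KI u'} \<subseteq> U" for U
  proof -
    have diff: "KI (x - y) = KI x - KI y" for x y using KI_add[of x "- y"] KI_scale[of "-1" y] by simp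
    have "emb (i1 \<cdot>\<^sub>1 s) 0 = KI (emb s 0)" "emb 0 (i2 \<cdot>\<^sub>2 t) = KI (emb 0 t)"
      using s t W1_zero W2_zero by (simp_all add: KI_emb)
    then show ?thesis unfolding st KI_scale diff
      using U by (auto simp: st diff KI_scale intro!: T.subspace_scale T.subspace_diff)
  qed
  show thesis by (rule that[OF s(1,2) t(1,2) u'V u'0 nq' fu perp gen])
qed

text \<open>The product of the last three coefficients is -N(t) times a square. Were it a norm from
  k(sqrt a), the norm of the quaternion algebra would be isotropic on the span of 1, i2 and
  t.\<close>

lemma type_E7:
  assumes dim: "B.dim UNIV = 4"
  shows "quadratic_space_E7 sT J.V (\<lambda>v. - nq v)"
proof -
  have "B.dim UNIV \<noteq> 2" using dim by simp
  from u_frame[OF this] obtain s t u' where st: "s \<in> W1" "s \<noteq> 0" "t \<in> W2" "t \<noteq> 0"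
    and u': "u' \<in> J.V" "u' \<noteq> 0" "- nq u' = - (N1 s * N2 t)" "fA u u' = 0" "fA u (KI u') = 0"
    and perp: "\<And>p q. p \<in> W1 \<Longrightarrow> q \<in> W2 \<Longrightarrow> A.f s p = 0 \<Longrightarrow> B.f t q = 0 \<Longrightarrow> fA u (emb p q) = 0 \<and> fA u' (emb p q) = 0"
    and gen: "\<And>U. T.subspace U \<Longrightarrow> {u, u', KI u, KI u'} \<subseteq> U \<Longrightarrow>
      emb s 0 \<in> U \<and> emb (i1 \<cdot>\<^sub>1 s) 0 \<in> U \<and> emb 0 t \<in> U \<and> emb 0 (i2 \<cdot>\<^sub>2 t) \<in> U" by blast
  obtain l where l: "l \<noteq> 0" "A.f l one1 = 0" "A.f l i1 = 0" "A.f l s = 0" "A.f l (i1 \<cdot>\<^sub>1 s) = 0"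
    "l \<in> W1" "s \<cdot>\<^sub>1 l \<in> W1" "s \<cdot>\<^sub>1 l \<noteq> 0" "A.f s l = 0" "A.f s (s \<cdot>\<^sub>1 l) = 0" "A.f l (s \<cdot>\<^sub>1 l) = 0"
    "A.f s (i1 \<cdot>\<^sub>1 l) = 0" "A.f s (i1 \<cdot>\<^sub>1 (s \<cdot>\<^sub>1 l)) = 0" "A.f l (i1 \<cdot>\<^sub>1 (s \<cdot>\<^sub>1 l)) = 0"
    by (rule W1_frame[OF st(1,2)])
  define vs where "vs = [u, u', emb l 0, emb (s \<cdot>\<^sub>1 l) 0]"
  note W = st l W2_zero W1_zero
  have "norm_multiple sT J.V (\<lambda>v. - nq v) (adjoin_sqrt a) (\<lambda>(x, y). x\<^sup>2 - a * y\<^sup>2) (map (\<lambda>v. - nq v) vs)"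
  proof (rule norm_multiple_V)
    show "set vs \<subseteq> J.V" using W u_V u' by (simp add: vs_def emb_V)
    show "sorted_wrt (\<lambda>v w. fA v w = 0 \<and> fA v (KI w) = 0) vs"
      using W i_W1 u' perp by (simp add: vs_def KI_emb fA_emb)
    show "0 \<notin> set vs" using emb_nonzero[OF l(6) W2_zero] emb_nonzero[OF l(7) W2_zero] W u u'(2)
      by (simp add: vs_def)
    let ?U = "T.span (set (vs @ map KI vs))"
    have U: "{u, u', KI u, KI u'} \<subseteq> ?U" by (auto simp: vs_def intro: T.span_base)
    note G = gen[OF T.subspace_span U]
    have M: "{emb l 0, emb (s \<cdot>\<^sub>1 l) 0, emb (i1 \<cdot>\<^sub>1 l) 0, emb (i1 \<cdot>\<^sub>1 (s \<cdot>\<^sub>1 l)) 0} \<subseteq> ?U"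
      using W by (auto simp: vs_def KI_emb intro: T.span_base)
    have "emb p 0 \<in> ?U" if "p \<in> W1" for p
      by (rule emb_W1_mem[OF st(1,2) l(1-5) T.subspace_span _ that])
        (use M G in auto)
    moreover have "emb 0 q \<in> ?U" if "q \<in> W2" for q
      by (rule emb_W2_mem[OF K_basis_4[OF dim st(3,4)] T.subspace_span _ that]) (use G in auto)
    ultimately show "J.V \<subseteq> ?U" by (intro V_subset_if T.subspace_span)
  qed
  moreover have "map (\<lambda>v. - nq v) vs = [1, - (N1 s * N2 t), N1 l / n, N1 s * N1 l / n]"
    using nq_u u'(3) Q_emb[OF l(6) W2_zero] Q_emb[OF l(7) W2_zero] by (simp add: vs_def)
  moreover have "- (N1 s * N2 t) * (N1 l / n) * (N1 s * N1 l / n) \<notin> range (\<lambda>(x, y). x\<^sup>2 - a * y\<^sup>2)"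
  proof
    let ?c = "N1 s * N1 l / n"
    assume "- (N1 s * N2 t) * (N1 l / n) * ?c \<in> range (\<lambda>(x, y). x\<^sup>2 - a * y\<^sup>2)"
    then obtain x y where xy: "- (N1 s * N2 t) * (N1 l / n) * ?c = x\<^sup>2 - a * y\<^sup>2" by auto
    have c: "?c \<noteq> 0" using st l by simp
    have "- N2 t * ?c\<^sup>2 = x\<^sup>2 - a * y\<^sup>2" unfolding xy[symmetric] by (simp add: power2_eq_square)
    then have "N2 t * ?c\<^sup>2 + x\<^sup>2 - a * y\<^sup>2 = 0" by (simp add: algebra_simps)
    moreover have "N2 (?c *\<^sub>2 t + (x *\<^sub>2 one2 + y *\<^sub>2 i2)) = N2 t * ?c\<^sup>2 + x\<^sup>2 - a * y\<^sup>2"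
      using W2D[OF st(3)] i2 unfolding B.N_add a_def
      by (simp add: B.f_add_right B.skw_def B.f_sym[of one2 i2] N_i)
    ultimately have "?c *\<^sub>2 t + (x *\<^sub>2 one2 + y *\<^sub>2 i2) = 0" by (simp only: B.N_eq_0_iff)
    then have "B.f (?c *\<^sub>2 t + (x *\<^sub>2 one2 + y *\<^sub>2 i2)) t = 0" by (simp only: B.f_zero_left)
    then have "?c * (2 * N2 t) = 0"
      using W2D[OF st(3)] unfolding B.f_add_left B.f_scale_left by (simp add: B.skw_def B.f_sym[of one2 t] B.f_self)
    then show False using c A.two st unfolding mult_eq_0_iff by simp
  qed
  ultimately show ?thesis using aniso_V unfolding quadratic_space_E7_def by metis
qed

lemma type_E8:
  assumes dim: "B.dim UNIV = 8"
  shows "quadratic_space_E8 sT J.V (\<lambda>v. - nq v)"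
proof -
  have "B.dim UNIV \<noteq> 2" using dim by simp
  from u_frame[OF this] obtain s t u' where st: "s \<in> W1" "s \<noteq> 0" "t \<in> W2" "t \<noteq> 0"
    and u': "u' \<in> J.V" "u' \<noteq> 0" "- nq u' = - (N1 s * N2 t)" "fA u u' = 0" "fA u (KI u') = 0"
    and perp: "\<And>p q. p \<in> W1 \<Longrightarrow> q \<in> W2 \<Longrightarrow> A.f s p = 0 \<Longrightarrow> B.f t q = 0 \<Longrightarrow> fA u (emb p q) = 0 \<and> fA u' (emb p q) = 0"
    and gen: "\<And>U. T.subspace U \<Longrightarrow> {u, u', KI u, KI u'} \<subseteq> U \<Longrightarrow>
      emb s 0 \<in> U \<and> emb (i1 \<cdot>\<^sub>1 s) 0 \<in> U \<and> emb 0 t \<in> U \<and> emb 0 (i2 \<cdot>\<^sub>2 t) \<in> U" by blast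
  obtain l where l: "l \<noteq> 0" "A.f l one1 = 0" "A.f l i1 = 0" "A.f l s = 0" "A.f l (i1 \<cdot>\<^sub>1 s) = 0"
    "l \<in> W1" "s \<cdot>\<^sub>1 l \<in> W1" "s \<cdot>\<^sub>1 l \<noteq> 0" "A.f s l = 0" "A.f s (s \<cdot>\<^sub>1 l) = 0" "A.f l (s \<cdot>\<^sub>1 l) = 0"
    "A.f s (i1 \<cdot>\<^sub>1 l) = 0" "A.f s (i1 \<cdot>\<^sub>1 (s \<cdot>\<^sub>1 l)) = 0" "A.f l (i1 \<cdot>\<^sub>1 (s \<cdot>\<^sub>1 l)) = 0"
    by (rule W1_frame[OF st(1,2)])
  obtain m where m: "m \<noteq> 0" "B.f m one2 = 0" "B.f m i2 = 0" "B.f m t = 0" "B.f m (i2 \<cdot>\<^sub>2 t) = 0"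
    using W2_exists_next[OF dim st(3,4)] by blast
  note basis = K_basis_8[OF dim st(3,4) m]
  have mW: "m \<in> W2" "t \<cdot>\<^sub>2 m \<in> W2" "t \<cdot>\<^sub>2 m \<noteq> 0"
    using m st basis(1) B.f_sym[of "t \<cdot>\<^sub>2 m" one2] B.f_sym[of "t \<cdot>\<^sub>2 m" i2]
    by (simp_all add: W2_def B.skw_def B.norm.orthogonal_def)
  have mf: "B.f t m = 0" "B.f t (t \<cdot>\<^sub>2 m) = 0" "B.f t (i2 \<cdot>\<^sub>2 m) = 0" "B.f t (i2 \<cdot>\<^sub>2 (t \<cdot>\<^sub>2 m)) = 0"
    "B.f m (t \<cdot>\<^sub>2 m) = 0" "B.f m (i2 \<cdot>\<^sub>2 (t \<cdot>\<^sub>2 m)) = 0"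
    using basis(1) by (simp_all add: B.norm.orthogonal_def)
  define vs where "vs = [u, u', emb l 0, emb (s \<cdot>\<^sub>1 l) 0, emb 0 m, emb 0 (t \<cdot>\<^sub>2 m)]"
  note W = st l W2_zero W1_zero mW mf
  have "norm_multiple sT J.V (\<lambda>v. - nq v) (adjoin_sqrt a) (\<lambda>(x, y). x\<^sup>2 - a * y\<^sup>2) (map (\<lambda>v. - nq v) vs)"
  proof (rule norm_multiple_V)
    show "set vs \<subseteq> J.V" using W u_V u' by (simp add: vs_def emb_V)
    show "sorted_wrt (\<lambda>v w. fA v w = 0 \<and> fA v (KI w) = 0) vs"
      using W i_W1 i_W2 u' perp by (simp add: vs_def KI_emb fA_emb)
    show "0 \<notin> set vs"
      using emb_nonzero[OF l(6) W2_zero] emb_nonzero[OF l(7) W2_zero] emb_nonzero[OF W1_zero mW(1)]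
        emb_nonzero[OF W1_zero mW(2)] W u u'(2) m(1)
      by (simp add: vs_def)
    let ?U = "T.span (set (vs @ map KI vs))"
    have U: "{u, u', KI u, KI u'} \<subseteq> ?U" by (auto simp: vs_def intro: T.span_base)
    note G = gen[OF T.subspace_span U]
    have M: "{emb l 0, emb (s \<cdot>\<^sub>1 l) 0, emb (i1 \<cdot>\<^sub>1 l) 0, emb (i1 \<cdot>\<^sub>1 (s \<cdot>\<^sub>1 l)) 0,
        emb 0 m, emb 0 (t \<cdot>\<^sub>2 m), emb 0 (i2 \<cdot>\<^sub>2 m), emb 0 (i2 \<cdot>\<^sub>2 (t \<cdot>\<^sub>2 m))} \<subseteq> ?U"
      using W by (auto simp: vs_def KI_emb intro: T.span_base)
    have "emb p 0 \<in> ?U" if "p \<in> W1" for p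
      by (rule emb_W1_mem[OF st(1,2) l(1-5) T.subspace_span _ that])
        (use M G in auto)
    moreover have "emb 0 q \<in> ?U" if "q \<in> W2" for q
      by (rule emb_W2_mem[OF basis T.subspace_span _ that])
        (use M G in auto)
    ultimately show "J.V \<subseteq> ?U" by (intro V_subset_if T.subspace_span)
  qed
  moreover have "map (\<lambda>v. - nq v) vs = [1, - (N1 s * N2 t), N1 l / n, N1 s * N1 l / n, - N2 m / n, - (N2 t * N2 m) / n]"
    using nq_u u'(3) Q_emb[OF l(6) W2_zero] Q_emb[OF l(7) W2_zero] Q_emb[OF W1_zero mW(1)]
      Q_emb[OF W1_zero mW(2)] by (simp add: vs_def)
  moreover have "- (- (N1 s * N2 t) * (N1 l / n) * (N1 s * N1 l / n) * (- N2 m / n) * (- (N2 t * N2 m) / n))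
      \<in> range (\<lambda>(x, y). x\<^sup>2 - a * y\<^sup>2)"
    \<comment> \<open>All signs cancel and N(s), N(t), N(l), N(m) each occur twice, over n^4: the
      value is a square, hence the norm of its root.\<close>
    by (rule range_eqI[of _ _ "(N1 s * N2 t * N1 l * N2 m / n\<^sup>2, 0)"]) (simp add: power2_eq_square mult_ac)
  ultimately show ?thesis using aniso_V unfolding quadratic_space_E8_def by metis
qed

end

section \<open>Linkage\<close>

context quaternion_pair
begin

lemma pfister_dim_4:
  assumes "dim UNIV = 4"
  shows "isometric_to_diagonal sc UNIV N (tensor_diag (pfister [N i, N s]) (pfister []))"
proof -
  note o = block_orthogonal[OF one_neq_zero]
  show ?thesis
  proof (rule norm.isometric_to_diagonal_orthogonal[OF o])
    show "UNIV = span (set (block one))"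
      using norm.orthogonal_span_UNIV[OF o] assms by (simp add: block_def)
  qed (simp_all add: f_self two block_def tensor_diag_def)
qed

lemma pfister_dim_8:
  assumes "dim UNIV = 8"
  shows "\<exists>m. m \<noteq> 0 \<and> isometric_to_diagonal sc UNIV N (tensor_diag (pfister [N i, N s]) (pfister [m]))"
proof -
  obtain l where l: "l \<noteq> 0" "\<forall>b\<in>set (block one). f l b = 0"
    using norm.orthogonal_extend[OF block_orthogonal[OF one_neq_zero]] assms by (auto simp: block_def)
  \<comment> \<open>Interleaved to match the order of entries in \<open>tensor_diag\<close>.\<close>
  let ?bs = "[one, l, s, s \<cdot> l, i, i \<cdot> l, i \<cdot> s, i \<cdot> (s \<cdot> l)]"
  have "norm.orthogonal (block one @ block l)"
    by (rule two_blocks_orthogonal) (use l in \<open>simp_all add: block_def\<close>)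
  then have o: "norm.orthogonal ?bs"
    by (rule norm.orthogonal_reorder) (auto simp: block_def)
  have "isometric_to_diagonal sc UNIV N (tensor_diag (pfister [N i, N s]) (pfister [N l]))"
  proof (rule norm.isometric_to_diagonal_orthogonal[OF o])
    show "UNIV = span (set ?bs)"
      using norm.orthogonal_span_UNIV[OF o] assms by simp
  qed (simp_all add: f_self two tensor_diag_def mult.assoc)
  then show ?thesis using l by (intro exI[of _ "N l"]) simp
qed

end

text \<open>In each algebra the pair generates a quaternion subalgebra whose norm is the Pfister
  form of the norms of the pair; equal norms make this factor common.\<close>

lemma r_linked_2_if_equal_norms:
  fixes C1 :: "('k::field, 'a::ab_group_add) normed_algebra" and C2 :: "('k, 'b::ab_group_add) normed_algebra"
  assumes A: "anisotropic_composition (scal C1) (mul C1) (unt C1) (nrm C1)"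
    and B: "anisotropic_composition (scal C2) (mul C2) (unt C2) (nrm C2)"
    and dim1: "algebra_dim C1 = 8" and dim2: "algebra_dim C2 = 2 \<or> algebra_dim C2 = 4 \<or> algebra_dim C2 = 8"
    and i1: "i1 \<in> anisotropic_composition.skw (unt C1) (nrm C1)" "i1 \<noteq> 0"
    and i2: "i2 \<in> anisotropic_composition.skw (unt C2) (nrm C2)" "i2 \<noteq> 0" and i: "nrm C1 i1 = nrm C2 i2"
    and s: "s \<in> anisotropic_composition.skw (unt C1) (nrm C1)" "polar (nrm C1) s i1 = 0" "s \<noteq> 0"
    and t: "t \<in> anisotropic_composition.skw (unt C2) (nrm C2)" "polar (nrm C2) t i2 = 0" and st: "nrm C1 s = nrm C2 t"
  shows "r_linked 2 C1 C2"
proof -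
  interpret A: anisotropic_composition "scal C1" "mul C1" "unt C1" "nrm C1" by (rule A)
  interpret B: anisotropic_composition "scal C2" "mul C2" "unt C2" "nrm C2" by (rule B)
  have t0: "t \<noteq> 0" using s(3) st by auto
  interpret QA: quaternion_pair "scal C1" "mul C1" "unt C1" "nrm C1" i1 s
    using i1 s by unfold_locales (simp_all add: A.f_sym[of i1 s])
  interpret QB: quaternion_pair "scal C2" "mul C2" "unt C2" "nrm C2" i2 t
    using i2 t t0 by unfold_locales (simp_all add: B.f_sym[of i2 t])
  obtain m where m: "m \<noteq> 0"
    "isometric_to_diagonal (scal C1) UNIV (nrm C1) (tensor_diag (pfister [nrm C1 i1, nrm C1 s]) (pfister [m]))"
    using QA.pfister_dim_8[OF dim1] by blast
  obtain bs where bs: "0 \<notin> set bs"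
    "isometric_to_diagonal (scal C2) UNIV (nrm C2) (tensor_diag (pfister [nrm C1 i1, nrm C1 s]) (pfister bs))"
  proof -
    \<comment> \<open>Dimension 2 is excluded, since t is nonzero, skew and orthogonal to
      i2.\<close>
    from dim2 consider "algebra_dim C2 = 4" | "algebra_dim C2 = 8"
      using B.skw_perp_zero_if_dim_2 i2 t t0 by blast
    then show ?thesis
    proof cases
      case 1
      then show ?thesis using that[of "[]"] QB.pfister_dim_4 by (simp add: i st)
    next
      case 2
      then obtain m where m: "m \<noteq> 0"
        "isometric_to_diagonal (scal C2) UNIV (nrm C2) (tensor_diag (pfister [nrm C2 i2, nrm C2 t]) (pfister [m]))"
        using QB.pfister_dim_8 by blast
      show ?thesis by (rule that[of "[m]"]) (use m in \<open>simp_all add: i st\<close>)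
    qed
  qed
  show ?thesis
    unfolding r_linked_def
    using m bs i1 s by (intro exI[of _ "[nrm C1 i1, nrm C1 s]"] exI[of _ "[m]"] exI[of _ bs]) simp
qed

section \<open>Composition algebras and their tensor product\<close>

lemma two_neq_zero_if_CHAR:
  assumes "CHAR('k::field) \<noteq> 2" shows "(2::'k) \<noteq> 0"
proof
  assume "(2::'k) = 0"
  then have "of_nat 2 = (0::'k)" by simp
  then have "CHAR('k) dvd 2" by (simp only: of_nat_eq_0_iff_char_dvd)
  then have "CHAR('k) = 1" using assms two_is_prime_nat by (auto simp: prime_nat_iff)
  then show False using of_nat_CHAR[where 'a = 'k] by simp
qed

text \<open>An invertible element of norm 0 would give the unit norm 0, hence every element by
  multiplicativity, contrary to nondegeneracy.\<close>

lemma anisotropic_compositionI: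
  fixes C :: "('k::field, 'a::ab_group_add) normed_algebra"
  assumes C: "composition_algebra C" and one: "unt C \<noteq> 0"
    and inv: "\<And>x. x \<noteq> 0 \<Longrightarrow> \<exists>y. mul C x y = unt C" and two: "(2::'k) \<noteq> 0"
  shows "anisotropic_composition (scal C) (mul C) (unt C) (nrm C)"
proof -
  have v: "vector_space (scal C)" using C by (simp add: composition_algebra_def unital_algebra_def)
  have nm: "nrm C (mul C x y) = nrm C x * nrm C y" for x y using C by (simp add: composition_algebra_def)
  have "x = 0" if "nrm C x = 0" for x
  proof (rule ccontr)
    assume "x \<noteq> 0"
    then obtain y where "mul C x y = unt C" using inv by blast
    then have "nrm C (unt C) = 0" using nm[of x y] that by simp
    then have "nrm C z = 0" for z
      using nm[of "unt C" z] C by (simp add: composition_algebra_def unital_algebra_def)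
    then have "polar (nrm C) (unt C) y = 0" for y by (simp add: polar_def)
    then show False using one C by (auto simp: composition_algebra_def nondegenerate_on_def)
  qed
  then show ?thesis
    using v C one two
    by (intro anisotropic_composition.intro anisotropic_composition_axioms.intro)
      (auto simp: composition_algebra_def unital_algebra_def bilinear_on_def linear_on_def quadratic_form_on_def)
qed

lemma anisotropic_composition_division:
  fixes C :: "('k::field, 'a::ab_group_add) normed_algebra"
  assumes "composition_algebra C" "division_algebra C" "(2::'k) \<noteq> 0"
  shows "anisotropic_composition (scal C) (mul C) (unt C) (nrm C)"
proof (rule anisotropic_compositionI[OF assms(1) _ _ assms(3)])
  show "\<exists>y. mul C x y = unt C" if "x \<noteq> 0" for x
  proof -
    have "surj (mul C x)" using assms(2) that by (simp add: division_algebra_def bij_def)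
    then show ?thesis by (metis surjD)
  qed
qed (use assms(2) in \<open>simp add: division_algebra_def\<close>)

lemma anisotropic_composition_extension:
  fixes C :: "('k::field, 'a::ab_group_add) normed_algebra"
  assumes "composition_algebra C" "separable_quadratic_extension C" "(2::'k) \<noteq> 0"
  shows "anisotropic_composition (scal C) (mul C) (unt C) (nrm C)"
  using assms by (intro anisotropic_compositionI) (auto simp: separable_quadratic_extension_def field_extension_def)

section \<open>Identification of the skew elements and of the bilinear map\<close>

context tensor_pair
begin

lemma polar_fA:
  assumes q: "\<And>s t. s \<in> A.skw \<Longrightarrow> t \<in> B.skw \<Longrightarrow> q (emb s t) = N1 s - N2 t" and x: "x \<in> skS" and y: "y \<in> skS"
  shows "polar q x y = fA x y"
proof -
  note D = skS_D[OF x] skS_D[OF y]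
  have "q (emb (pr1 x + pr1 y) (pr2 x + pr2 y)) = N1 (pr1 x + pr1 y) - N2 (pr2 x + pr2 y)"
    using D by (intro q A.subspace_add[OF A.subspace_skw] B.subspace_add[OF B.subspace_skw])
  then have "q (x + y) = N1 (pr1 x + pr1 y) - N2 (pr2 x + pr2 y)" by (simp add: emb_add D)
  moreover have "q x = N1 (pr1 x) - N2 (pr2 x)" "q y = N1 (pr1 y) - N2 (pr2 y)"
    using q[OF D(1,2)] q[OF D(4,5)] by (simp_all add: D)
  ultimately show ?thesis by (simp add: polar_def fA_def)
qed

text \<open>Split p and q into scalar and skew parts: the products of two parts of the same kind are
  fixed by the involution and cancel, the mixed ones double.\<close>

lemma tn_diff_conj: "p \<otimes> q - A.cj p \<otimes> B.cj q = emb (B.f q one2 *\<^sub>1 A.im p) (A.f p one1 *\<^sub>2 B.im q)"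
proof -
  define c d where "c = A.f p one1 / 2" and "d = B.f q one2 / 2"
  have e: "p = c *\<^sub>1 one1 + A.im p" "A.cj p = c *\<^sub>1 one1 - A.im p"
    "q = d *\<^sub>2 one2 + B.im q" "B.cj q = d *\<^sub>2 one2 - B.im q"
    unfolding c_def d_def by (rule A.im_decomp A.cj_decomp B.im_decomp B.cj_decomp)+
  have f: "A.f p one1 = c + c" "B.f q one2 = d + d" using A.two by (simp_all add: c_def d_def flip: mult_2)
  have "p \<otimes> q - A.cj p \<otimes> B.cj q
      = (c *\<^sub>1 one1 + A.im p) \<otimes> (d *\<^sub>2 one2 + B.im q) - (c *\<^sub>1 one1 - A.im p) \<otimes> (d *\<^sub>2 one2 - B.im q)"
    using e by metis
  also have "\<dots> = emb (d *\<^sub>1 A.im p + d *\<^sub>1 A.im p) (c *\<^sub>2 B.im q + c *\<^sub>2 B.im q)"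
    by (simp add: emb_def tn_add_left tn_add_right tn_diff_left tn_diff_right T.scale_right_distrib
        T.scale_right_diff_distrib)
  finally show ?thesis unfolding f A.scale_left_distrib B.scale_left_distrib .
qed

context
  fixes \<sigma> :: "'t \<Rightarrow> 't"
  assumes lin: "linear_on sT sT UNIV UNIV \<sigma>" and conj_pure: "\<And>p q. \<sigma> (p \<otimes> q) = A.cj p \<otimes> B.cj q"
begin

lemma \<sigma>_add: "\<sigma> (x + y) = \<sigma> x + \<sigma> y" and \<sigma>_scale: "\<sigma> (c *\<^sub>T x) = c *\<^sub>T \<sigma> x"
  using lin by (simp_all add: linear_on_def)

text \<open>Every \<open>z - \<sigma> z\<close> lies in \<open>skS\<close>, and for skew z it equals
  2z.\<close>

lemma skew_eq_skS: "{x. \<sigma> x = - x} = skS"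
proof (intro subset_antisym subsetI)
  fix x assume "x \<in> skS"
  then obtain s t where "x = emb s t" "s \<in> A.skw" "t \<in> B.skw" by (auto simp: skS_def)
  then show "x \<in> {x. \<sigma> x = - x}" by (simp add: emb_def \<sigma>_add conj_pure A.cj_skw B.cj_skw)
next
  have *: "z - \<sigma> z \<in> skS" for z
  proof (induction z rule: tensor_induct)
    case (pure p q)
    show ?case unfolding conj_pure tn_diff_conj
      by (intro emb_mem A.subspace_scale[OF A.subspace_skw] B.subspace_scale[OF B.subspace_skw] A.im_skw B.im_skw)
  next
    case (add x y)
    have "x + y - \<sigma> (x + y) = (x - \<sigma> x) + (y - \<sigma> y)" by (simp add: \<sigma>_add)
    then show ?case by (simp only: T.subspace_add[OF subspace_skS add])
  qed
  fix x assume "x \<in> {x. \<sigma> x = - x}"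
  then have "x + x \<in> skS" using *[of x] by simp
  then have "(1 / 2) *\<^sub>T (2 *\<^sub>T x) \<in> skS"
    using T.subspace_scale[OF subspace_skS] T.scale_left_distrib[of 1 1 x] by simp
  then show "x \<in> skS" using A.two by simp
qed

text \<open>On pure tensors the second term is the conjugate of the first, so
  \<open>tn_diff_conj\<close> applies to their difference.\<close>

lemma bt_conj: "mT x (\<sigma> y) - mT y (\<sigma> x) = bt x y"
proof -
  have bt_add: "bt (x + x') y = bt x y + bt x' y" "bt y (x + x') = bt y x + bt y x'" for x x' y
    using bt_bilinear by (auto simp: bilinear_on_def linear_on_def)
  have 1: "mT (p \<otimes> q) (\<sigma> (p' \<otimes> q')) - mT (p' \<otimes> q') (\<sigma> (p \<otimes> q)) = bt (p \<otimes> q) (p' \<otimes> q')" for p q p' q'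
  proof -
    have "A.f (p \<cdot>\<^sub>1 A.cj p') one1 = A.f p p'" "B.f (q \<cdot>\<^sub>2 B.cj q') one2 = B.f q q'"
      by (simp_all add: A.f_adj_right B.f_adj_right)
    then show ?thesis
      using tn_diff_conj[of "p \<cdot>\<^sub>1 A.cj p'" "q \<cdot>\<^sub>2 B.cj q'"]
      by (simp add: conj_pure mT_tn A.cj_mult B.cj_mult bt_def)
  qed
  have 2: "mT (p \<otimes> q) (\<sigma> y) - mT y (\<sigma> (p \<otimes> q)) = bt (p \<otimes> q) y" for p q
  proof (induction y rule: tensor_induct)
    case (add x y)
    then show ?case by (simp add: \<sigma>_add mT_add_left mT_add_right bt_add algebra_simps flip: add)
  qed (rule 1)
  show ?thesis
  proof (induction x rule: tensor_induct)
    case (add x x')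
    show ?case by (simp add: \<sigma>_add mT_add_left mT_add_right bt_add algebra_simps flip: add)
  qed (rule 2)
qed

end

end

section \<open>Transfer to the given data\<close>

theorem theorem3p20:
  fixes C1 :: "('k::field, 'a::ab_group_add) normed_algebra"
    and C2 :: "('k, 'b::ab_group_add) normed_algebra"
    and T :: "('k, 'a, 'b, 't::ab_group_add) tensor_algebra"
    and i1 :: 'a and i2 :: 'b and a :: 'k and u :: 't
    and S V X0 :: "'t set" and qA Q :: "'t \<Rightarrow> 'k" and e0 e1 r :: 't
    and jm act \<beta> xdot h :: "'t \<Rightarrow> 't \<Rightarrow> 't"
  assumes char: "CHAR('k) \<noteq> 2"
    and C1: "octonion_algebra C1" "division_algebra C1"
    and C2: "composition_algebra C2"
      "separable_quadratic_extension C2 \<or>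
       (quaternion_algebra C2 \<and> division_algebra C2) \<or>
       (octonion_algebra C2 \<and> division_algebra C2)"
    and linkage: "has_linkage_number C1 C2 1"
    and T: "is_tensor_algebra C1 C2 T"
    and i1: "i1 \<in> skew_of C1" "mul C1 i1 i1 = scal C1 a (unt C1)"
    and i2: "i2 \<in> skew_of C2" "mul C2 i2 i2 = scal C2 a (unt C2)"
    and a: "a \<noteq> 0"
    and S: "S = tensor_skew C1 C2 T"
    and qA: "qA = albert_form C1 C2 T"
    and V: "V = {s \<in> S. polar qA s (tens T i1 (unt C2)) = 0 \<and> polar qA s (tens T (unt C1) i2) = 0}"
    and u: "u \<in> V" "u \<noteq> 0"
    and e0: "e0 = tens T i1 (unt C2) + tens T (unt C1) i2"
    and e1: "e1 = scal T (qA u / (4 * a)) (tens T i1 (unt C2) - tens T (unt C1) i2)"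
    and Q: "Q = (\<lambda>v. 1 / qA u * qA v)"
    and jm: "jm = spin_mult (scal T) V Q e0 e1"
    and r: "r = skew_inverse C1 C2 T (e0 + e1)"
    and act: "act = (\<lambda>s x. mul T s (mul T r x))"
    and \<beta>: "\<beta> = (\<lambda>x y. mul T x (tensor_conj C1 C2 T y) - mul T y (tensor_conj C1 C2 T x))"
    and X0: "X0 = {x. act e0 x = x}"
    and xdot: "xdot = (\<lambda>x v. act v (act u x))"
    and h: "h = (\<lambda>x y. \<beta> (act u x) y)"
  shows
    "(special_jordan_module (scal T) S jm (e0 + e1) (scal T) UNIV act \<and>
      (\<forall>x y. \<beta> x y \<in> S) \<and>
      (\<forall>j\<in>S. \<forall>x y. U_op (scal T) jm j (\<beta> x y) = \<beta> (act j x) (act j y)) \<and>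
      (\<forall>j\<in>S. \<forall>x y. jm j (\<beta> x y) = scal T (1/2) (\<beta> (act j x) y + \<beta> x (act j y)))) \<and>
     ((\<forall>x\<in>X0. \<forall>v\<in>V. act (\<beta> (act v x) x) x = act v (act u (act (\<beta> (act u x) x) x))) \<and>
      (\<forall>x\<in>X0. x \<noteq> 0 \<longrightarrow> \<beta> (act u x) x \<noteq> 0)) \<and>
     (quadrangular_algebra (scal T) (scal T) V Q u X0 xdot h \<and>
      (algebra_dim C2 = 2 \<longrightarrow> quadrangular_algebra_E6 (scal T) (scal T) V Q u X0 xdot h) \<and>
      (algebra_dim C2 = 4 \<longrightarrow> quadrangular_algebra_E7 (scal T) (scal T) V Q u X0 xdot h) \<and>
      (algebra_dim C2 = 8 \<longrightarrow> quadrangular_algebra_E8 (scal T) (scal T) V Q u X0 xdot h))"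
proof -
  have two: "(2::'k) \<noteq> 0" by (rule two_neq_zero_if_CHAR[OF char])
  have comp1: "composition_algebra C1" and dim1: "algebra_dim C1 = 8"
    using C1 by (simp_all add: octonion_algebra_def)
  have dim2: "algebra_dim C2 = 2 \<or> algebra_dim C2 = 4 \<or> algebra_dim C2 = 8"
    using C2(2) by (auto simp: separable_quadratic_extension_def quaternion_algebra_def octonion_algebra_def)
  have A: "anisotropic_composition (scal C1) (mul C1) (unt C1) (nrm C1)"
    by (rule anisotropic_composition_division[OF comp1 C1(2) two])
  have B: "anisotropic_composition (scal C2) (mul C2) (unt C2) (nrm C2)"
    using C2(2) anisotropic_composition_division[OF C2(1) _ two] anisotropic_composition_extension[OF C2(1) _ two] by blast
  interpret P: tensor_pair "scal C1" "mul C1" "unt C1" "nrm C1" "scal C2" "mul C2" "unt C2" "nrm C2"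
    "scal T" "mul T" "tens T"
  proof (intro tensor_pair.intro A B tensor_pair_axioms.intro)
    show "is_tensor_product (scal C1) (scal C2) (scal T) (tens T)" using T by (simp add: is_tensor_algebra_def)
    then show "vector_space (scal T)" by (simp add: is_tensor_product_def)
  qed (use T in \<open>simp_all add: is_tensor_algebra_def bilinear_on_def linear_on_def\<close>)
  have cj: "conj_of C1 = P.A.cj" "conj_of C2 = P.B.cj"
    by (simp_all add: fun_eq_iff conj_of_def P.A.cj_def P.B.cj_def)
  have skw: "skew_of C1 = P.A.skw" "skew_of C2 = P.B.skw"
    by (auto simp: skew_of_def cj P.A.skw_iff P.B.skw_iff)
  note conj = tensor_conj_props[OF comp1 C2(1) T, unfolded cj]
  have S_eq: "S = P.skS" unfolding S tensor_skew_def by (rule P.skew_eq_skS[OF conj])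
  have \<beta>_eq: "\<beta> = P.bt" unfolding \<beta> by (intro ext P.bt_conj[OF conj])
  have parts: "skew_parts C1 C2 T (P.emb s t) = (s, t)" if "s \<in> P.A.skw" "t \<in> P.B.skw" for s t
    unfolding skew_parts_def skw P.emb_def[symmetric]
  proof (rule the_equality)
    fix x assume "case x of (s', t') \<Rightarrow> s' \<in> P.A.skw \<and> t' \<in> P.B.skw \<and> P.emb s t = P.emb s' t'"
    then obtain s' t' where x: "x = (s', t')" "s' \<in> P.A.skw" "t' \<in> P.B.skw" "P.emb s t = P.emb s' t'"
      by (cases x) auto
    show "x = (s, t)"
      using P.pr_emb[OF that] P.pr_emb[OF x(2,3)] by (simp add: x(1,4))
  qed (use that in simp)
  have qA_emb: "qA (P.emb s t) = nrm C1 s - nrm C2 t" if "s \<in> P.A.skw" "t \<in> P.B.skw" for s t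
    using parts[OF that] by (simp add: qA albert_form_def)
  have i1s: "i1 \<in> P.A.skw" and i2s: "i2 \<in> P.B.skw" using i1 i2 by (simp_all add: skw)
  have Ni: "nrm C1 i1 = - a" "nrm C2 i2 = - a"
  proof -
    have "scal C1 (nrm C1 i1) (unt C1) = scal C1 (- a) (unt C1)"
      using P.A.skw_sq[OF i1s, of "unt C1"] i1 by simp
    then show "nrm C1 i1 = - a" by (rule P.A.scale_right_imp_eq[rotated]) simp
    have "scal C2 (nrm C2 i2) (unt C2) = scal C2 (- a) (unt C2)"
      using P.B.skw_sq[OF i2s, of "unt C2"] i2 by simp
    then show "nrm C2 i2 = - a" by (rule P.B.scale_right_imp_eq[rotated]) simp
  qed
  have nz: "i1 \<noteq> 0" "i2 \<noteq> 0" using Ni a by auto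
  have z: "0 \<in> P.A.skw" "0 \<in> P.B.skw" by (simp_all add: P.A.skw_def P.B.skw_def)
  have embs: "tens T i1 (unt C2) = P.emb i1 0" "tens T (unt C1) i2 = P.emb 0 i2" by (simp_all add: P.emb_def)
  \<comment> \<open>The form is an orthogonal sum, so each of the two vectors tests one
    component.\<close>
  have V_eq: "V = {x \<in> P.skS. polar (nrm C1) (P.pr1 x) i1 = 0 \<and> polar (nrm C2) (P.pr2 x) i2 = 0}"
    unfolding V S_eq embs using i1s i2s z by (auto simp: P.polar_fA[OF qA_emb] P.fA_def)
  interpret O: octonion_setup "scal C1" "mul C1" "unt C1" "nrm C1" "scal C2" "mul C2" "unt C2" "nrm C2"
    "scal T" "mul T" "tens T" i1 i2 qA u
  proof (intro octonion_setup.intro albert_setup.intro P.tensor_pair_axioms albert_setup_axioms.intro octonion_setup_axioms.intro)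
    show "s = 0" if "s \<in> P.A.skw" "t \<in> P.B.skw" "polar (nrm C1) s i1 = 0" "polar (nrm C2) t i2 = 0" "nrm C1 s = nrm C2 t" for s t
    proof (rule ccontr)
      assume "s \<noteq> 0"
      then have "r_linked 2 C1 C2"
        using r_linked_2_if_equal_norms[OF A B dim1 dim2 i1s nz(1) i2s nz(2) _ that(1,3) _ that(2,4,5)] by (simp add: Ni)
      then show False using linkage by (simp add: has_linkage_number_def numeral_2_eq_2)
    qed
  qed (use i1s i2s nz Ni qA_emb u V_eq dim1 dim2 in auto)
  have a_eq: "O.a = a" by (simp add: O.a_def Ni)
  have e0_eq: "e0 = O.e0" by (simp add: e0 O.e0_def P.emb_def)
  have e1_eq: "e1 = O.e1" by (simp add: e1 O.e1_def P.emb_def a_eq O.n_def)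
  \<comment> \<open>Both e0 and e1 are isotropic, so only the pairing \<open>fA e0 e1 = - n\<close>
    contributes.\<close>
  have "2 * qA (e0 + e1) = 2 * - O.n"
    using O.qA_fA[OF O.e_mem(3)] by (simp add: e0_eq e1_eq P.fA_add_left P.fA_add_right O.fA_e)
  then have "qA (e0 + e1) = - O.n" using two unfolding mult_cancel_left by blast
  moreover have "skew_natural C1 C2 T (e0 + e1) = P.nat (e0 + e1)"
  proof -
    note D = P.skS_D[OF O.e_mem(3)]
    show ?thesis
      using parts[OF D(1,2), unfolded D(3)] by (simp add: skew_natural_def e0_eq e1_eq P.nat_def P.emb_def)
  qed
  ultimately have r_eq: "r = O.r"
    by (simp add: r skew_inverse_def O.r_def e0_eq e1_eq flip: qA)
  have act_eq: "act = O.act" by (simp add: fun_eq_iff act r_eq O.act_def)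
  have V_J: "V = O.J.V" 
  proof (rule set_eqI)
    show "x \<in> V \<longleftrightarrow> x \<in> O.J.V" for x
      unfolding O.V_iff V_eq O.W1_def O.W2_def using P.skS_D(1,2)[of x] by blast
  qed
  have Q_eq: "Q = (\<lambda>v. - O.nq v)" by (simp add: fun_eq_iff Q O.nq_def O.n_def)
  have X0_eq: "X0 = O.J.X0" by (simp add: X0 O.J.X0_def act_eq e0_eq)
  have jm_eq: "jm x y = O.J.jprod x y" if "x \<in> S" "y \<in> S" for x y
    unfolding jm V_J Q_eq e0_eq e1_eq using that by (intro O.J.spin_mult) (simp_all add: S_eq)
  have U_eq: "U_op (scal T) jm x y = U_op (scal T) O.J.jprod x y" if "x \<in> S" "y \<in> S" for x y
    using that by (simp add: U_op_def jm_eq S_eq)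
  have quad: "quadrangular_algebra (scal T) (scal T) V Q u X0 xdot h"
    using jordan_spin_base.quadrangular[OF O.spin_base] unfolding xdot h act_eq \<beta>_eq X0_eq Q_eq V_J .
  have part1: "special_jordan_module (scal T) S jm (e0 + e1) (scal T) UNIV act"
    unfolding S_eq act_eq e0_eq e1_eq by (rule O.J.special_module) (simp add: jm_eq S_eq)
  have dimX: "vector_space.dim (scal T) X0 = 4 * algebra_dim C2" unfolding X0_eq by (rule O.dim_X0_eq)
  have E6: "algebra_dim C2 = 2 \<longrightarrow> quadrangular_algebra_E6 (scal T) (scal T) V Q u X0 xdot h"
    using quad dimX O.type_E6 by (simp add: quadrangular_algebra_E6_def V_J Q_eq)
  have E7: "algebra_dim C2 = 4 \<longrightarrow> quadrangular_algebra_E7 (scal T) (scal T) V Q u X0 xdot h"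
    using quad dimX O.type_E7 by (simp add: quadrangular_algebra_E7_def V_J Q_eq)
  have E8: "algebra_dim C2 = 8 \<longrightarrow> quadrangular_algebra_E8 (scal T) (scal T) V Q u X0 xdot h"
    using quad dimX O.type_E8 by (simp add: quadrangular_algebra_E8_def V_J Q_eq)
  have mem: "\<beta> x y \<in> S" for x y by (simp add: S_eq \<beta>_eq)
  have U: "U_op (scal T) jm j (\<beta> x y) = \<beta> (act j x) (act j y)" if "j \<in> S" for j x y
    using O.J.\<beta>_U[of j x y] that U_eq[OF that mem] by (simp add: S_eq \<beta>_eq act_eq)
  have der: "jm j (\<beta> x y) = scal T (1/2) (\<beta> (act j x) y + \<beta> x (act j y))" if "j \<in> S" for j x y
    using O.J.\<beta>_jprod[of j x y] that jm_eq[OF that mem] by (simp add: S_eq \<beta>_eq act_eq)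
  have cub: "act (\<beta> (act v x) x) x = act v (act u (act (\<beta> (act u x) x) x))" if "x \<in> X0" "v \<in> V" for x v
    using that unfolding X0_eq V_J act_eq \<beta>_eq by (rule O.cubic)
  have reg: "\<beta> (act u x) x \<noteq> 0" if "x \<in> X0" "x \<noteq> 0" for x
    using O.regular[of x] that unfolding X0_eq act_eq \<beta>_eq by blast
  show ?thesis using part1 mem U der cub reg quad E6 E7 E8 by blast
qed

end
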